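(* Let $d'\geq 2$, $t\geq 2$ and $n\geq 3$ be integers with $t\mid d'$, and let $A_1,\ldots,A_n$ be $n$ nontrivial partitions of $2d'$ of the form $$A_1=[2a_{11},\ldots,2a_{1r_1}],\quad A_2=[2a_{21},\ldots,2a_{2r_2}],\quad A_3=[ta_{31},\ldots,ta_{3r_3}],$$ $$A_k=[a_{k1},\ldots,a_{kr_k}]\quad (4\leq k\leq n),$$ where all $a_{kl}\geq 1$ are integers, satisfying $\sum_{k=1}^{n}r_k=2(n-2)d'+2$. Then the following are equivalent: (1) There exists a branched cover $f:S^2\to S^2$ of degree $2d'$ with branching data $\mathcal{D}=\{A_1,\ldots,A_n\}$. (2) There exist - a decomposition of $[a_{31},\ldots,a_{3r_3}]$ into two partitions of $d'/t$, - a decomposition of each of $[a_{11},\ldots,a_{1r_1}]$ and $[a_{21},\ldots,a_{2r_2}]$ into $t$ partitions of $d'/t$, - a decomposition of each $A_k$ ($4\leq k\leq n$) into $2t$ partitions of $d'/t$, such that there exists a branched cover $g:S^2\to S^2$ of degree $d'/t$ whose branching data consists of all the partitions of $d'/t$ occurring in these decompositions.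
   Context: A branched cover $f:Y\to X$ between compact, connected, orientable surfaces is a surjective map that is locally modeled on the power maps $\mathbb{C}\ni z\mapsto z^m\in\mathbb{C}$ for positive integers $m$; $m$ is the local degree at the preimage point corresponding to $0$. A point of $X$ having a preimage of local degree greater than $1$ is a branch point; there are finitely many of them. Removing the branch points and their preimages gives a genuine covering map, whose degree $d$ is called the degree of $f$. A partition of $d$ is a multiset $[b_1,\ldots,b_r]$ of positive integers with sum $d$; it is nontrivial if at least one part is greater than $1$. The local degrees at the preimages of each branch point form a nontrivial partition of $d$. If $f$ has $n$ branch points, with corresponding partitions $A_1,\ldots,A_n$, then $\{A_1,\ldots,A_n\}$ (counted with multiplicity) is the branching data of $f$. When a list of partitions prescribing branching data contains trivial partitions $[1,\ldots,1]$, these correspond to non-branch points and are disregarded. Decomposing a partition $A$ of $md$ into $m$ partitions of $d$ means writing the multiset $A$ as the multiset union of $m$ multisets, each with sum $d$. *)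

theory Defs
  imports "HOL-Analysis.Analysis" "HOL-Library.Multiset"
begin

section \<open>Branched covers\<close>

text \<open>
  Surfaces are subsets of topological spaces with the subspace topology. Only
  \<open>Y = X = S\<^sup>2\<close> is used below, so compactness, connectedness and orientability of
  \<open>Y\<close> and \<open>X\<close> are not hypotheses of the definitions. The finiteness of fibres and of the
  set of branch points, the uniqueness of local degrees and the constancy of the fibre
  cardinality off the branch points all rely on them.
\<close>

text \<open>Near \<open>y\<close>, in charts onto the complex plane centred at \<open>y\<close> and \<open>f y\<close>, \<open>f\<close> is \<open>z \<mapsto> z ^ m\<close>.\<close>

definition locally_power ::
  "'a::topological_space set \<Rightarrow> 'b::topological_space set \<Rightarrow> ('a \<Rightarrow> 'b) \<Rightarrow> 'a \<Rightarrow> nat \<Rightarrow> bool" where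
  "locally_power Y X f y m \<longleftrightarrow> m > 0 \<and>
     (\<exists>U V \<phi> \<phi>' \<psi> \<psi>'.
        openin (top_of_set Y) U \<and> y \<in> U \<and> openin (top_of_set X) V \<and> f ` U \<subseteq> V \<and>
        homeomorphism U (UNIV :: complex set) \<phi> \<phi>' \<and> \<phi> y = 0 \<and>
        homeomorphism V (UNIV :: complex set) \<psi> \<psi>' \<and> \<psi> (f y) = 0 \<and>
        (\<forall>u\<in>U. \<psi> (f u) = \<phi> u ^ m))"

definition branched_cover ::
  "'a::topological_space set \<Rightarrow> 'b::topological_space set \<Rightarrow> ('a \<Rightarrow> 'b) \<Rightarrow> bool" where
  "branched_cover Y X f \<longleftrightarrow>
     continuous_on Y f \<and> f ` Y = X \<and> (\<forall>y\<in>Y. \<exists>m. locally_power Y X f y m)"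

definition local_degree ::
  "'a::topological_space set \<Rightarrow> 'b::topological_space set \<Rightarrow> ('a \<Rightarrow> 'b) \<Rightarrow> 'a \<Rightarrow> nat" where
  "local_degree Y X f y = (THE m. locally_power Y X f y m)"

definition branch_points ::
  "'a::topological_space set \<Rightarrow> 'b::topological_space set \<Rightarrow> ('a \<Rightarrow> 'b) \<Rightarrow> 'b set" where
  "branch_points Y X f = {x \<in> X. \<exists>y\<in>Y. f y = x \<and> local_degree Y X f y > 1}"

text \<open>
  The degree of the covering map obtained by removing the branch points and their
  preimages. Since \<open>card\<close> of an infinite set is \<open>0\<close>, \<open>d > 0\<close> makes these fibres finite.
\<close>

definition has_degree ::
  "'a::topological_space set \<Rightarrow> 'b::topological_space set \<Rightarrow> ('a \<Rightarrow> 'b) \<Rightarrow> nat \<Rightarrow> bool" where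
  "has_degree Y X f d \<longleftrightarrow>
     d > 0 \<and> (\<forall>x \<in> X - branch_points Y X f. card {y \<in> Y. f y = x} = d)"

definition local_degrees_over ::
  "'a::topological_space set \<Rightarrow> 'b::topological_space set \<Rightarrow> ('a \<Rightarrow> 'b) \<Rightarrow> 'b \<Rightarrow> nat multiset" where
  "local_degrees_over Y X f x = image_mset (local_degree Y X f) (mset_set {y \<in> Y. f y = x})"

definition branching_data ::
  "'a::topological_space set \<Rightarrow> 'b::topological_space set \<Rightarrow> ('a \<Rightarrow> 'b) \<Rightarrow> nat multiset multiset" where
  "branching_data Y X f = image_mset (local_degrees_over Y X f) (mset_set (branch_points Y X f))"

abbreviation S2 :: "(real ^ 3) set" where
  "S2 \<equiv> sphere 0 1"

section \<open>Partitions\<close>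

definition partition_of :: "nat \<Rightarrow> nat multiset \<Rightarrow> bool" where
  "partition_of d A \<longleftrightarrow> (\<forall>b \<in># A. b > 0) \<and> sum_mset A = d"

definition nontrivial :: "nat multiset \<Rightarrow> bool" where
  "nontrivial A \<longleftrightarrow> (\<exists>b \<in># A. b > 1)"

text \<open>\<open>P\<close> collects, with multiplicity, the \<open>m\<close> partitions of \<open>d\<close> into which \<open>A\<close> is decomposed.\<close>

definition decomposition :: "nat multiset \<Rightarrow> nat \<Rightarrow> nat \<Rightarrow> nat multiset multiset \<Rightarrow> bool" where
  "decomposition A m d P \<longleftrightarrow> size P = m \<and> (\<forall>p \<in># P. partition_of d p) \<and> sum_mset P = A"

text \<open>
  A list of partitions \<open>D\<close> prescribing branching data may contain trivial partitions, which
  are disregarded.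
\<close>

definition realized_on_S2 :: "nat \<Rightarrow> nat multiset multiset \<Rightarrow> bool" where
  "realized_on_S2 d D \<longleftrightarrow>
     (\<exists>f. branched_cover S2 S2 f \<and> has_degree S2 S2 f d \<and>
          branching_data S2 S2 f = filter_mset nontrivial D)"

end

theory Submission
  imports Defs
begin

text \<open>
  Write \<open>x\<^sub>k\<close> for the point of the target with partition \<open>A k\<close>. Local degrees divisible by
  \<open>2, 2, t\<close> over \<open>x\<^sub>1, x\<^sub>2, x\<^sub>3\<close> say that \<open>f\<close> is a map to the orbifold with these three cone
  points, whose universal cover is the quotient map \<open>h : S\<^sup>2 \<rightarrow> S\<^sup>2\<close> by the dihedral group of order
  \<open>2t\<close>. As the source of \<open>f\<close> is simply connected, \<open>f = h \<circ> g\<close>. The map \<open>h\<close> has \<open>t\<close> points of local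
  degree \<open>2\<close> over each of \<open>x\<^sub>1\<close> and \<open>x\<^sub>2\<close>, two points of local degree \<open>t\<close> over \<open>x\<^sub>3\<close>, and \<open>2t\<close>
  unramified points over every other point. Local degrees multiply, so \<open>A k\<close> is the union over
  \<open>w \<in> h\<^sup>-\<^sup>1(x\<^sub>k)\<close> of the partitions of \<open>g\<close> over \<open>w\<close>, scaled by \<open>2, 2, t\<close> or \<open>1\<close>
  (\<open>local_degrees_over_compose\<close>). This is the required decomposition. Conversely, given \<open>g\<close>, a
  homeomorphism of the sphere moves its branch points to those points of the fibres of \<open>h\<close> that the
  decomposition assigns to them, and composing with \<open>h\<close> realizes the \<open>A k\<close>.

  The map \<open>h\<close> and the factorization through it are built from power maps
  (\<open>dihedral_cover\<close>): \<open>h\<close> is a map \<open>z \<mapsto> z ^ t\<close> followed by a map \<open>z \<mapsto> z\<^sup>2\<close>. The coordinate of the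
  squaring map has its zero and its pole at \<open>x\<^sub>1\<close> and \<open>x\<^sub>2\<close>; the two preimages of \<open>x\<^sub>3\<close> under it
  are the zero and the pole of the coordinate of the other map. Lifting \<open>f\<close> through \<open>z \<mapsto> z ^ m\<close>
  means finding a continuous \<open>m\<close>-th root of the coordinate of \<open>f\<close>
  (\<open>lift_through_power_map\<close>). Near a zero or a pole it exists because the local degree is divisible
  by \<open>m\<close>; two roots on a connected set differ by a constant, so roots on two open sets with connected
  intersection can be glued (\<open>has_root_Un\<close>); and the punctured sphere is assembled in this way from
  contractible sets and punctured discs.

  The maps are not holomorphic: the charts of \<open>f\<close> and of \<open>h\<close> at a common point are related by
  a mere local homeomorphism \<open>\<tau>\<close>. What makes local power maps composable, and divisible, is that
  \<open>\<tau> (z ^ m) = r z ^ m\<close> for another local homeomorphism \<open>r\<close>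
  (\<open>root_of_local_homeomorphism\<close>), because \<open>\<tau>\<close> winds exactly once around its centre, in one
  direction or the other. Local degrees are well defined because they count nearby preimages
  (\<open>locally_power_count\<close>), and for the same reason their sum over a fibre is the degree
  (\<open>sum_local_degrees_constant\<close>).
\<close>

section \<open>Continuous roots of local homeomorphisms of the plane\<close>

lemma continuous_Ints_constant:
  fixes D :: "'a::topological_space \<Rightarrow> complex"
  assumes "connected S" "continuous_on S D" and int: "\<And>x. x \<in> S \<Longrightarrow> D x \<in> \<int>"
  shows "D constant_on S"
proof (rule continuous_discrete_range_constant[OF assms(1,2)])
  fix x assume x: "x \<in> S"
  have "1 \<le> norm (D y - D x)" if y: "y \<in> S" "D y \<noteq> D x" for y
  proof -
    obtain i j :: int where ij: "D y = of_int i" "D x = of_int j"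
      using int[OF x] int[OF y(1)] by (metis Ints_cases)
    then have "norm (D y - D x) = of_int \<bar>i - j\<bar>" by (simp flip: of_int_diff)
    moreover have "i \<noteq> j" using ij y(2) by auto
    ultimately show ?thesis by simp
  qed
  then show "\<exists>e>0. \<forall>y. y \<in> S \<and> D y \<noteq> D x \<longrightarrow> e \<le> norm (D y - D x)"
    by (intro exI[of _ 1]) auto
qed

text \<open>
  The quotient of the two functions is continuous and takes values in the finite set of roots of unity.
\<close>

lemma nth_roots_proportional:
  fixes r s :: "'a::topological_space \<Rightarrow> complex"
  assumes conn: "connected S" and r: "continuous_on S r" and s: "continuous_on S s"
    and eq: "\<And>x. x \<in> S \<Longrightarrow> r x ^ m = s x ^ m" and nz: "\<And>x. x \<in> S \<Longrightarrow> s x \<noteq> 0" and m: "m > 0"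
  obtains \<zeta> where "\<zeta> ^ m = 1" "\<And>x. x \<in> S \<Longrightarrow> r x = \<zeta> * s x"
proof (cases "S = {}")
  case True
  show ?thesis by (rule that[of 1]) (simp_all add: True)
next
  case False
  then obtain x0 where x0: "x0 \<in> S" by blast
  have quot: "(r x / s x) ^ m = 1" if "x \<in> S" for x
    using eq[OF that] nz[OF that] by (simp add: power_divide)
  have "continuous_on S (\<lambda>x. r x / s x)" using nz by (intro continuous_intros r s) auto
  moreover have "finite ((\<lambda>x. r x / s x) ` S)"
    by (rule finite_subset[OF _ finite_nth_roots[OF m, of 1]]) (use quot in auto)
  ultimately have "(\<lambda>x. r x / s x) constant_on S" by (rule continuous_finite_range_constant[OF conn])
  then obtain \<zeta> where \<zeta>: "\<And>x. x \<in> S \<Longrightarrow> r x / s x = \<zeta>" by (auto simp: constant_on_def)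
  show ?thesis
  proof (rule that[of \<zeta>])
    show "\<zeta> ^ m = 1" using quot[OF x0] \<zeta>[OF x0] by simp
    show "r x = \<zeta> * s x" if "x \<in> S" for x using \<zeta>[OF that] nz[OF that] by (simp add: field_simps)
  qed
qed

text \<open>
  The logarithm \<open>T\<close> of \<open>\<tau> \<circ> exp\<close> exists because a half-plane is contractible. The increment of \<open>T\<close>
  over a period of \<open>exp\<close> is a continuous function with values in the multiples of \<open>2 \<pi> \<i>\<close>, hence
  constant; \<open>e\<close> is the winding number of \<open>\<tau>\<close> around \<open>0\<close>.
\<close>

lemma logarithm_along_exp:
  fixes \<tau> :: "complex \<Rightarrow> complex"
  assumes R: "R > 0" and cont: "continuous_on (ball 0 R) \<tau>"
    and nz: "\<And>z. z \<in> ball 0 R \<Longrightarrow> z \<noteq> 0 \<Longrightarrow> \<tau> z \<noteq> 0"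
  obtains T and e :: int where
    "continuous_on {s. Re s < ln R} T"
    "\<And>s. Re s < ln R \<Longrightarrow> exp (T s) = \<tau> (exp s)"
    "\<And>s k. Re s < ln R \<Longrightarrow>
       T (s + of_int k * (of_real (2 * pi) * \<i>)) = T s + of_int (k * e) * (of_real (2 * pi) * \<i>)"
proof -
  define H where "H = {s. Re s < ln R}"
  define p where "p = of_real (2 * pi) * \<i>"
  have p0: "p \<noteq> 0" by (simp add: p_def)
  have cH: "convex H" unfolding H_def by (rule convex_halfspace_Re_lt)
  have inb: "exp s \<in> ball 0 R" if "s \<in> H" for s
    using that R by (simp add: H_def) (metis exp_less_cancel_iff exp_ln)
  have "continuous_on H (\<lambda>s. \<tau> (exp s))"
    by (rule continuous_on_compose2[OF cont]) (auto intro!: continuous_intros inb)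
  then obtain T where T: "continuous_on H T" "\<And>s. s \<in> H \<Longrightarrow> \<tau> (exp s) = exp (T s)"
    using continuous_logarithm_on_contractible[of H "\<lambda>s. \<tau> (exp s)"] convex_imp_contractible[OF cH] nz inb
    by (metis exp_not_eq_zero)
  have expp: "exp (s + of_int k * p) = exp s" for s k
    by (simp add: exp_eq p_def)
  have sh: "s + of_int k * p \<in> H \<longleftrightarrow> s \<in> H" for s k by (simp add: H_def p_def)
  have sh1: "s + p \<in> H \<longleftrightarrow> s \<in> H" for s using sh[of s 1] by simp
  define D where "D s = (T (s + p) - T s) / p" for s
  have Dint: "D s \<in> \<int>" if "s \<in> H" for s
  proof -
    have "exp (T (s + p)) = exp (T s)"
      using T(2)[OF that] T(2)[of "s + p"] sh1[of s] that expp[of s 1] by simp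
    then obtain n :: int where "T (s + p) = T s + of_int (2 * n) * pi * \<i>"
      by (auto simp: exp_eq)
    then have "D s = of_int n" using p0 by (simp add: D_def p_def field_simps)
    then show ?thesis by simp
  qed
  have contD: "continuous_on H D" unfolding D_def
  proof (intro continuous_intros T(1) p0)
    show "continuous_on H (\<lambda>x. T (x + p))"
      by (rule continuous_on_compose2[OF T(1)]) (auto intro!: continuous_intros simp: sh1)
  qed (use p0 in auto)
  have "D constant_on H" by (rule continuous_Ints_constant[OF convex_connected[OF cH] contD Dint])
  then obtain c where c: "\<And>s. s \<in> H \<Longrightarrow> D s = c" by (auto simp: constant_on_def)
  have "complex_of_real (ln R - 1) \<in> H" by (simp add: H_def)
  then obtain e :: int where e: "c = of_int e" using c Dint by (metis Ints_cases)
  have step: "T (s + p) = T s + of_int e * p" if "s \<in> H" for s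
    using c[OF that] p0 by (simp add: D_def e field_simps)
  have "T (s + of_int k * p) = T s + of_int (k * e) * p" if "s \<in> H" for s k
  proof (induction k rule: int_induct[of _ 0])
    case base then show ?case by simp
  next
    case (step1 i)
    have "T (s + of_int (i + 1) * p) = T ((s + of_int i * p) + p)" by (simp add: algebra_simps)
    also have "\<dots> = T (s + of_int i * p) + of_int e * p" by (rule step) (simp add: sh that)
    finally show ?case using step1 by (simp add: algebra_simps)
  next
    case (step2 i)
    have "T (s + of_int i * p) = T ((s + of_int (i - 1) * p) + p)" by (simp add: algebra_simps)
    also have "\<dots> = T (s + of_int (i - 1) * p) + of_int e * p" by (rule step) (simp only: sh that)
    finally show ?case using step2 by (simp add: algebra_simps)
  qed
  then show ?thesis using that[of T e] T by (auto simp: H_def p_def)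
qed

text \<open>
  With \<open>T\<close> as in \<open>logarithm_along_exp\<close>, the expression \<open>exp (T (m s) / m)\<close> depends only on
  \<open>z = exp s\<close> and is an \<open>m\<close>-th root of \<open>\<tau> (z ^ m)\<close>. Points \<open>z\<close> with equal powers differ by an
  \<open>m\<close>-th root of unity, and \<open>r\<close> turns this root into its \<open>e\<close>-th power. Hence injectivity of \<open>r\<close> needs
  \<open>e\<close> to be prime to \<open>m\<close>; in fact \<open>e\<close> is \<open>1\<close> or \<open>-1\<close>.
\<close>

lemma root_of_local_homeomorphism:
  fixes \<tau> :: "complex \<Rightarrow> complex"
  assumes R: "R > 0" and cont: "continuous_on (ball 0 R) \<tau>" and inj: "inj_on \<tau> (ball 0 R)"
    and zero: "\<tau> 0 = 0" and m: "m > 0"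
  obtains r where "continuous_on (ball 0 (root m R)) r" "inj_on r (ball 0 (root m R))"
    "r 0 = 0" "\<And>z. z \<in> ball 0 (root m R) \<Longrightarrow> r z ^ m = \<tau> (z ^ m)"
proof -
  define p where "p = of_real (2 * pi) * \<i>"
  have p0: "p \<noteq> 0" by (simp add: p_def)
  have expp: "exp (s + of_int k * p) = exp s" for s k
    by (simp add: exp_eq p_def)
  have exp_eq_p: "exp w = exp z \<Longrightarrow> \<exists>n::int. w = z + of_int n * p" for w z
    by (auto simp: exp_eq p_def)
  have nz: "\<tau> z \<noteq> 0" if "z \<in> ball 0 R" "z \<noteq> 0" for z
    using inj that zero R by (auto simp: inj_on_def)
  obtain T and e :: int where T: "continuous_on {s. Re s < ln R} T"
    "\<And>s. Re s < ln R \<Longrightarrow> exp (T s) = \<tau> (exp s)"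
    "\<And>s k. Re s < ln R \<Longrightarrow> T (s + of_int k * p) = T s + of_int (k * e) * p"
    using logarithm_along_exp[OF R cont] nz unfolding p_def by metis
  \<comment> \<open>The inverse winds around the origin as well, and the two winding numbers multiply to 1.\<close>
  have e1: "\<bar>e\<bar> = 1"
  proof -
    define \<sigma> where "\<sigma> = inv_into (ball 0 R) \<tau>"
    have op: "open (\<tau> ` ball 0 R)" using invariance_of_domain[OF cont _ inj] by simp
    have "0 \<in> \<tau> ` ball 0 R" using zero R by force
    with op obtain R' where R': "R' > 0" "ball 0 R' \<subseteq> \<tau> ` ball 0 R"
      by (meson openE)
    have c\<sigma>: "continuous_on (ball 0 R') \<sigma>"
      using continuous_on_inverse_open[of "ball 0 R" \<tau> \<sigma>] cont inj R'(2)
      by (metis (no_types, lifting) \<sigma>_def continuous_on_subset dual_order.refl inv_into_f_f open_ball)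
    have \<sigma>nz: "\<sigma> z \<noteq> 0" if "z \<in> ball 0 R'" "z \<noteq> 0" for z
      using that R'(2) zero unfolding \<sigma>_def by (metis f_inv_into_f subsetD)
    obtain T' and e' :: int where T': "continuous_on {s. Re s < ln R'} T'"
      "\<And>s. Re s < ln R' \<Longrightarrow> exp (T' s) = \<sigma> (exp s)"
      "\<And>s k. Re s < ln R' \<Longrightarrow> T' (s + of_int k * p) = T' s + of_int (k * e') * p"
      using logarithm_along_exp[OF R'(1) c\<sigma>] \<sigma>nz unfolding p_def by metis
    have "isCont \<tau> 0" using cont R by (simp add: continuous_on_eq_continuous_at)
    then obtain \<delta> where \<delta>: "\<delta> > 0" "\<And>z. norm z < \<delta> \<Longrightarrow> norm (\<tau> z) < R'"
      using R'(1) zero by (auto simp: continuous_at_eps_delta dist_norm)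
    define b where "b = min (ln R) (ln \<delta>)"
    define B where "B = {s. Re s < b}"
    have cB: "convex B" unfolding B_def by (rule convex_halfspace_Re_lt)
    have Bd: "Re s < ln R" "norm (exp s) < \<delta>" "norm (exp s) < R" "Re (T s) < ln R'" if "s \<in> B" for s
    proof -
      show s: "Re s < ln R" using that by (simp add: B_def b_def)
      show "norm (exp s) < R" using s R by simp (metis exp_less_cancel_iff exp_ln)
      have "Re s < ln \<delta>" using that by (simp add: B_def b_def)
      then show "norm (exp s) < \<delta>" using \<delta>(1) by simp (metis exp_less_cancel_iff exp_ln)
      then have "norm (exp (T s)) < R'" using \<delta>(2) T(2)[OF s] by simp
      then show "Re (T s) < ln R'" using R'(1) by simp (metis exp_less_cancel_iff exp_ln)
    qed
    define D where "D s = (T' (T s) - s) / p" for s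
    have Dint: "\<exists>n::int. T' (T s) = s + of_int n * p" if "s \<in> B" for s
    proof (rule exp_eq_p)
      have "exp (T' (T s)) = \<sigma> (\<tau> (exp s))" using T'(2) T(2) Bd[OF that] by simp
      also have "\<dots> = exp s" using Bd[OF that] inj by (simp add: \<sigma>_def)
      finally show "exp (T' (T s)) = exp s" .
    qed
    have contD: "continuous_on B D" unfolding D_def
    proof (intro continuous_intros p0)
      show "continuous_on B (\<lambda>x. T' (T x))"
        by (rule continuous_on_compose2[OF T'(1)])
           (auto intro!: continuous_on_subset[OF T(1)] simp: Bd)
    qed (use p0 in auto)
    have "D s \<in> \<int>" if "s \<in> B" for s using Dint[OF that] p0 by (auto simp: D_def)
    then have "D constant_on B" by (rule continuous_Ints_constant[OF convex_connected[OF cB] contD])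
    then obtain c where c: "\<And>s. s \<in> B \<Longrightarrow> D s = c" by (auto simp: constant_on_def)
    define s :: complex where "s = of_real (b - 1)"
    have sB: "s \<in> B" "s + p \<in> B" by (simp_all add: s_def B_def p_def)
    have "T (s + p) = T s + of_int e * p" using T(3)[of s 1] Bd[OF sB(1)] by simp
    moreover have "T' (T s + of_int e * p) = T' (T s) + of_int (e * e') * p"
      using T'(3) Bd[OF sB(1)] by blast
    ultimately have "T' (T (s + p)) - T' (T s) = of_int (e * e') * p" by simp
    moreover have "T' (T (s + p)) - T' (T s) = p"
      using c[OF sB(1)] c[OF sB(2)] p0 by (simp add: D_def field_simps)
    ultimately have "of_int (e * e') = (1::complex)" using p0 by simp
    then have "e * e' = 1" by (metis of_int_eq_1_iff)
    then show ?thesis by (metis abs_zmult_eq_1 abs_1)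
  qed
  define \<rho> where "\<rho> = root m R"
  have \<rho>: "\<rho> > 0" "\<rho> ^ m = R" using R m by (simp_all add: \<rho>_def)
  have ln\<rho>: "ln R = m * ln \<rho>" using \<rho> ln_realpow[of \<rho> m] by simp
  have Re_m: "Re (of_nat m * s) < ln R" if "Re s < ln \<rho>" for s
    using that m by (simp add: ln\<rho>)
  \<comment> \<open>The principal branch jumps across the negative axis, but by the shift rule for T the value
    of r is the same for every logarithm of z.\<close>
  define r where "r z = (if z = 0 then 0 else exp (T (of_nat m * Ln z) / of_nat m))" for z
  have r_exp: "r (exp s) = exp (T (of_nat m * s) / of_nat m)" if s: "Re s < ln \<rho>" for s
  proof -
    obtain n :: int where n: "Ln (exp s) = s + of_int n * p" using exp_eq_p by (metis exp_Ln exp_not_eq_zero)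
    have "T (of_nat m * Ln (exp s)) = T (of_nat m * s + of_int (int m * n) * p)"
      by (simp add: n algebra_simps)
    also have "\<dots> = T (of_nat m * s) + of_int (int m * n * e) * p" by (rule T(3)) (rule Re_m[OF s])
    finally have "T (of_nat m * Ln (exp s)) / of_nat m = T (of_nat m * s) / of_nat m + of_int (n * e) * p"
      using m by (simp add: field_simps)
    then show ?thesis unfolding r_def by (simp only: expp exp_not_eq_zero if_False)
  qed
  have log: "\<exists>s. z = exp s \<and> Re s < ln \<rho>" if "z \<in> ball 0 \<rho>" "z \<noteq> 0" for z
    using that \<rho> by (intro exI[of _ "Ln z"]) (auto)
  have pow: "r z ^ m = \<tau> (z ^ m)" if "z \<in> ball 0 \<rho>" for z
  proof (cases "z = 0")
    case True then show ?thesis using m zero by (simp add: r_def zero_power)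
  next
    case False
    then obtain s where s: "z = exp s" "Re s < ln \<rho>" using log \<open>z \<in> ball 0 \<rho>\<close> by blast
    have "r z ^ m = exp (T (of_nat m * s))"
      using m by (simp add: s(1) r_exp[OF s(2)] flip: exp_of_nat_mult)
    also have "\<dots> = \<tau> (exp (of_nat m * s))" by (rule T(2)) (rule Re_m[OF s(2)])
    finally show ?thesis by (simp add: s(1) exp_of_nat_mult)
  qed
  have contr: "continuous_on (ball 0 \<rho>) r"
  proof (rule continuous_at_imp_continuous_on, intro ballI)
    fix z :: complex assume z: "z \<in> ball 0 \<rho>"
    show "isCont r z"
    proof (cases "z = 0")
      case True
      have "((\<lambda>w. \<tau> (w ^ m)) \<longlongrightarrow> \<tau> (0 ^ m)) (at 0)"
      proof -
        have "isCont \<tau> (0 ^ m)" using cont R m by (simp add: continuous_on_eq_continuous_at zero_power)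
        then have "isCont (\<lambda>w. \<tau> (w ^ m)) 0"
          using isCont_o2[of 0 "\<lambda>w. w ^ m" \<tau>] by (auto intro!: continuous_intros)
        then show ?thesis by (simp add: isCont_def)
      qed
      then have "((\<lambda>w. root m (norm (\<tau> (w ^ m)))) \<longlongrightarrow> root m (norm (\<tau> (0 ^ m)))) (at 0)"
        by (intro tendsto_intros)
      then have lim: "((\<lambda>w. root m (norm (\<tau> (w ^ m)))) \<longlongrightarrow> 0) (at 0)" using zero m by (simp add: zero_power)
      have ev: "eventually (\<lambda>w. norm (r w) \<le> root m (norm (\<tau> (w ^ m)))) (at 0)"
      proof -
        have "eventually (\<lambda>w. w \<in> ball 0 \<rho>) (at (0::complex))"
          using \<rho>(1) by (auto simp: eventually_at dist_commute intro!: exI[of _ \<rho>])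
        then show ?thesis
          by (rule eventually_mono) (simp flip: pow add: norm_power real_root_power_cancel m)
      qed
      have "(r \<longlongrightarrow> 0) (at 0)" by (rule Lim_null_comparison[OF ev lim])
      then show ?thesis using True by (simp add: isCont_def r_def)
    next
      case False
      \<comment> \<open>a branch of the logarithm that is continuous near z, also when z is a negative real\<close>
      define l where "l w = Ln (w / z) + Ln z" for w
      have clz: "isCont l z" unfolding l_def using False
        by (intro continuous_intros) auto
      have lz: "l z = Ln z" using False by (simp add: l_def)
      have Rez: "Re (l z) < ln \<rho>" using z False \<rho> by (simp add: lz)
      have "isCont T (of_nat m * l z)"
        using T(1) Re_m[OF Rez] by (simp add: continuous_on_eq_continuous_at open_halfspace_Re_lt)
      then have "isCont (\<lambda>w. T (of_nat m * l w)) z"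
        using isCont_o2[of z "\<lambda>w. of_nat m * l w" T] clz by (auto intro!: continuous_intros)
      then have c: "isCont (\<lambda>w. exp (T (of_nat m * l w) / of_nat m)) z"
        using m by (intro continuous_intros) auto
      have "eventually (\<lambda>w. w \<in> ball 0 \<rho> - {0}) (nhds z)"
        by (rule eventually_nhds_in_open) (use z False in \<open>auto\<close>)
      then have ev: "eventually (\<lambda>w. r w = exp (T (of_nat m * l w) / of_nat m)) (nhds z)"
      proof (rule eventually_mono)
        fix w :: complex assume w: "w \<in> ball 0 \<rho> - {0}"
        have ew: "exp (l w) = w" using w False by (simp add: l_def exp_add)
        then have "exp (Re (l w)) < \<rho>" using w by (metis DiffD1 mem_ball_0 norm_exp_eq_Re)
        then have "Re (l w) < ln \<rho>" using \<rho>(1) by (metis exp_less_cancel_iff exp_ln)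
        then show "r w = exp (T (of_nat m * l w) / of_nat m)" using r_exp ew by metis
      qed
      then show ?thesis using isCont_cong[OF ev] c by simp
    qed
  qed
  have injr: "inj_on r (ball 0 \<rho>)"
  proof (rule inj_onI)
    fix z w assume z: "z \<in> ball 0 \<rho>" and w: "w \<in> ball 0 \<rho>" and eq: "r z = r w"
    have pb: "z ^ m \<in> ball 0 R" if "z \<in> ball 0 \<rho>" for z :: complex
      using that m \<rho> power_strict_mono[of "norm z" \<rho> m] by (auto simp: norm_power)
    have "\<tau> (z ^ m) = \<tau> (w ^ m)" using pow z w eq by metis
    then have zw: "z ^ m = w ^ m" using inj pb z w by (simp add: inj_on_eq_iff)
    show "z = w"
    proof (cases "z = 0")
      case True then show ?thesis using zw m by (simp add: power_0_left)
    next
      case False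
      then have w0: "w \<noteq> 0" using zw m by (auto simp: zero_power)
      obtain s where s: "z = exp s" "Re s < ln \<rho>" using log z False by blast
      obtain u where u: "w = exp u" "Re u < ln \<rho>" using log w w0 by blast
      have "exp (of_nat m * u) = exp (of_nat m * s)" using zw s u by (simp add: exp_of_nat_mult)
      then obtain k :: int where k: "of_nat m * u = of_nat m * s + of_int k * p" using exp_eq_p by blast
      have "exp (T (of_nat m * s) / of_nat m) = exp (T (of_nat m * u) / of_nat m)"
        using eq s u r_exp by simp
      then obtain n :: int where "T (of_nat m * s) / of_nat m = T (of_nat m * u) / of_nat m + of_int n * p"
        using exp_eq_p by blast
      then have "T (of_nat m * s) = T (of_nat m * u) + of_nat m * of_int n * p"
        using m by (simp add: field_simps)
      also have "\<dots> = T (of_nat m * s) + of_int (k * e) * p + of_nat m * of_int n * p"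
        using T(3)[OF Re_m[OF s(2)], of k] k by simp
      finally have "(of_int (k * e + int m * n) :: complex) * p = 0" by (simp add: algebra_simps)
      then have "k * e + int m * n = 0" using p0 by (metis mult_eq_0_iff of_int_eq_0_iff)
      then have "int m dvd k * e" by (metis dvd_add_left_iff dvd_0_right dvd_triv_left)
      then have "int m dvd k" using e1 by (metis abs_mult abs_of_nonneg dvd_abs_iff mult.right_neutral)
      then obtain j where "k = int m * j" by (auto simp: dvd_def)
      then have "of_nat m * u = of_nat m * (s + of_int j * p)" using k by (simp add: algebra_simps)
      then have "u = s + of_int j * p" using m by simp
      then show ?thesis using s u expp by simp
    qed
  qed
  show ?thesis using that[of r] contr injr pow by (simp add: \<rho>_def r_def)
qed

section \<open>Charts and locally power-like maps\<close>

text \<open>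
  The charts in \<open>locally_power\<close> have image the whole plane, which restriction to a smaller
  neighbourhood destroys. Here any open image is allowed; \<open>locally_powerI\<close> shows that this changes
  nothing.
\<close>

definition chart ::
  "'a::topological_space set \<Rightarrow> 'a set \<Rightarrow> ('a \<Rightarrow> complex) \<Rightarrow> 'a \<Rightarrow> bool" where
  "chart X V \<psi> x \<longleftrightarrow> openin (top_of_set X) V \<and> x \<in> V \<and> \<psi> x = 0 \<and>
     open (\<psi> ` V) \<and> (\<exists>\<psi>'. homeomorphism V (\<psi> ` V) \<psi> \<psi>')"

lemma chartD:
  assumes "chart X V \<psi> x"
  shows "openin (top_of_set X) V" "V \<subseteq> X" "x \<in> V" "\<psi> x = 0" "open (\<psi> ` V)"
    "continuous_on V \<psi>" "inj_on \<psi> V"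
  using assms unfolding chart_def
  by (auto dest: openin_imp_subset simp: homeomorphism_def) (metis inj_onI)

lemma chart_restrict:
  assumes ch: "chart X V \<psi> x" and W: "openin (top_of_set X) W" "x \<in> W"
  shows "chart X (V \<inter> W) \<psi> x"
proof -
  obtain \<psi>' where h: "homeomorphism V (\<psi> ` V) \<psi> \<psi>'" using ch by (auto simp: chart_def)
  have "openin (top_of_set V) (V \<inter> W)"
    by (metis W(1) ch chartD(1) chartD(2) inf_le1 openin_Int openin_subset_trans)
  then have "openin (top_of_set (\<psi> ` V)) (\<psi> ` (V \<inter> W))"
    by (rule homeomorphism_imp_open_map[OF h])
  then have "open (\<psi> ` (V \<inter> W))" using chartD(5)[OF ch] openin_open_trans by blast
  moreover have "homeomorphism (V \<inter> W) (\<psi> ` (V \<inter> W)) \<psi> \<psi>'"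
    by (rule homeomorphism_of_subsets[OF h]) auto
  ultimately show ?thesis using ch W by (auto simp: chart_def intro: openin_Int)
qed

lemma chart_ball:
  assumes ch: "chart X V \<psi> x" and \<epsilon>: "\<epsilon> > 0" "ball 0 \<epsilon> \<subseteq> \<psi> ` V"
  shows "chart X (V \<inter> \<psi> -` ball 0 \<epsilon>) \<psi> x" "\<psi> ` (V \<inter> \<psi> -` ball 0 \<epsilon>) = ball 0 \<epsilon>"
proof -
  have "openin (top_of_set V) (V \<inter> \<psi> -` ball 0 \<epsilon>)"
    using chartD(6)[OF ch] by (simp add: continuous_openin_preimage_gen)
  then have "openin (top_of_set X) (V \<inter> \<psi> -` ball 0 \<epsilon>)"
    using chartD(1)[OF ch] openin_trans by blast
  then have "chart X (V \<inter> (V \<inter> \<psi> -` ball 0 \<epsilon>)) \<psi> x"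
    using chartD(3,4)[OF ch] \<epsilon>(1) by (intro chart_restrict[OF ch]) auto
  then show "chart X (V \<inter> \<psi> -` ball 0 \<epsilon>) \<psi> x" by simp
  show "\<psi> ` (V \<inter> \<psi> -` ball 0 \<epsilon>) = ball 0 \<epsilon>" using \<epsilon>(2) by blast
qed

lemma chart_obtain_ball:
  assumes ch: "chart X V \<psi> x"
  obtains \<epsilon> where "\<epsilon> > 0" "ball 0 \<epsilon> \<subseteq> \<psi> ` V"
  using chartD(3,4,5)[OF ch] by (metis imageI openE)

text \<open>
  By invariance of domain, a continuous injective \<open>r\<close> has an open image and a continuous inverse.
\<close>

lemma chart_compose:
  assumes ch: "chart X V \<psi> x" and r: "continuous_on (\<psi> ` V) r" "inj_on r (\<psi> ` V)" "r 0 = 0"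
  shows "chart X V (\<lambda>u. r (\<psi> u)) x"
proof -
  obtain \<psi>' where h: "homeomorphism V (\<psi> ` V) \<psi> \<psi>'" using ch by (auto simp: chart_def)
  obtain r' where h': "homeomorphism (\<psi> ` V) (r ` \<psi> ` V) r r'"
    using invariance_of_domain_homeomorphism[OF chartD(5)[OF ch] r(1) _ r(2)] by auto
  have "open (r ` \<psi> ` V)" by (rule invariance_of_domain[OF r(1) chartD(5)[OF ch] r(2)])
  with homeomorphism_compose[OF h h'] ch show ?thesis
    by (auto simp: chart_def r(3) image_image comp_def)
qed

lemma chart_of_homeomorphism_UNIV:
  assumes "homeomorphism V UNIV \<psi> \<psi>'" "openin (top_of_set X) V" "x \<in> V"
  shows "chart X V (\<lambda>u. \<psi> u - \<psi> x) x"
proof -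
  have im: "\<psi> ` V = UNIV" using assms(1) by (simp add: homeomorphism_def)
  have "homeomorphism UNIV UNIV (\<lambda>z. z - \<psi> x) (\<lambda>z. z + \<psi> x)"
    by (intro homeomorphismI continuous_intros) auto
  from homeomorphism_compose[OF assms(1) this]
  have "homeomorphism V UNIV (\<lambda>u. \<psi> u - \<psi> x) (\<lambda>z. \<psi>' (z + \<psi> x))"
    by (simp add: comp_def)
  then show ?thesis using assms
    by (auto simp: chart_def homeomorphism_def)
qed

text \<open>
  Radial stretchings of discs to the plane. The one for the exponent \<open>m\<close> is made so that \<open>z \<mapsto> z ^ m\<close>
  intertwines the case \<open>1\<close> on the disc of radius \<open>\<delta>\<close> with the case \<open>m\<close> on the disc of radius
  \<open>\<delta> ^ m\<close>.
\<close>

lemma ball_homeomorphism_UNIV: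
  fixes \<delta> :: real
  assumes "\<delta> > 0" "m > 0"
  shows "homeomorphism (ball 0 (\<delta> ^ m)) (UNIV :: complex set)
    (\<lambda>w. (1 / (\<delta> - root m (norm w)) ^ m) *\<^sub>R w)
    (\<lambda>w. (\<delta> ^ m / (1 + root m (norm w)) ^ m) *\<^sub>R w)"
    (is "homeomorphism ?B UNIV ?f ?g")
proof -
  have lt: "root m (norm w) < \<delta>" if "w \<in> ?B" for w :: complex
    using that assms real_root_less_iff[of m "norm w" "\<delta> ^ m"] by (simp add: real_root_power_cancel)
  have ge: "root m (norm w) \<ge> 0" for w :: complex using assms by simp
  have pos: "1 + root m (norm w) > 0" for w :: complex using ge[of w] by linarith
  have nw: "norm w = root m (norm w) ^ m" for w :: complex using assms by simp
  have scale: "root m (norm ((c ^ m) *\<^sub>R w)) = c * root m (norm w)" if "c \<ge> 0" for c and w :: complex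
    using that assms by (simp add: real_root_mult real_root_power_cancel)
  have rf: "root m (norm (?f w)) = root m (norm w) / (\<delta> - root m (norm w))" if "w \<in> ?B" for w
    using scale[of "1 / (\<delta> - root m (norm w))" w] lt[OF that] by (simp add: power_divide)
  have rg: "root m (norm (?g w)) = \<delta> * root m (norm w) / (1 + root m (norm w))" for w
    using scale[of "\<delta> / (1 + root m (norm w))" w] pos[of w] assms
    by (simp add: power_divide divide_nonneg_pos)
  show ?thesis
  proof (rule homeomorphismI)
    show "continuous_on ?B ?f"
      using assms lt by (intro continuous_intros) (force+)
    have "1 + root m (norm w) \<noteq> 0" for w :: complex using pos[of w] by linarith
    then show "continuous_on UNIV ?g"
      using assms by (intro continuous_intros) auto
    show "?f ` ?B \<subseteq> UNIV" by simp
    show "?g ` UNIV \<subseteq> ?B"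
    proof clarify
      fix w :: complex
      have "root m (norm (?g w)) < \<delta>"
        unfolding rg using ge[of w] pos[of w] assms by (simp add: pos_divide_less_eq algebra_simps)
      then have "root m (norm (?g w)) ^ m < \<delta> ^ m"
        by (rule power_strict_mono[OF _ ge assms(2)])
      then show "?g w \<in> ?B" using nw[of "?g w"] by simp
    qed
    show "?g (?f w) = w" if "w \<in> ?B" for w
    proof -
      define \<rho> where "\<rho> = root m (norm w)"
      have \<rho>: "\<delta> - \<rho> > 0" using lt[OF that] by (auto simp: \<rho>_def)
      have "root m (norm (?f w)) = \<rho> / (\<delta> - \<rho>)" using rf[OF that] by (simp add: \<rho>_def)
      then have "1 + root m (norm (?f w)) = \<delta> / (\<delta> - \<rho>)"
        using \<rho> by (simp add: add_divide_distrib[symmetric] add_num_frac)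
      then have "?g (?f w) = (\<delta> ^ m / (\<delta> / (\<delta> - \<rho>)) ^ m) *\<^sub>R (?f w)" by simp
      also have "\<dots> = (\<delta> ^ m / (\<delta> / (\<delta> - \<rho>)) ^ m * (1 / (\<delta> - \<rho>) ^ m)) *\<^sub>R w"
        by (simp add: \<rho>_def)
      also have "\<delta> ^ m / (\<delta> / (\<delta> - \<rho>)) ^ m * (1 / (\<delta> - \<rho>) ^ m) = 1"
        using \<rho> assms by (simp add: power_divide)
      finally show ?thesis by simp
    qed
    show "?f (?g w) = w" for w
    proof -
      define \<rho> where "\<rho> = root m (norm w)"
      have \<rho>: "1 + \<rho> > 0" using pos by (auto simp: \<rho>_def)
      have "root m (norm (?g w)) = \<delta> * \<rho> / (1 + \<rho>)" using rg by (simp add: \<rho>_def)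
      then have "\<delta> - root m (norm (?g w)) = \<delta> / (1 + \<rho>)"
        using \<rho> by (simp add: field_simps)
      then have "?f (?g w) = (1 / (\<delta> / (1 + \<rho>)) ^ m) *\<^sub>R (?g w)" by simp
      also have "\<dots> = (1 / (\<delta> / (1 + \<rho>)) ^ m * (\<delta> ^ m / (1 + \<rho>) ^ m)) *\<^sub>R w"
        by (simp add: \<rho>_def)
      also have "1 / (\<delta> / (1 + \<rho>)) ^ m * (\<delta> ^ m / (1 + \<rho>) ^ m) = 1"
        using \<rho> assms by (simp add: power_divide)
      finally show ?thesis by simp
    qed
  qed
qed

lemma locally_powerE:
  assumes "locally_power Y X f y m"
  obtains U V \<phi> \<psi> where "m > 0" "chart Y U \<phi> y" "chart X V \<psi> (f y)" "f ` U \<subseteq> V"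
    "\<And>u. u \<in> U \<Longrightarrow> \<psi> (f u) = \<phi> u ^ m" "\<phi> ` U = UNIV"
proof -
  obtain U V \<phi> \<phi>' \<psi> \<psi>' where *: "m > 0"
     "openin (top_of_set Y) U" "y \<in> U" "openin (top_of_set X) V" "f ` U \<subseteq> V"
     "homeomorphism U (UNIV :: complex set) \<phi> \<phi>'" "\<phi> y = 0"
     "homeomorphism V (UNIV :: complex set) \<psi> \<psi>'" "\<psi> (f y) = 0"
     "\<And>u. u \<in> U \<Longrightarrow> \<psi> (f u) = \<phi> u ^ m"
    using assms unfolding locally_power_def by blast
  have "chart Y U \<phi> y" using chart_of_homeomorphism_UNIV[OF *(6,2,3)] *(7) by simp
  moreover have "f y \<in> V" using *(3,5) by blast
  from chart_of_homeomorphism_UNIV[OF *(8,4) this] have "chart X V \<psi> (f y)" using *(9) by simp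
  moreover have "\<phi> ` U = UNIV" using *(6) by (simp add: homeomorphism_def)
  ultimately show ?thesis using that[of U \<phi> V \<psi>] *(1,5,10) by blast
qed

text \<open>
  Both charts are cut down to discs of radii \<open>\<delta>\<close> and \<open>\<delta> ^ m\<close>, which the power map respects, and
  then stretched to the plane by homeomorphisms that the power map respects as well.
\<close>

lemma locally_powerI:
  assumes m: "m > 0" and c1: "chart Y U \<phi> y" and c2: "chart X V \<psi> (f y)" and fUV: "f ` U \<subseteq> V"
    and eq: "\<And>u. u \<in> U \<Longrightarrow> \<psi> (f u) = \<phi> u ^ m"
  shows "locally_power Y X f y m"
proof -
  obtain \<epsilon>1 where \<epsilon>1: "\<epsilon>1 > 0" "ball 0 \<epsilon>1 \<subseteq> \<phi> ` U" using chart_obtain_ball[OF c1] .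
  obtain \<epsilon>2 where \<epsilon>2: "\<epsilon>2 > 0" "ball 0 \<epsilon>2 \<subseteq> \<psi> ` V" using chart_obtain_ball[OF c2] .
  define \<delta> where "\<delta> = min \<epsilon>1 (root m \<epsilon>2)"
  have \<delta>0: "\<delta> > 0" using \<epsilon>1 \<epsilon>2 m by (simp add: \<delta>_def)
  have "\<delta> ^ m \<le> root m \<epsilon>2 ^ m" using \<delta>0 by (intro power_mono) (auto simp: \<delta>_def)
  then have \<delta>m: "\<delta> ^ m \<le> \<epsilon>2" using m \<epsilon>2 by simp
  have b1: "ball 0 \<delta> \<subseteq> \<phi> ` U"
    using \<epsilon>1(2) by (rule order.trans[rotated]) (simp add: \<delta>_def subset_ball)
  have b2: "ball 0 (\<delta> ^ m) \<subseteq> \<psi> ` V"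
    using \<epsilon>2(2) by (rule order.trans[rotated]) (simp add: \<delta>m subset_ball)
  define U' where "U' = U \<inter> \<phi> -` ball 0 \<delta>"
  define V' where "V' = V \<inter> \<psi> -` ball 0 (\<delta> ^ m)"
  have U': "chart Y U' \<phi> y" "\<phi> ` U' = ball 0 \<delta>"
    unfolding U'_def by (rule chart_ball[OF c1 \<delta>0 b1])+
  have V': "chart X V' \<psi> (f y)" "\<psi> ` V' = ball 0 (\<delta> ^ m)"
    unfolding V'_def by (rule chart_ball[OF c2 _ b2], use \<delta>0 in simp)+
  obtain \<phi>' where \<phi>': "homeomorphism U' (ball 0 \<delta>) \<phi> \<phi>'" using U' by (auto simp: chart_def)
  obtain \<psi>' where \<psi>': "homeomorphism V' (ball 0 (\<delta> ^ m)) \<psi> \<psi>'" using V' by (auto simp: chart_def)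
  define a where "a w = (1 / (\<delta> - norm w)) *\<^sub>R w" for w :: complex
  define b where "b w = (1 / (\<delta> - root m (norm w)) ^ m) *\<^sub>R w" for w :: complex
  obtain a' where a: "homeomorphism (ball 0 \<delta>) UNIV a a'"
    using ball_homeomorphism_UNIV[of \<delta> 1] \<delta>0 by (auto simp: a_def[abs_def])
  obtain b' where b: "homeomorphism (ball 0 (\<delta> ^ m)) UNIV b b'"
    using ball_homeomorphism_UNIV[OF \<delta>0 m] by (auto simp: b_def[abs_def])
  have ab: "b (z ^ m) = a z ^ m" for z
    using m by (simp add: a_def b_def power_divide norm_power real_root_power_cancel scaleR_power)
  have sub: "f ` U' \<subseteq> V'"
  proof clarify
    fix u assume u: "u \<in> U'"
    then have "norm (\<phi> u ^ m) < \<delta> ^ m"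
      using m by (auto simp: U'_def norm_power intro: power_strict_mono)
    then show "f u \<in> V'" using u fUV eq by (auto simp: U'_def V'_def)
  qed
  show ?thesis unfolding locally_power_def
  proof (intro conjI m exI ballI)
    show "homeomorphism U' UNIV (a \<circ> \<phi>) (\<phi>' \<circ> a')" by (rule homeomorphism_compose[OF \<phi>' a])
    show "homeomorphism V' UNIV (b \<circ> \<psi>) (\<psi>' \<circ> b')" by (rule homeomorphism_compose[OF \<psi>' b])
    show "(b \<circ> \<psi>) (f u) = (a \<circ> \<phi>) u ^ m" if "u \<in> U'" for u
      using that eq ab by (simp add: U'_def)
    show "openin (top_of_set Y) U'" "y \<in> U'" "openin (top_of_set X) V'"
      using chartD[OF U'(1)] chartD[OF V'(1)] by auto
    show "(a \<circ> \<phi>) y = 0" "(b \<circ> \<psi>) (f y) = 0"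
      using chartD(4)[OF U'(1)] chartD(4)[OF V'(1)] by (auto simp: a_def b_def)
  qed (rule sub)
qed

text \<open>
  The given chart differs from the one in the definition by a local homeomorphism \<open>\<tau>\<close> of the plane,
  which \<open>root_of_local_homeomorphism\<close> moves to the source. This is what allows two local power maps to
  be compared through one chart at the intermediate or at the final point.
\<close>

lemma locally_power_any_target_chart:
  assumes lp: "locally_power Y X f y m" and ch: "chart X V \<psi> (f y)"
  obtains U \<Phi> where "chart Y U \<Phi> y" "f ` U \<subseteq> V" "\<And>u. u \<in> U \<Longrightarrow> \<psi> (f u) = \<Phi> u ^ m"
proof -
  obtain U0 V0 \<phi> \<psi>0 where *: "m > 0" "chart Y U0 \<phi> y" "chart X V0 \<psi>0 (f y)" "f ` U0 \<subseteq> V0"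
    "\<And>u. u \<in> U0 \<Longrightarrow> \<psi>0 (f u) = \<phi> u ^ m" "\<phi> ` U0 = UNIV" using locally_powerE[OF lp] by metis
  define W where "W = V0 \<inter> V"
  have W0: "chart X W \<psi>0 (f y)"
    unfolding W_def by (rule chart_restrict[OF *(3) chartD(1,3)[OF ch]])
  have W: "chart X W \<psi> (f y)"
    unfolding W_def by (subst Int_commute) (rule chart_restrict[OF ch chartD(1,3)[OF *(3)]])
  obtain \<psi>i where i: "homeomorphism W (\<psi>0 ` W) \<psi>0 \<psi>i" using W0 by (auto simp: chart_def)
  have inv: "\<psi>i (\<psi>0 w) = w" if "w \<in> W" for w using i that by (simp add: homeomorphism_def)
  obtain R where R: "R > 0" "ball 0 R \<subseteq> \<psi>0 ` W" using chart_obtain_ball[OF W0] .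
  have im: "\<psi>i ` \<psi>0 ` W = W" using i by (simp add: homeomorphism_def)
  have c: "continuous_on (\<psi>0 ` W) (\<lambda>z. \<psi> (\<psi>i z))"
    by (rule continuous_on_compose2[OF chartD(6)[OF W]])
       (use i im in \<open>auto simp: homeomorphism_def\<close>)
  have c': "continuous_on (ball 0 R) (\<lambda>z. \<psi> (\<psi>i z))" by (rule continuous_on_subset[OF c R(2)])
  have "inj_on (\<lambda>z. \<psi> (\<psi>i z)) (\<psi>0 ` W)"
    using chartD(7)[OF W] inv by (auto simp: inj_on_def)
  then have i': "inj_on (\<lambda>z. \<psi> (\<psi>i z)) (ball 0 R)" by (rule inj_on_subset[OF _ R(2)])
  have z': "\<psi> (\<psi>i 0) = 0"
    using inv[OF chartD(3)[OF W0]] chartD(4)[OF W0] chartD(4)[OF W] by simp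
  obtain r where r: "continuous_on (ball 0 (root m R)) r" "inj_on r (ball 0 (root m R))"
    "r 0 = 0" "\<And>z. z \<in> ball 0 (root m R) \<Longrightarrow> r z ^ m = \<psi> (\<psi>i (z ^ m))"
    using root_of_local_homeomorphism[OF R(1) c' i' z' *(1)] by blast
  define U where "U = U0 \<inter> \<phi> -` ball 0 (root m R)"
  have U: "chart Y U \<phi> y" "\<phi> ` U = ball 0 (root m R)"
    unfolding U_def using R(1) *(1,6) by (auto intro!: chart_ball[OF *(2)])
  have fU: "f u \<in> W \<and> \<psi>i (\<phi> u ^ m) = f u" if "u \<in> U" for u
  proof -
    have "norm (\<phi> u) < root m R" "u \<in> U0" using that by (auto simp: U_def)
    then have "norm (\<phi> u ^ m) < R"
      using power_strict_mono[of "norm (\<phi> u)" "root m R" m] *(1) R(1) by (simp add: norm_power)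
    then obtain w where w: "w \<in> W" "\<psi>0 w = \<psi>0 (f u)" using R(2) *(5)[OF \<open>u \<in> U0\<close>] by force
    moreover have "f u \<in> V0" using *(4) \<open>u \<in> U0\<close> by blast
    ultimately have "f u = w" using chartD(7)[OF *(3)] by (auto simp: inj_on_def W_def)
    then show ?thesis using w inv *(5)[OF \<open>u \<in> U0\<close>] by metis
  qed
  show ?thesis
  proof (rule that)
    show "chart Y U (\<lambda>u. r (\<phi> u)) y"
      by (rule chart_compose[OF U(1)]) (use r U(2) in auto)
    show "f ` U \<subseteq> V" using fU by (auto simp: W_def)
    show "\<psi> (f u) = r (\<phi> u) ^ m" if "u \<in> U" for u
      using fU[OF that] r(4)[of "\<phi> u"] that U(2) by (metis imageI)
  qed
qed

lemma locally_power_compose: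
  assumes g: "locally_power Y X g y m" and h: "locally_power X Z h (g y) l"
  shows "locally_power Y Z (\<lambda>u. h (g u)) y (m * l)"
proof -
  obtain V Z' \<phi> \<psi> where *: "l > 0" "chart X V \<phi> (g y)" "chart Z Z' \<psi> (h (g y))" "h ` V \<subseteq> Z'"
    "\<And>u. u \<in> V \<Longrightarrow> \<psi> (h u) = \<phi> u ^ l" using locally_powerE[OF h] by metis
  obtain U \<Phi> where "chart Y U \<Phi> y" "g ` U \<subseteq> V" "\<And>u. u \<in> U \<Longrightarrow> \<phi> (g u) = \<Phi> u ^ m"
    using locally_power_any_target_chart[OF g *(2)] by metis
  moreover have "m > 0" using g by (simp add: locally_power_def)
  ultimately show ?thesis using *
    by (intro locally_powerI[of "m * l" Y U \<Phi> y Z Z' \<psi>]) (auto simp: power_mult)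
qed

lemma locally_power_cong:
  assumes "locally_power Y X f y m" "\<And>u. u \<in> Y \<Longrightarrow> f u = g u" "y \<in> Y"
  shows "locally_power Y X g y m"
proof -
  obtain U V \<phi> \<psi> where *: "m > 0" "chart Y U \<phi> y" "chart X V \<psi> (f y)" "f ` U \<subseteq> V"
    "\<And>u. u \<in> U \<Longrightarrow> \<psi> (f u) = \<phi> u ^ m" using locally_powerE[OF assms(1)] by metis
  show ?thesis using * assms(2) assms(3) chartD(2)[OF *(2)]
    by (intro locally_powerI[of m Y U \<phi> y X V \<psi>]) (auto simp: image_subset_iff subset_iff)
qed

text \<open>
  In a common chart at \<open>h (g y)\<close> the functions \<open>\<phi> \<circ> g\<close> and \<open>\<Phi> ^ k\<close> have the same \<open>l\<close>-th power. On a
  punctured disc they then differ by a constant factor, which can be absorbed into the chart \<open>\<phi>\<close>.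
\<close>

lemma locally_power_lift:
  assumes f: "locally_power Y Z (\<lambda>u. h (g u)) y (k * l)" and h: "locally_power X Z h (g y) l"
    and cont: "continuous_on Y g" "g ` Y \<subseteq> X"
  shows "locally_power Y X g y k"
proof -
  obtain V Z' \<phi> \<psi> where *: "l > 0" "chart X V \<phi> (g y)" "chart Z Z' \<psi> (h (g y))" "h ` V \<subseteq> Z'"
    "\<And>u. u \<in> V \<Longrightarrow> \<psi> (h u) = \<phi> u ^ l" using locally_powerE[OF h] by metis
  obtain U0 \<Phi> where U0: "chart Y U0 \<Phi> y" "\<And>u. u \<in> U0 \<Longrightarrow> \<psi> (h (g u)) = \<Phi> u ^ (k * l)"
    using locally_power_any_target_chart[OF f *(3)] by metis
  have k: "k > 0" using f by (simp add: locally_power_def)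
  have opV: "openin (top_of_set Y) (Y \<inter> g -` V)"
    using cont chartD(1)[OF *(2)] by (simp add: continuous_openin_preimage image_subset_iff_funcset)
  have yV: "y \<in> Y \<inter> g -` V"
    using chartD(2,3)[OF U0(1)] chartD(3)[OF *(2)] by auto
  have U1: "chart Y (U0 \<inter> (Y \<inter> g -` V)) \<Phi> y" by (rule chart_restrict[OF U0(1) opV yV])
  obtain \<epsilon> where \<epsilon>: "\<epsilon> > 0" "ball 0 \<epsilon> \<subseteq> \<Phi> ` (U0 \<inter> (Y \<inter> g -` V))" using chart_obtain_ball[OF U1] .
  define U where "U = (U0 \<inter> (Y \<inter> g -` V)) \<inter> \<Phi> -` ball 0 \<epsilon>"
  have U: "chart Y U \<Phi> y" "\<Phi> ` U = ball 0 \<epsilon>"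
    unfolding U_def by (rule chart_ball[OF U1 \<epsilon>])+
  have UV: "g ` U \<subseteq> V" by (auto simp: U_def)
  have eq: "\<phi> (g u) ^ l = (\<Phi> u ^ k) ^ l" if "u \<in> U" for u
    using *(5)[of "g u"] U0(2)[of u] that by (simp add: U_def power_mult)
  have nz: "\<Phi> u \<noteq> 0" if "u \<in> U - {y}" for u
    using that chartD(3,4,7)[OF U(1)] by (auto simp: inj_on_def)
  obtain \<Phi>' where i: "homeomorphism U (ball 0 \<epsilon>) \<Phi> \<Phi>'" using U by (auto simp: chart_def)
  have "\<Phi>' 0 = y" using i chartD(3,4)[OF U(1)] by (metis homeomorphism_apply1)
  moreover have "\<Phi>' ` ball 0 \<epsilon> = U" using i by (simp add: homeomorphism_def)
  moreover have "inj_on \<Phi>' (ball 0 \<epsilon>)" 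
    by (rule inj_on_inverseI[of _ \<Phi>]) (rule homeomorphism_apply2[OF i])
  ultimately have "\<Phi>' ` (ball 0 \<epsilon> - {0}) = U - {y}"
    using \<epsilon>(1) inj_on_image_set_diff[of \<Phi>' "ball 0 \<epsilon>" "ball 0 \<epsilon>" "{0}"] by auto
  moreover have "connected (ball (0::complex) \<epsilon> - {0})"
    by (rule connected_punctured_convex) (use \<epsilon>(1) in \<open>auto simp: aff_dim_open\<close>)
  ultimately have conn: "connected (U - {y})"
    using i by (metis (no_types, lifting) Diff_subset connected_continuous_image continuous_on_subset homeomorphism_def)
  have c1: "continuous_on (U - {y}) (\<lambda>u. \<phi> (g u))"
    by (rule continuous_on_compose2[OF chartD(6)[OF *(2)]])
       (use UV chartD(2)[OF U(1)] in \<open>auto intro: continuous_on_subset[OF cont(1)]\<close>)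
  have c2: "continuous_on (U - {y}) (\<lambda>u. \<Phi> u ^ k)"
    by (intro continuous_intros continuous_on_subset[OF chartD(6)[OF U(1)]]) auto
  obtain \<zeta> where \<zeta>: "\<zeta> ^ l = 1" "\<And>u. u \<in> U - {y} \<Longrightarrow> \<phi> (g u) = \<zeta> * \<Phi> u ^ k"
    by (rule nth_roots_proportional[OF conn c1 c2 _ _ *(1)]) (use eq nz in auto)
  have \<zeta>_nz: "\<zeta> \<noteq> 0" using \<zeta>(1) *(1) by (auto simp: zero_power)
  have "chart X V (\<lambda>v. inverse \<zeta> * \<phi> v) (g y)"
    by (rule chart_compose[OF *(2)]) (use \<zeta>_nz in \<open>auto intro!: continuous_intros inj_onI\<close>)
  moreover have "inverse \<zeta> * \<phi> (g u) = \<Phi> u ^ k" if "u \<in> U" for u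
  proof (cases "u = y")
    case True then show ?thesis using chartD(4)[OF U(1)] chartD(4)[OF *(2)] k by simp
  next
    case False
    then show ?thesis using \<zeta>(2)[of u] that \<zeta>_nz by simp
  qed
  ultimately show ?thesis using U(1) UV k by (intro locally_powerI[of k Y U \<Phi> y X V]) auto
qed

section \<open>Local degrees\<close>

lemma chart_recentre:
  assumes ch: "chart X V \<psi> x" and x': "x' \<in> V"
  shows "chart X V (\<lambda>v. \<psi> v - \<psi> x') x'"
proof -
  obtain \<psi>' where h: "homeomorphism V (\<psi> ` V) \<psi> \<psi>'" using ch by (auto simp: chart_def)
  have t: "homeomorphism (\<psi> ` V) ((\<lambda>z. z - \<psi> x') ` \<psi> ` V) (\<lambda>z. z - \<psi> x') (\<lambda>z. z + \<psi> x')"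
    by (intro homeomorphismI continuous_intros) auto
  have "open ((\<lambda>z. z - \<psi> x') ` \<psi> ` V)"
    using open_translation[OF chartD(5)[OF ch], of "- \<psi> x'"] by (simp add: image_image)
  then show ?thesis
    using homeomorphism_compose[OF h t] chartD(1)[OF ch] x'
    by (auto simp: chart_def image_image comp_def)
qed

lemma power_locally_injective:
  fixes z0 :: complex
  assumes "z0 \<noteq> 0" "m > 0"
  obtains T where "open T" "z0 \<in> T" "inj_on (\<lambda>z. z ^ m) T"
proof -
  obtain T u q where T: "z0 \<in> T" "openin (top_of_set (- {0})) T"
    and h: "homeomorphism T u (\<lambda>z::complex. z ^ m) q"
    using covering_space_local_homeomorphism[OF covering_space_power_punctured_plane[OF assms(2)], of z0]
      assms(1) by (metis ComplI singletonD)
  have "open T" using T(2) by (metis open_Compl closed_singleton openin_open_trans)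
  moreover have "inj_on (\<lambda>z. z ^ m) T" by (rule inj_on_inverseI[of _ q]) (rule homeomorphism_apply1[OF h])
  ultimately show ?thesis using that T(1) by blast
qed

lemma power_root_exists:
  fixes c :: complex assumes "m > 0" shows "\<exists>z. z ^ m = c"
proof (cases "c = 0")
  case True then show ?thesis using assms by (intro exI[of _ 0]) (simp add: zero_power)
next
  case False
  then have "card {z. z ^ m = c} \<noteq> 0" using card_nth_roots[OF False assms] assms by simp
  then show ?thesis by (metis (mono_tags, lifting) Collect_empty_eq card.empty)
qed

text \<open>
  Away from \<open>0\<close> the power map is a local homeomorphism, so \<open>\<phi> ^ m\<close>, recentred, is itself a chart at
  \<open>u\<close>.
\<close>

lemma locally_power_off_centre:
  assumes m: "m > 0" and U: "chart Y U \<phi> y" and V: "chart X V \<psi> (f y)" and fUV: "f ` U \<subseteq> V"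
    and eq: "\<And>u. u \<in> U \<Longrightarrow> \<psi> (f u) = \<phi> u ^ m" and u: "u \<in> U" "u \<noteq> y"
  shows "locally_power Y X f u 1"
proof -
  have "\<phi> u \<noteq> 0" using chartD(3,4,7)[OF U] u by (auto simp: inj_on_def)
  then obtain T where T: "open T" "\<phi> u \<in> T" "inj_on (\<lambda>z. z ^ m) T"
    using power_locally_injective m by metis
  have Uu: "chart Y U (\<lambda>w. \<phi> w - \<phi> u) u" by (rule chart_recentre[OF U u(1)])
  have "openin (top_of_set U) (U \<inter> \<phi> -` T)"
    using chartD(6)[OF U] T(1) by (simp add: continuous_openin_preimage_gen)
  then have "openin (top_of_set Y) (U \<inter> \<phi> -` T)"
    using chartD(1)[OF U] openin_trans by blast
  then have "chart Y (U \<inter> (U \<inter> \<phi> -` T)) (\<lambda>w. \<phi> w - \<phi> u) u"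
    using u T(2) by (intro chart_restrict[OF Uu]) auto
  then have U': "chart Y (U \<inter> \<phi> -` T) (\<lambda>w. \<phi> w - \<phi> u) u" by (simp add: Int_absorb1)
  have "chart Y (U \<inter> \<phi> -` T) (\<lambda>w. ((\<phi> w - \<phi> u) + \<phi> u) ^ m - \<phi> u ^ m) u"
    by (rule chart_compose[OF U']) (use T(3) in \<open>auto intro!: continuous_intros simp: inj_on_def\<close>)
  then have U'': "chart Y (U \<inter> \<phi> -` T) (\<lambda>w. \<phi> w ^ m - \<phi> u ^ m) u" by simp
  have "f u \<in> V" using fUV u by blast
  then have "chart X V (\<lambda>v. \<psi> v - \<psi> (f u)) (f u)" by (rule chart_recentre[OF V])
  then show ?thesis using U'' fUV eq u
    by (intro locally_powerI[of 1 Y "U \<inter> \<phi> -` T" "\<lambda>w. \<phi> w ^ m - \<phi> u ^ m" u X V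
          "\<lambda>v. \<psi> v - \<psi> (f u)"]) auto
qed

lemma locally_power_image:
  assumes "locally_power Y X f y m"
  obtains V where "openin (top_of_set X) V" "f y \<in> V" "V \<subseteq> f ` Y"
proof -
  obtain U V \<phi> \<psi> where *: "m > 0" "chart Y U \<phi> y" "chart X V \<psi> (f y)" "f ` U \<subseteq> V"
    "\<And>u. u \<in> U \<Longrightarrow> \<psi> (f u) = \<phi> u ^ m" "\<phi> ` U = UNIV" using locally_powerE[OF assms] by metis
  have "v \<in> f ` Y" if v: "v \<in> V" for v
  proof -
    obtain z where "z ^ m = \<psi> v" using power_root_exists[OF *(1)] by metis
    moreover obtain u where "u \<in> U" "\<phi> u = z" using *(6) by (metis UNIV_I imageE)
    ultimately have "\<psi> (f u) = \<psi> v" "f u \<in> V" "u \<in> Y" using *(4,5) chartD(2)[OF *(2)] by auto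
    then show ?thesis using v chartD(7)[OF *(3)] by (auto simp: inj_on_def)
  qed
  then show ?thesis using that chartD(1,3)[OF *(3)] by blast
qed

text \<open>
  The exponent \<open>m\<close> is the number of preimages near \<open>y\<close> of a point near \<open>f y\<close>. This description
  refers to no chart; it gives the uniqueness of \<open>m\<close> and the constancy of the degree.
\<close>

lemma locally_power_count:
  assumes lp: "locally_power Y X f y m" and W: "openin (top_of_set Y) W" "y \<in> W"
  obtains W' V' where "openin (top_of_set Y) W'" "y \<in> W'" "W' \<subseteq> W"
    "openin (top_of_set X) V'" "f ` W' \<subseteq> V'" "f y \<in> V'"
    "\<And>x. x \<in> V' \<Longrightarrow> x \<noteq> f y \<Longrightarrow> card {u \<in> W'. f u = x} = m"
    "\<And>u. u \<in> W' \<Longrightarrow> u \<noteq> y \<Longrightarrow> f u \<noteq> f y \<and> locally_power Y X f u 1"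
proof -
  obtain U V \<phi> \<psi> where *: "m > 0" "chart Y U \<phi> y" "chart X V \<psi> (f y)" "f ` U \<subseteq> V"
    "\<And>u. u \<in> U \<Longrightarrow> \<psi> (f u) = \<phi> u ^ m" "\<phi> ` U = UNIV" using locally_powerE[OF lp] by metis
  have U1: "chart Y (U \<inter> W) \<phi> y" by (rule chart_restrict[OF *(2) W])
  obtain \<epsilon> where \<epsilon>: "\<epsilon> > 0" "ball 0 \<epsilon> \<subseteq> \<phi> ` (U \<inter> W)" using chart_obtain_ball[OF U1] .
  define W' where "W' = (U \<inter> W) \<inter> \<phi> -` ball 0 \<epsilon>"
  have W': "chart Y W' \<phi> y" "\<phi> ` W' = ball 0 \<epsilon>" unfolding W'_def by (rule chart_ball[OF U1 \<epsilon>])+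
  define V' where "V' = V \<inter> \<psi> -` ball 0 (\<epsilon> ^ m)"
  have "openin (top_of_set V) V'"
    unfolding V'_def using chartD(6)[OF *(3)] by (simp add: continuous_openin_preimage_gen)
  then have V': "openin (top_of_set X) V'" using chartD(1)[OF *(3)] openin_trans by blast
  show ?thesis
  proof
    show "openin (top_of_set Y) W'" "y \<in> W'" "W' \<subseteq> W" using chartD[OF W'(1)] by (auto simp: W'_def)
    show "openin (top_of_set X) V'" by (rule V')
    show "f y \<in> V'" using chartD(3,4)[OF *(3)] \<epsilon> by (auto simp: V'_def)
    show "f ` W' \<subseteq> V'"
    proof clarify
      fix u assume u: "u \<in> W'"
      then have "norm (\<phi> u ^ m) < \<epsilon> ^ m"
        using *(1) by (auto simp: W'_def norm_power intro: power_strict_mono)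
      then show "f u \<in> V'" using u *(4,5) by (auto simp: W'_def V'_def)
    qed
    show "f u \<noteq> f y \<and> locally_power Y X f u 1" if u: "u \<in> W'" "u \<noteq> y" for u
    proof
      have uU: "u \<in> U" using u by (simp add: W'_def)
      have "\<phi> u \<noteq> 0" using chartD(3,4,7)[OF *(2)] u(2) uU by (auto simp: inj_on_def)
      then show "f u \<noteq> f y" using *(5)[OF uU] chartD(4)[OF *(3)] by auto
      show "locally_power Y X f u 1"
        by (rule locally_power_off_centre[OF *(1-4) *(5) uU u(2)])
    qed
    show "card {u \<in> W'. f u = x} = m" if x: "x \<in> V'" "x \<noteq> f y" for x
    proof -
      have nz: "\<psi> x \<noteq> 0" 
        using x inj_onD[OF chartD(7)[OF *(3)], of x "f y"] chartD(3,4)[OF *(3)] by (auto simp: V'_def)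
      have "bij_betw \<phi> {u \<in> W'. f u = x} {z. z ^ m = \<psi> x}"
        unfolding bij_betw_def
      proof
        show "inj_on \<phi> {u \<in> W'. f u = x}" using chartD(7)[OF W'(1)] by (auto simp: inj_on_def)
        show "\<phi> ` {u \<in> W'. f u = x} = {z. z ^ m = \<psi> x}"
        proof (intro equalityI subsetI)
          fix z assume z: "z \<in> {z. z ^ m = \<psi> x}"
          then have "norm z ^ m < \<epsilon> ^ m" using x by (auto simp: V'_def simp flip: norm_power)
          then have "norm z < \<epsilon>" using \<epsilon>(1) by (simp add: power_less_imp_less_base)
          then obtain u where u: "u \<in> W'" "\<phi> u = z" using W'(2) by force
          then have "\<psi> (f u) = \<psi> x" "f u \<in> V" using z *(4) *(5)[of u] by (auto simp: W'_def)
          then have "f u = x" using x chartD(7)[OF *(3)] by (auto simp: inj_on_def V'_def)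
          then show "z \<in> \<phi> ` {u \<in> W'. f u = x}" using u by blast
        qed (use *(5) in \<open>auto simp: W'_def\<close>)
      qed
      then show ?thesis using card_nth_roots[OF nz *(1)] by (simp add: bij_betw_same_card)
    qed
  qed
qed

text \<open>
  A neighbourhood adapted to the exponent \<open>k\<close> is chosen inside one adapted to \<open>l\<close>, so that counting
  preimages gives \<open>k \<le> l\<close>.
\<close>

lemma locally_power_unique:
  assumes "locally_power Y X f y m" "locally_power Y X f y m'"
  shows "m = m'"
proof -
  have le: "k \<le> l" if lk: "locally_power Y X f y k" and ll: "locally_power Y X f y l" for k l
  proof -
    obtain U0 \<phi> where "chart Y U0 \<phi> y" using locally_powerE[OF lk] by metis
    then have op: "openin (top_of_set Y) Y" "y \<in> Y" using chartD(2,3) by (simp, blast)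
    obtain W1 V1 where 1: "openin (top_of_set Y) W1" "y \<in> W1" "openin (top_of_set X) V1" "f y \<in> V1"
      "\<And>x. x \<in> V1 \<Longrightarrow> x \<noteq> f y \<Longrightarrow> card {u \<in> W1. f u = x} = l"
      by (rule locally_power_count[OF ll op]) blast
    obtain W2 V2 where 2: "W2 \<subseteq> W1" "openin (top_of_set X) V2" "f y \<in> V2"
      "\<And>x. x \<in> V2 \<Longrightarrow> x \<noteq> f y \<Longrightarrow> card {u \<in> W2. f u = x} = k"
      by (rule locally_power_count[OF lk 1(1,2)]) blast
    obtain V \<psi> where ch: "chart X V \<psi> (f y)" using locally_powerE[OF lk] by metis
    have ch': "chart X (V \<inter> (V1 \<inter> V2)) \<psi> (f y)"
      by (rule chart_restrict[OF ch]) (use 1 2 in auto)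
    obtain \<epsilon> where \<epsilon>: "\<epsilon> > 0" "ball 0 \<epsilon> \<subseteq> \<psi> ` (V \<inter> (V1 \<inter> V2))" using chart_obtain_ball[OF ch'] .
    then have "complex_of_real (\<epsilon> / 2) \<in> \<psi> ` (V \<inter> (V1 \<inter> V2))" by (intro subsetD[OF \<epsilon>(2)]) simp
    then obtain x where x: "x \<in> V1" "x \<in> V2" "\<psi> x = complex_of_real (\<epsilon> / 2)" by auto
    then have "x \<noteq> f y" using chartD(4)[OF ch] \<epsilon>(1) by auto
    then have c: "card {u \<in> W2. f u = x} = k" "card {u \<in> W1. f u = x} = l" using 1 2 x by blast+
    have "l > 0" using ll by (simp add: locally_power_def)
    then have "finite {u \<in> W1. f u = x}" using c(2) by (metis card.infinite less_numeral_extra(3))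
    then have "card {u \<in> W2. f u = x} \<le> card {u \<in> W1. f u = x}"
      by (rule card_mono) (use 2(1) in auto)
    then show ?thesis using c by simp
  qed
  show ?thesis using le assms by (meson le_antisym)
qed

lemma local_degree_eq: "locally_power Y X f y m \<Longrightarrow> local_degree Y X f y = m"
  unfolding local_degree_def using locally_power_unique by blast

lemma locally_power_continuous_on:
  assumes "\<And>y. y \<in> Y \<Longrightarrow> \<exists>m. locally_power Y X f y m"
  shows "continuous_on Y f"
  unfolding continuous_on_def
proof
  fix y assume y: "y \<in> Y"
  then obtain m where lp: "locally_power Y X f y m" using assms by blast
  obtain U V \<phi> \<psi> where *: "m > 0" "chart Y U \<phi> y" "chart X V \<psi> (f y)" "f ` U \<subseteq> V"
    "\<And>u. u \<in> U \<Longrightarrow> \<psi> (f u) = \<phi> u ^ m" "\<phi> ` U = UNIV" using locally_powerE[OF lp] by metis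
  obtain \<psi>i where i: "homeomorphism V (\<psi> ` V) \<psi> \<psi>i" using *(3) by (auto simp: chart_def)
  have "continuous_on U (\<lambda>u. \<psi>i (\<phi> u ^ m))"
  proof (rule continuous_on_compose2[OF homeomorphism_cont2[OF i]])
    show "continuous_on U (\<lambda>u. \<phi> u ^ m)" by (intro continuous_intros chartD(6)[OF *(2)])
    show "(\<lambda>u. \<phi> u ^ m) ` U \<subseteq> \<psi> ` V" using *(4,5) by force
  qed
  moreover have "\<psi>i (\<phi> u ^ m) = f u" if "u \<in> U" for u
    using *(4,5) that homeomorphism_apply1[OF i, of "f u"] by force
  ultimately have "continuous_on U f" by (rule continuous_on_eq) 
  then have c: "(f \<longlongrightarrow> f y) (at y within U)"
    using chartD(3)[OF *(2)] by (simp add: continuous_on_def)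
  obtain O' where O': "open O'" "U = Y \<inter> O'" using chartD(1)[OF *(2)] by (auto simp: openin_open)
  have "at y within Y = at y within U"
    by (rule at_within_nhd[of y O']) (use O' chartD(3)[OF *(2)] in auto)
  then show "(f \<longlongrightarrow> f y) (at y within Y)" using c by simp
qed

text \<open>
  Surjectivity is automatic: the image is compact, it is open because local power maps are open, and \<open>X\<close>
  is connected.
\<close>

lemma branched_coverI:
  assumes "compact Y" "Y \<noteq> {}" "connected X" "f ` Y \<subseteq> X"
    and lp: "\<And>y. y \<in> Y \<Longrightarrow> \<exists>m. locally_power Y X f y m"
  shows "branched_cover Y (X :: 'b::t2_space set) f"
proof -
  have c: "continuous_on Y f" by (rule locally_power_continuous_on[OF lp])
  have "closedin (top_of_set X) (f ` Y)"
    using compact_imp_closed[OF compact_continuous_image[OF c assms(1)]] assms(4)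
    by (simp add: closed_subset)
  moreover have "openin (top_of_set X) (f ` Y)"
  proof (subst openin_subopen, clarify)
    fix y assume "y \<in> Y"
    then show "\<exists>T. openin (top_of_set X) T \<and> f y \<in> T \<and> T \<subseteq> f ` Y"
      using lp locally_power_image by metis
  qed
  ultimately have "f ` Y = X" using assms(2,3) by (metis connected_clopen image_is_empty)
  then show ?thesis using c lp by (auto simp: branched_cover_def)
qed

lemma locally_finite_in_compact:
  assumes "compact Y"
    and "\<And>y. y \<in> Y \<Longrightarrow> \<exists>W. openin (top_of_set Y) W \<and> y \<in> W \<and> finite (W \<inter> P)"
  shows "finite (Y \<inter> P)"
proof -
  obtain W where W: "\<And>y. y \<in> Y \<Longrightarrow> openin (top_of_set Y) (W y) \<and> y \<in> W y \<and> finite (W y \<inter> P)"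
    using assms(2) by metis
  then have "Y \<subseteq> \<Union> (W ` Y)" "\<forall>c \<in> W ` Y. openin (top_of_set Y) c" by auto
  then obtain D where D: "D \<subseteq> W ` Y" "finite D" "Y \<subseteq> \<Union> D"
    using assms(1) unfolding compact_eq_openin_cover by metis
  have "finite (\<Union>c\<in>D. c \<inter> P)" using D W by (intro finite_UN_I) auto
  then show ?thesis by (rule rev_finite_subset) (use D(3) in auto)
qed

lemma branched_cover_locally_power:
  "branched_cover Y X f \<Longrightarrow> y \<in> Y \<Longrightarrow> locally_power Y X f y (local_degree Y X f y)"
  unfolding branched_cover_def using local_degree_eq by metis

lemma local_degree_pos: "branched_cover Y X f \<Longrightarrow> y \<in> Y \<Longrightarrow> local_degree Y X f y > 0"
  using branched_cover_locally_power locally_power_def by metis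

lemma finite_fibre:
  assumes f: "branched_cover Y X f" and Y: "compact Y"
  shows "finite {y \<in> Y. f y = x}"
proof -
  have "finite (Y \<inter> {y. f y = x})"
  proof (rule locally_finite_in_compact[OF Y])
    fix y assume y: "y \<in> Y"
    let ?m = "local_degree Y X f y"
    obtain W V where W: "openin (top_of_set Y) W" "y \<in> W" "f ` W \<subseteq> V"
      "\<And>x. x \<in> V \<Longrightarrow> x \<noteq> f y \<Longrightarrow> card {u \<in> W. f u = x} = ?m"
      "\<And>u. u \<in> W \<Longrightarrow> u \<noteq> y \<Longrightarrow> f u \<noteq> f y"
      by (rule locally_power_count[OF branched_cover_locally_power[OF f y] openin_subtopology_self y]) blast
    have "finite {u \<in> W. f u = x}"
    proof (cases "x \<in> V \<and> x \<noteq> f y")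
      case True
      then have "card {u \<in> W. f u = x} > 0" using W(4) local_degree_pos[OF f y] by simp
      then show ?thesis by (rule card_ge_0_finite)
    next
      case False
      then have "{u \<in> W. f u = x} \<subseteq> {y}" using W by auto
      then show ?thesis by (rule finite_subset) simp
    qed
    moreover have "{u \<in> W. f u = x} = W \<inter> {y. f y = x}" by auto
    ultimately have "finite (W \<inter> {y. f y = x})" by simp
    then show "\<exists>W. openin (top_of_set Y) W \<and> y \<in> W \<and> finite (W \<inter> {y. f y = x})" using W by blast
  qed
  moreover have "Y \<inter> {y. f y = x} = {y \<in> Y. f y = x}" by auto
  ultimately show ?thesis by simp
qed

lemma finite_branch_points:
  assumes f: "branched_cover Y X f" and Y: "compact Y"
  shows "finite (branch_points Y X f)"
proof -
  have "finite (Y \<inter> {y. local_degree Y X f y > 1})"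
  proof (rule locally_finite_in_compact[OF Y])
    fix y assume y: "y \<in> Y"
    obtain W where W: "openin (top_of_set Y) W" "y \<in> W"
      "\<And>u. u \<in> W \<Longrightarrow> u \<noteq> y \<Longrightarrow> locally_power Y X f u 1"
      by (rule locally_power_count[OF branched_cover_locally_power[OF f y] openin_subtopology_self y]) blast
    then have "W \<inter> {y. local_degree Y X f y > 1} \<subseteq> {y}" using local_degree_eq by fastforce
    then show "\<exists>W. openin (top_of_set Y) W \<and> y \<in> W \<and> finite (W \<inter> {y. local_degree Y X f y > 1})"
      using W by (meson finite.emptyI finite_insert finite_subset)
  qed
  moreover have "branch_points Y X f \<subseteq> f ` (Y \<inter> {y. local_degree Y X f y > 1})"
    by (auto simp: branch_points_def)
  ultimately show ?thesis by (meson finite_imageI finite_subset)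
qed

section \<open>The degree of a branched cover\<close>

lemma sum_local_degrees_over:
  "sum_mset (local_degrees_over Y X f x) = (\<Sum>y | y \<in> Y \<and> f y = x. local_degree Y X f y)"
  by (simp add: local_degrees_over_def sum_unfold_sum_mset)

text \<open>
  Around each point of the fibre over \<open>x\<close> there is a neighbourhood in which a point near \<open>x\<close> has as
  many preimages as the local degree says, all of local degree \<open>1\<close>. By compactness of \<open>Y\<close> a point near
  \<open>x\<close> has no preimages outside these neighbourhoods. So the sum is locally constant.
\<close>

lemma sum_local_degrees_constant:
  fixes Y :: "'a::metric_space set" and X :: "'b::t2_space set"
  assumes f: "branched_cover Y X f" and Y: "compact Y" and X: "connected X"
  shows "(\<lambda>x. sum_mset (local_degrees_over Y X f x)) constant_on X"
proof (rule locally_constant_imp_constant[OF X])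
  fix x assume x: "x \<in> X"
  define F where "F = {y \<in> Y. f y = x}"
  have finF: "finite F" unfolding F_def by (rule finite_fibre[OF f Y])
  have fim: "f ` Y = X" and cont: "continuous_on Y f" using f by (auto simp: branched_cover_def)
  have "\<exists>d>0. \<forall>z\<in>F. z \<noteq> y \<longrightarrow> d \<le> dist y z" for y using finite_set_avoid[OF finF] .
  then obtain d where d: "\<And>y. d y > 0" "\<And>y z. z \<in> F \<Longrightarrow> z \<noteq> y \<Longrightarrow> d y \<le> dist y z" by metis
  define Q where "Q y W V \<longleftrightarrow> openin (top_of_set Y) W \<and> y \<in> W \<and> W \<subseteq> Y \<inter> ball y (d y / 2) \<and>
      openin (top_of_set X) V \<and> x \<in> V \<and>
      (\<forall>x' \<in> V - {x}. card {u \<in> W. f u = x'} = local_degree Y X f y) \<and>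
      (\<forall>u \<in> W - {y}. locally_power Y X f u 1)" for y W V
  have "\<exists>W V. Q y W V" if y: "y \<in> F" for y
  proof -
    have y': "y \<in> Y" "f y = x" using y by (auto simp: F_def)
    have B: "openin (top_of_set Y) (Y \<inter> ball y (d y / 2))" "y \<in> Y \<inter> ball y (d y / 2)"
      using d(1)[of y] y' by (simp_all add: openin_open_Int)
    obtain W V where "openin (top_of_set Y) W" "y \<in> W" "W \<subseteq> Y \<inter> ball y (d y / 2)"
      "openin (top_of_set X) V" "f y \<in> V"
      "\<And>x. x \<in> V \<Longrightarrow> x \<noteq> f y \<Longrightarrow> card {u \<in> W. f u = x} = local_degree Y X f y"
      "\<And>u. u \<in> W \<Longrightarrow> u \<noteq> y \<Longrightarrow> locally_power Y X f u 1"
      by (rule locally_power_count[OF branched_cover_locally_power[OF f y'(1)] B]) blast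
    then have "Q y W V" unfolding Q_def y'(2) by blast
    then show ?thesis by blast
  qed
  then obtain W V where "\<And>y. y \<in> F \<Longrightarrow> Q y (W y) (V y)" by metis
  note WV = this[unfolded Q_def]
  have disj: "W y \<inter> W z = {}" if "y \<in> F" "z \<in> F" "y \<noteq> z" for y z
  proof (rule ccontr)
    assume "W y \<inter> W z \<noteq> {}"
    then obtain u where "u \<in> W y" "u \<in> W z" by blast
    then have "dist y u < d y / 2" "dist z u < d z / 2" using WV that by (auto simp: subset_iff)
    moreover have "d y \<le> dist y z" "d z \<le> dist y z" using d(2) that by (metis dist_commute)+
    moreover have "dist y z \<le> dist y u + dist z u" by (metis dist_triangle2)
    ultimately show False by linarith
  qed
  define C where "C = Y - (\<Union>y\<in>F. W y)"
  have "openin (top_of_set Y) (\<Union>y\<in>F. W y)" using WV by blast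
  then have "compact C"
    unfolding C_def using Y by (metis closedin_compact closedin_diff closedin_subtopology_refl topspace_euclidean_subtopology closedin_topspace)
  then have "compact (f ` C)" by (rule compact_continuous_image[rotated]) (use cont in \<open>auto simp: C_def intro: continuous_on_subset\<close>)
  then have "closed (f ` C)" by (rule compact_imp_closed)
  define T where "T = (X - f ` C) \<inter> (X \<inter> (\<Inter>y\<in>F. V y))"
  have "openin (top_of_set X) (X - f ` C)"
    using \<open>closed (f ` C)\<close> by (simp add: Diff_eq openin_open_Int open_Compl)
  moreover have "openin (top_of_set X) (X \<inter> (\<Inter>y\<in>F. V y))"
  proof (cases "F = {}")
    case False
    then have "openin (top_of_set X) (\<Inter>y\<in>F. V y)" using WV finF by (intro openin_INT2) auto
    then show ?thesis by (rule openin_Int[OF openin_subtopology_self])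
  qed simp
  ultimately have T: "openin (top_of_set X) T" unfolding T_def by (rule openin_Int)
  have xT: "x \<in> T" using x WV by (auto simp: T_def C_def F_def)
  have "(\<Sum>y | y \<in> Y \<and> f y = x'. local_degree Y X f y) = (\<Sum>y\<in>F. local_degree Y X f y)"
    if x': "x' \<in> T" "x' \<noteq> x" for x'
  proof -
    have fib: "{y \<in> Y. f y = x'} = (\<Union>y\<in>F. {u \<in> W y. f u = x'})"
    proof -
      have "u \<in> Y" if "y \<in> F" "u \<in> W y" for y u using WV[OF that(1)] that(2) by blast
      moreover have "\<exists>y\<in>F. u \<in> W y" if "u \<in> Y" "f u = x'" for u
        using that x'(1) by (auto simp: T_def C_def)
      ultimately show ?thesis by blast
    qed
    have deg1: "local_degree Y X f u = 1" if "y \<in> F" "u \<in> W y" "f u = x'" for y u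
    proof -
      have "u \<noteq> y" using that x' by (auto simp: F_def)
      moreover have "\<forall>u \<in> W y - {y}. locally_power Y X f u 1" using WV[OF that(1)] by (elim conjE)
      ultimately have "locally_power Y X f u 1" using that(2) by blast
      then show ?thesis by (rule local_degree_eq)
    qed
    have "(\<Sum>y | y \<in> Y \<and> f y = x'. local_degree Y X f y)
        = (\<Sum>y\<in>F. \<Sum>u | u \<in> W y \<and> f u = x'. local_degree Y X f u)"
      unfolding fib
    proof (rule sum.UNION_disjoint[OF finF])
      show "\<forall>y\<in>F. finite {u \<in> W y. f u = x'}"
        using finite_fibre[OF f Y, of x'] unfolding fib using finF by auto
      show "\<forall>i\<in>F. \<forall>j\<in>F. i \<noteq> j \<longrightarrow> {u \<in> W i. f u = x'} \<inter> {u \<in> W j. f u = x'} = {}"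
        using disj by blast
    qed
    also have "\<dots> = (\<Sum>y\<in>F. card {u \<in> W y. f u = x'})"
      by (intro sum.cong refl) (simp add: deg1)
    also have "\<dots> = (\<Sum>y\<in>F. local_degree Y X f y)"
    proof (intro sum.cong refl)
      fix y assume y: "y \<in> F"
      have "\<forall>x' \<in> V y - {x}. card {u \<in> W y. f u = x'} = local_degree Y X f y"
        using WV[OF y] by (elim conjE)
      then show "card {u \<in> W y. f u = x'} = local_degree Y X f y" using x' y by (auto simp: T_def)
    qed
    finally show ?thesis .
  qed
  then have "sum_mset (local_degrees_over Y X f x') = sum_mset (local_degrees_over Y X f x)"
    if "x' \<in> T" for x'
    using that by (cases "x' = x") (simp_all add: sum_local_degrees_over F_def)
  then show "\<exists>T. openin (top_of_set X) T \<and> x \<in> T \<and>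
     (\<forall>x'\<in>T. sum_mset (local_degrees_over Y X f x') = sum_mset (local_degrees_over Y X f x))"
    using T xT by blast
qed

lemma has_degree_iff_sum_local_degrees:
  fixes Y :: "'a::metric_space set" and X :: "'b::t2_space set"
  assumes f: "branched_cover Y X f" and Y: "compact Y" and X: "connected X" "infinite X" and x0: "x0 \<in> X"
  shows "has_degree Y X f d \<longleftrightarrow> sum_mset (local_degrees_over Y X f x0) = d"
proof -
  let ?N = "\<lambda>x. sum_mset (local_degrees_over Y X f x)"
  have const: "?N x = ?N x0" if "x \<in> X" for x
    using sum_local_degrees_constant[OF f Y X(1)] that x0 unfolding constant_on_def by metis
  have unbr: "card {y \<in> Y. f y = x} = ?N x0" if x: "x \<in> X - branch_points Y X f" for x
  proof -
    have "local_degree Y X f y = 1" if "y \<in> Y" "f y = x" for y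
      using x that local_degree_pos[OF f that(1)] unfolding branch_points_def by force
    then have "?N x = card {y \<in> Y. f y = x}" unfolding sum_local_degrees_over by simp
    then show ?thesis using const x by simp
  qed
  have "infinite (X - branch_points Y X f)"
    using X(2) finite_branch_points[OF f Y] by simp
  then have "X - branch_points Y X f \<noteq> {}" by (metis finite.emptyI)
  then obtain x1 where x1: "x1 \<in> X - branch_points Y X f" by blast
  have "?N x0 > 0"
  proof -
    obtain y where y: "y \<in> Y" "f y = x0" using f x0 by (auto simp: branched_cover_def)
    have "?N x0 \<noteq> 0" unfolding sum_local_degrees_over
      using finite_fibre[OF f Y, of x0] y local_degree_pos[OF f y(1)] by (subst sum_eq_0_iff) auto
    then show ?thesis by (simp only: neq0_conv)
  qed
  then show ?thesis unfolding has_degree_def using unbr x1 by metis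
qed

section \<open>Gluing continuous roots\<close>

definition has_root :: "nat \<Rightarrow> ('a::topological_space \<Rightarrow> complex) \<Rightarrow> 'a set \<Rightarrow> bool" where
  "has_root m q S \<longleftrightarrow> (\<exists>r. continuous_on S r \<and> (\<forall>x\<in>S. r x ^ m = q x))"

lemma has_root_subset: "has_root m q S \<Longrightarrow> T \<subseteq> S \<Longrightarrow> has_root m q T"
  unfolding has_root_def by (meson continuous_on_subset subsetD)

lemma has_root_contractible:
  fixes q :: "'a::real_normed_vector \<Rightarrow> complex"
  assumes "continuous_on S q" "contractible S" "\<And>z. z \<in> S \<Longrightarrow> q z \<noteq> 0" "m > 0"
  shows "has_root m q S"
proof -
  obtain g where g: "continuous_on S g" "\<And>x. x \<in> S \<Longrightarrow> q x = exp (g x)"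
    using continuous_logarithm_on_contractible[OF assms(1-3)] by blast
  have "continuous_on S (\<lambda>x. exp (g x / of_nat m))" using assms(4) by (intro continuous_intros g(1)) auto
  moreover have "exp (g x / of_nat m) ^ m = q x" if "x \<in> S" for x
    using assms(4) g(2)[OF that] by (simp flip: exp_of_nat_mult)
  ultimately show ?thesis unfolding has_root_def by blast
qed

text \<open>
  The Mayer-Vietoris argument for roots: on the connected intersection the two roots differ by a root of
  unity, by which one of them is multiplied.
\<close>

lemma has_root_Un:
  fixes q :: "'a::topological_space \<Rightarrow> complex"
  assumes S: "openin (top_of_set (S \<union> T)) S" "has_root m q S"
    and T: "openin (top_of_set (S \<union> T)) T" "has_root m q T"
    and conn: "connected (S \<inter> T)" and nz: "\<And>x. x \<in> S \<inter> T \<Longrightarrow> q x \<noteq> 0" and m: "m > 0"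
  shows "has_root m q (S \<union> T)"
proof -
  obtain r where r: "continuous_on S r" "\<And>x. x \<in> S \<Longrightarrow> r x ^ m = q x" using S(2) by (auto simp: has_root_def)
  obtain s where s: "continuous_on T s" "\<And>x. x \<in> T \<Longrightarrow> s x ^ m = q x" using T(2) by (auto simp: has_root_def)
  have s0: "s x \<noteq> 0" if "x \<in> S \<inter> T" for x using nz[OF that] s(2)[of x] that m by (auto simp: zero_power)
  obtain \<zeta> where \<zeta>m: "\<zeta> ^ m = 1" and \<zeta>: "\<And>x. x \<in> S \<inter> T \<Longrightarrow> r x = \<zeta> * s x"
    by (rule nth_roots_proportional[OF conn continuous_on_subset[OF r(1)] continuous_on_subset[OF s(1)] _ s0 m])
       (use r(2) s(2) in auto)
  define w where "w x = (if x \<in> S then r x else \<zeta> * s x)" for x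
  have "continuous_on (S \<union> T) w"
    unfolding w_def
  proof (rule continuous_on_cases_local_open[OF S(1) T(1) r(1)])
    show "continuous_on T (\<lambda>x. \<zeta> * s x)" by (intro continuous_intros s(1))
  qed (use \<zeta> in auto)
  moreover have "w x ^ m = q x" if "x \<in> S \<union> T" for x
    using that r(2) s(2) \<zeta>m by (auto simp: w_def power_mult_distrib)
  ultimately show ?thesis unfolding has_root_def by blast
qed

lemma has_root_open_Un:
  fixes q :: "complex \<Rightarrow> complex"
  assumes "open S" "open T" "has_root m q S" "has_root m q T" "connected (S \<inter> T)"
    "\<And>x. x \<in> S \<inter> T \<Longrightarrow> q x \<noteq> 0" "m > 0"
  shows "has_root m q (S \<union> T)"
  using assms by (intro has_root_Un) (auto intro: open_subset)

text \<open>
  \<open>U\<close> slit along either horizontal ray from \<open>c\<close> is starlike and carries a root. The two slit sets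
  overlap in two components, so they cannot be glued directly. The punctured disc, on which the
  root is given, is added to the first slit set to make the overlap connected.
\<close>

lemma has_root_convex_puncture:
  fixes q :: "complex \<Rightarrow> complex"
  assumes U: "open U" "convex U" and q: "continuous_on (U - {c}) q" "\<And>z. z \<in> U - {c} \<Longrightarrow> q z \<noteq> 0"
    and \<epsilon>: "\<epsilon> > 0" "ball c \<epsilon> \<subseteq> U" "has_root m q (ball c \<epsilon> - {c})" and m: "m > 0"
  shows "has_root m q (U - {c})"
proof -
  define ray where "ray s = {z. Im z = Im c \<and> s * (Re z - Re c) \<ge> 0}" for s :: real
  have cl: "closed (ray s)" for s
    unfolding ray_def by (intro closed_Collect_conj closed_Collect_eq closed_Collect_le continuous_intros)
  have c_ray: "c \<in> ray s" for s by (simp add: ray_def)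
  \<comment> \<open>a convex set containing c, slit along a ray from c, is starlike about a point of the opposite ray\<close>
  have star: "starlike (C - ray s)" if C: "open C" "convex C" "c \<in> C" and s: "s = 1 \<or> s = -1" for C s
  proof -
    obtain e where e: "e > 0" "ball c e \<subseteq> C" using C by (meson openE)
    define a where "a = c - of_real (s * (e / 2))"
    have a: "Im a = Im c" "s * (Re a - Re c) = - (e / 2)"
      using s by (auto simp: a_def)
    have "norm (c - a) < e" using e s by (auto simp: a_def norm_mult)
    then have aC: "a \<in> C" using e(2) by (auto simp: dist_norm)
    have aR: "a \<notin> ray s" using a e by (simp add: ray_def)
    show ?thesis unfolding starlike_def
    proof (intro bexI[of _ a] ballI subsetI)
      fix x w assume x: "x \<in> C - ray s" and w: "w \<in> closed_segment a x"
      have wC: "w \<in> C" using w x aC C(2) closed_segment_subset by (meson DiffD1 subsetD)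
      obtain t where t: "0 \<le> t" "t \<le> 1" "w = (1 - t) *\<^sub>R a + t *\<^sub>R x"
        using w by (auto simp: in_segment)
      have Imw: "Im w - Im c = t * (Im x - Im c)" by (simp add: t a algebra_simps)
      have Rew: "s * (Re w - Re c) = (1 - t) * (s * (Re a - Re c)) + t * (s * (Re x - Re c))"
        by (simp add: t algebra_simps)
      have "w \<notin> ray s"
      proof
        assume wr: "w \<in> ray s"
        then have "t * (Im x - Im c) = 0" using Imw by (simp add: ray_def)
        then consider "t = 0" | "Im x = Im c" by auto
        then show False
        proof cases
          case 1 then show False using wr aR t by simp
        next
          case 2
          then have "s * (Re x - Re c) < 0" using x by (auto simp: ray_def)
          then have "t * (s * (Re x - Re c)) \<le> 0" using t by (simp add: mult_nonneg_nonpos)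
          moreover have "(1 - t) * (s * (Re a - Re c)) \<le> 0" using t e a by (simp add: mult_nonneg_nonpos)
          moreover have "s * (Re w - Re c) \<ge> 0" using wr by (simp add: ray_def)
          ultimately have "(1 - t) * (s * (Re a - Re c)) = 0" "t * (s * (Re x - Re c)) = 0"
            using Rew by linarith+
          then show False using a e \<open>s * (Re x - Re c) < 0\<close> by auto
        qed
      qed
      then show "w \<in> C - ray s" using wC by blast
    qed (use aC aR in blast)
  qed
  have cU: "c \<in> U" using \<epsilon> by auto
  have root_slit: "has_root m q (U - ray s)" if "s = 1 \<or> s = -1" for s
  proof (rule has_root_contractible[OF _ _ _ m])
    show "continuous_on (U - ray s) q" by (rule continuous_on_subset[OF q(1)]) (use c_ray in auto)
    show "contractible (U - ray s)" using star[OF U cU that] by (rule starlike_imp_contractible)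
    show "\<And>z. z \<in> U - ray s \<Longrightarrow> q z \<noteq> 0" using q(2) c_ray by blast
  qed
  define D where "D = ball c \<epsilon> - {c}"
  have D: "open D" "has_root m q D" using \<epsilon> by (auto simp: D_def open_delete)
  have D_slit: "connected (ball c \<epsilon> - ray s)" if "s = 1 \<or> s = -1" for s
    using star[of "ball c \<epsilon>" s] \<epsilon>(1) that starlike_imp_connected by auto
  have "has_root m q ((U - ray 1) \<union> D)"
  proof (rule has_root_open_Un[OF _ D(1) _ D(2) _ _ m])
    show "open (U - ray 1)" using U cl by blast
    show "has_root m q (U - ray 1)" by (rule root_slit) simp
    have "(U - ray 1) \<inter> D = ball c \<epsilon> - ray 1" using \<epsilon>(2) c_ray by (auto simp: D_def)
    then show "connected ((U - ray 1) \<inter> D)" using D_slit by simp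
    show "\<And>x. x \<in> (U - ray 1) \<inter> D \<Longrightarrow> q x \<noteq> 0" using q(2) by (auto simp: D_def)
  qed
  then have "has_root m q (((U - ray 1) \<union> D) \<union> (U - ray (-1)))"
  proof (rule has_root_open_Un[rotated 2, OF _ _ _ _ m])
    show "open ((U - ray 1) \<union> D)" using U cl D by blast
    show "open (U - ray (-1))" using U cl by blast
    show "has_root m q (U - ray (-1))" by (rule root_slit) simp
    show "q x \<noteq> 0" if "x \<in> ((U - ray 1) \<union> D) \<inter> (U - ray (-1))" for x
      using q(2) that c_ray[of "-1"] by blast
    define up where "up = U \<inter> {z. Im z > Im c}"
    define lo where "lo = U \<inter> {z. Im z < Im c}"
    define B where "B = ball c \<epsilon> - ray (-1)"
    have eq: "((U - ray 1) \<union> D) \<inter> (U - ray (-1)) = (up \<union> B) \<union> lo"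
    proof (intro equalityI subsetI)
      fix z assume z: "z \<in> ((U - ray 1) \<union> D) \<inter> (U - ray (-1))"
      show "z \<in> (up \<union> B) \<union> lo"
      proof (cases "Im z = Im c")
        case True
        then have "z \<in> D" using z by (auto simp: ray_def)
        then show ?thesis using z by (auto simp: B_def D_def)
      next
        case False
        then show ?thesis using z by (auto simp: up_def lo_def)
      qed
    next
      fix z assume z: "z \<in> (up \<union> B) \<union> lo"
      then show "z \<in> ((U - ray 1) \<union> D) \<inter> (U - ray (-1))"
        using \<epsilon>(2) c_ray[of "-1"] by (auto simp: up_def lo_def B_def D_def ray_def)
    qed
    have cB: "connected B" unfolding B_def by (rule D_slit) simp
    have "c + \<i> * of_real (\<epsilon> / 2) \<in> up \<inter> B" "c - \<i> * of_real (\<epsilon> / 2) \<in> B \<inter> lo"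
      using \<epsilon> by (auto simp: up_def lo_def B_def ray_def dist_norm norm_mult intro!: subsetD[OF \<epsilon>(2)])
    then have ne: "up \<inter> B \<noteq> {}" "(up \<union> B) \<inter> lo \<noteq> {}" by blast+
    have "convex up" "convex lo" unfolding up_def lo_def
      using U(2) by (auto intro!: convex_Int convex_halfspace_Im_gt convex_halfspace_Im_lt)
    then have "connected up" "connected lo" by (auto intro: convex_connected)
    then have "connected ((up \<union> B) \<union> lo)"
      using cB ne by (intro connected_Un) auto
    then show "connected (((U - ray 1) \<union> D) \<inter> (U - ray (-1)))" by (simp only: eq)
  qed
  moreover have "((U - ray 1) \<union> D) \<union> (U - ray (-1)) = U - {c}"
  proof -
    have "ray 1 \<inter> ray (-1) = {c}" by (auto simp: ray_def complex_eq_iff)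
    then show ?thesis using \<epsilon>(2) by (auto simp: D_def)
  qed
  ultimately show ?thesis by simp
qed

text \<open>
  Two punctures are separated by a strip without punctures. Two overlapping open half-planes that meet in
  this strip each cut out of \<open>U\<close> a convex set with fewer punctures, and the intersection of these is convex.
\<close>

lemma has_root_convex_punctures:
  fixes q :: "complex \<Rightarrow> complex"
  assumes "finite C" "open U" "convex U" "continuous_on (U - C) q" "\<And>z. z \<in> U - C \<Longrightarrow> q z \<noteq> 0"
    and "C \<subseteq> U" and "\<And>c. c \<in> C \<Longrightarrow> \<exists>\<epsilon>>0. has_root m q (ball c \<epsilon> - {c})" and m: "m > 0"
  shows "has_root m q (U - C)"
  using assms(1-7)
proof (induction "card C" arbitrary: C U rule: less_induct)
  case less
  consider "C = {}" | c where "C = {c}" | c c' where "c \<in> C" "c' \<in> C" "c \<noteq> c'" by blast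
  then show ?case
  proof cases
    case 1
    then show ?thesis using less.prems m
      by (intro has_root_contractible) (auto intro: convex_imp_contractible)
  next
    case (2 c)
    obtain \<epsilon> where \<epsilon>: "\<epsilon> > 0" "has_root m q (ball c \<epsilon> - {c})" using less.prems(7) 2 by auto
    obtain \<epsilon>' where \<epsilon>': "\<epsilon>' > 0" "ball c \<epsilon>' \<subseteq> U" using less.prems(2,6) 2 by (auto intro: openE)
    have "has_root m q (ball c (min \<epsilon> \<epsilon>') - {c})" by (rule has_root_subset[OF \<epsilon>(2)]) auto
    moreover have "ball c (min \<epsilon> \<epsilon>') \<subseteq> U" using \<epsilon>'(2) by auto
    ultimately show ?thesis
      using has_root_convex_puncture[of U c q "min \<epsilon> \<epsilon>'" m] less.prems 2 \<epsilon>(1) \<epsilon>'(1) m by simp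
  next
    case (3 c c')
    define l where "l z = (z - c) \<bullet> (c' - c)" for z
    have l_c: "l c = 0" "l c' > 0" using 3 by (auto simp: l_def)
    \<comment> \<open>The strip 0 < l < \<beta> contains no puncture.\<close>
    define \<beta> where "\<beta> = Min {x \<in> l ` C. x > 0}"
    have fin: "finite {x \<in> l ` C. x > 0}" "{x \<in> l ` C. x > 0} \<noteq> {}" using less.prems(1) l_c 3 by auto
    have \<beta>0: "\<beta> > 0" using Min_in[OF fin] by (simp add: \<beta>_def)
    have gap: "l z \<le> 0 \<or> l z \<ge> \<beta>" if "z \<in> C" for z
    proof (cases "l z > 0")
      case True
      then show ?thesis using Min_le[OF fin(1), of "l z"] that by (simp add: \<beta>_def)
    qed simp
    define U1 where "U1 = U \<inter> {z. l z < \<beta>}"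
    define U2 where "U2 = U \<inter> {z. l z > 0}"
    have l': "l z = (c' - c) \<bullet> z - (c' - c) \<bullet> c" for z
      by (simp add: l_def inner_diff_left inner_diff_right inner_commute algebra_simps)
    have H: "{z. l z < \<beta>} = {z. (c' - c) \<bullet> z < \<beta> + (c' - c) \<bullet> c}" "{z. l z > 0} = {z. (c' - c) \<bullet> z > (c' - c) \<bullet> c}"
      by (auto simp: l')
    have U1: "open U1" "convex U1" and U2: "open U2" "convex U2"
      unfolding U1_def U2_def H using less.prems(2,3)
      by (auto intro: open_Int convex_Int open_halfspace_lt open_halfspace_gt convex_halfspace_lt convex_halfspace_gt)
    have part: "has_root m q (V - C)" if V: "open V" "convex V" "V \<subseteq> U" and x: "x \<in> C" "x \<notin> V" for V x
    proof -
      have "card (C \<inter> V) < card C" using x less.prems(1) by (intro psubset_card_mono) auto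
      moreover have "V - C \<inter> V = V - C" by blast
      moreover have "continuous_on (V - C) q" by (rule continuous_on_subset[OF less.prems(4)]) (use V in auto)
      ultimately show ?thesis
        using less.hyps[of "C \<inter> V" V] less.prems V by (auto simp: subset_iff)
    qed
    have r1: "has_root m q (U1 - C)" by (rule part[OF U1, of c'])
      (use 3 gap[of c'] l_c in \<open>auto simp: U1_def\<close>)
    have r2: "has_root m q (U2 - C)" by (rule part[OF U2, of c]) (use 3 l_c in \<open>auto simp: U2_def\<close>)
    have "has_root m q ((U1 - C) \<union> (U2 - C))"
    proof (rule has_root_open_Un[OF _ _ r1 r2 _ _ m])
      show "open (U1 - C)" "open (U2 - C)"
        using U1 U2 finite_imp_closed[OF less.prems(1)] by (auto intro: open_Diff)
      have "(U1 - C) \<inter> (U2 - C) = U1 \<inter> U2" using gap by (force simp: U1_def U2_def)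
      moreover have "convex (U1 \<inter> U2)" using U1 U2 by (intro convex_Int)
      ultimately show "connected ((U1 - C) \<inter> (U2 - C))" by (simp add: convex_connected)
      show "\<And>x. x \<in> (U1 - C) \<inter> (U2 - C) \<Longrightarrow> q x \<noteq> 0" using less.prems(5) by (auto simp: U1_def)
    qed
    moreover have "(U1 - C) \<union> (U2 - C) = U - C" using \<beta>0 by (auto simp: U1_def U2_def)
    ultimately show ?thesis by simp
  qed
qed

section \<open>Coordinates on the sphere\<close>

lemma chart_pullback:
  assumes h: "homeomorphism Y X \<theta> \<theta>'" and ch: "chart X V \<psi> (\<theta> y)" and y: "y \<in> Y"
  shows "chart Y (Y \<inter> \<theta> -` V) (\<lambda>u. \<psi> (\<theta> u)) y"
proof -
  have im: "\<theta> ` (Y \<inter> \<theta> -` V) = V"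
    using h chartD(2)[OF ch] by (auto simp: homeomorphism_def)
  have 1: "homeomorphism (Y \<inter> \<theta> -` V) V \<theta> \<theta>'"
    by (rule homeomorphism_of_subsets[OF h _ _ im]) (use chartD(2)[OF ch] in auto)
  obtain \<psi>' where 2: "homeomorphism V (\<psi> ` V) \<psi> \<psi>'" using ch by (auto simp: chart_def)
  have "openin (top_of_set Y) (Y \<inter> \<theta> -` V)"
    by (rule continuous_openin_preimage[OF homeomorphism_cont1[OF h] _ chartD(1)[OF ch]])
       (use homeomorphism_image1[OF h] in auto)
  moreover have "(\<lambda>u. \<psi> (\<theta> u)) ` (Y \<inter> \<theta> -` V) = \<psi> ` V" using im by (metis image_image)
  ultimately show ?thesis
    using homeomorphism_compose[OF 1 2] chartD(3,4,5)[OF ch] y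
    by (auto simp: chart_def comp_def)
qed

lemma S2_compact_connected_infinite: "compact S2" "connected S2" "S2 \<noteq> {}" "infinite S2"
proof -
  show "compact S2" by simp
  show c: "connected S2" by (rule connected_sphere) simp
  show "S2 \<noteq> {}" by simp
  show "infinite S2"
  proof
    assume "finite S2"
    moreover have "axis 1 1 \<in> S2" "- axis 1 1 \<in> S2" by simp_all
    moreover have "axis 1 1 \<noteq> (- axis 1 1 :: real^3)" 
      by (metis axis_eq_0_iff eq_neg_iff_add_eq_0 scaleR_2 scaleR_eq_0_iff zero_neq_numeral zero_neq_one)
    ultimately show False using c connected_finite_iff_sing by (metis empty_iff singletonD)
  qed
qed

text \<open>
  The map \<open>\<sigma>\<close> plays the part of a meromorphic coordinate of the Riemann sphere with its zero at \<open>a\<close> and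
  its pole at \<open>b\<close>; only its topological properties are used.
\<close>

locale sphere_coordinate =
  fixes a b :: "real ^ 3" and \<sigma> :: "real ^ 3 \<Rightarrow> complex" and \<sigma>i
  assumes ab: "a \<in> S2" "b \<in> S2" "a \<noteq> b"
    and homeo: "homeomorphism (S2 - {b}) UNIV \<sigma> \<sigma>i"
    and zero: "\<sigma> a = 0"
begin

lemma \<sigma>i_in: "\<sigma>i z \<in> S2" "\<sigma>i z \<noteq> b"
  using homeo unfolding homeomorphism_def by blast+

lemma \<sigma>_\<sigma>i [simp]: "\<sigma> (\<sigma>i z) = z"
  using homeo unfolding homeomorphism_def by blast

lemma \<sigma>i_\<sigma>: "x \<in> S2 \<Longrightarrow> x \<noteq> b \<Longrightarrow> \<sigma>i (\<sigma> x) = x"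
  using homeo unfolding homeomorphism_def by blast

lemma \<sigma>i_0: "\<sigma>i 0 = a"
  using \<sigma>i_\<sigma>[of a] ab zero by simp

lemma \<sigma>_eq_0: "x \<in> S2 \<Longrightarrow> x \<noteq> b \<Longrightarrow> \<sigma> x = 0 \<longleftrightarrow> x = a"
  using \<sigma>i_\<sigma> \<sigma>i_0 zero by metis

lemma \<sigma>i_eq_a: "\<sigma>i z = a \<longleftrightarrow> z = 0"
  using \<sigma>_\<sigma>i \<sigma>i_0 zero by metis

lemma continuous_\<sigma>: "continuous_on (S2 - {b}) \<sigma>" and continuous_\<sigma>i: "continuous_on A \<sigma>i"
  using homeo unfolding homeomorphism_def by (auto intro: continuous_on_subset)

lemma far_from_a_open: "openin (top_of_set S2) (S2 - \<sigma>i ` cball 0 M)"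
proof -
  have "compact (\<sigma>i ` cball 0 M)" by (intro compact_continuous_image continuous_\<sigma>i) simp
  then show ?thesis by (simp add: Diff_eq openin_open_Int open_Compl compact_imp_closed)
qed

lemma far_from_a_iff: "x \<in> S2 - \<sigma>i ` cball 0 M \<longleftrightarrow> x \<in> S2 \<and> (x = b \<or> norm (\<sigma> x) > M)"
proof (cases "x \<in> S2 \<and> x \<noteq> b")
  case True
  then have "x \<in> \<sigma>i ` cball 0 M \<longleftrightarrow> \<sigma> x \<in> cball 0 M" using \<sigma>i_\<sigma>[of x] by (metis \<sigma>_\<sigma>i image_iff)
  then show ?thesis using True by auto
next
  case False
  then show ?thesis using \<sigma>i_in ab by auto
qed

lemma far_in_neighbourhood_of_b:
  assumes "open T" "b \<in> T"
  obtains M where "M > 0" "\<And>z. norm z > M \<Longrightarrow> \<sigma>i z \<in> T"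
proof -
  have "compact (S2 - T)" using assms(1) by (intro compact_diff) auto
  then have "compact (\<sigma> ` (S2 - T))"
    using assms(2) by (intro compact_continuous_image continuous_on_subset[OF continuous_\<sigma>]) auto
  then obtain M where M: "M > 0" "\<And>x. x \<in> S2 - T \<Longrightarrow> norm (\<sigma> x) \<le> M"
    using compact_imp_bounded bounded_pos by (metis imageI)
  have "\<sigma>i z \<in> T" if "norm z > M" for z
    using M(2)[of "\<sigma>i z"] that \<sigma>i_in(1) by fastforce
  then show ?thesis using that M(1) by blast
qed

lemma tendsto_b:
  assumes "\<And>M. M > 0 \<Longrightarrow> eventually (\<lambda>y. g y \<in> S2 \<and> (g y = b \<or> norm (\<sigma> (g y)) > M)) F"
  shows "(g \<longlongrightarrow> b) F"
proof (rule topological_tendstoI)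
  fix T assume "open T" "b \<in> T"
  then obtain M where M: "M > 0" "\<And>z. norm z > M \<Longrightarrow> \<sigma>i z \<in> T" using far_in_neighbourhood_of_b by metis
  show "eventually (\<lambda>y. g y \<in> T) F"
    using assms[OF M(1)] by (rule eventually_mono) (metis M(2) \<open>b \<in> T\<close> \<sigma>i_\<sigma>)
qed

lemma eventually_far:
  assumes "(g \<longlongrightarrow> b) F" "eventually (\<lambda>y. g y \<in> S2) F"
  shows "eventually (\<lambda>y. g y \<in> S2 \<and> (g y = b \<or> norm (\<sigma> (g y)) > M)) F"
proof -
  obtain T where T: "open T" "S2 - \<sigma>i ` cball 0 M = S2 \<inter> T"
    using far_from_a_open by (auto simp: openin_open)
  have "b \<in> T" using T(2) far_from_a_iff[of b M] ab by blast
  then have "eventually (\<lambda>y. g y \<in> T) F" using assms(1) T(1) by (simp add: topological_tendstoD)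
  then show ?thesis using assms(2)
    by eventually_elim (metis IntI T(2) far_from_a_iff)
qed

definition \<kappa> where "\<kappa> x = (if x = b then 0 else inverse (\<sigma> x))"

lemma homeomorphism_\<kappa>: "homeomorphism (S2 - {a}) UNIV \<kappa> (\<lambda>w. if w = 0 then b else \<sigma>i (inverse w))"
proof (rule homeomorphismI)
  show "continuous_on (S2 - {a}) \<kappa>" unfolding continuous_on_def
  proof
    fix x assume x: "x \<in> S2 - {a}"
    show "(\<kappa> \<longlongrightarrow> \<kappa> x) (at x within S2 - {a})"
    proof (cases "x = b")
      case False
      have "continuous_on (S2 - {a} - {b}) (\<lambda>x. inverse (\<sigma> x))"
        using \<sigma>_eq_0 by (intro continuous_intros continuous_on_subset[OF continuous_\<sigma>]) auto
      then have "continuous_on (S2 - {a} - {b}) \<kappa>"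
        by (rule continuous_on_eq) (simp add: \<kappa>_def)
      then have "(\<kappa> \<longlongrightarrow> \<kappa> x) (at x within S2 - {a} - {b})"
        using x False by (auto simp: continuous_on_def)
      moreover have "at x within S2 - {a} = at x within S2 - {a} - {b}"
        by (rule at_within_nhd[of x "- {b}"]) (use False in auto)
      ultimately show ?thesis by simp
    next
      case True
      have "(\<kappa> \<longlongrightarrow> 0) (at b within S2 - {a})"
      proof (rule tendstoI)
        fix e :: real assume e: "e > 0"
        have "eventually (\<lambda>y. y \<in> S2 \<and> (y = b \<or> norm (\<sigma> y) > 1 / e)) (at b within S2 - {a})"
        proof (rule eventually_far)
          show "((\<lambda>y. y) \<longlongrightarrow> b) (at b within S2 - {a})" by (rule tendsto_ident_at)
          show "eventually (\<lambda>y. y \<in> S2) (at b within S2 - {a})" by (auto simp: eventually_at_filter)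
        qed
        then show "eventually (\<lambda>y. dist (\<kappa> y) 0 < e) (at b within S2 - {a})"
        proof (rule eventually_mono)
          fix y assume "y \<in> S2 \<and> (y = b \<or> norm (\<sigma> y) > 1 / e)"
          then show "dist (\<kappa> y) 0 < e"
            using e less_imp_inverse_less[of "1 / e" "norm (\<sigma> y)"] by (auto simp: \<kappa>_def norm_inverse)
        qed
      qed
      then show ?thesis using True by (simp add: \<kappa>_def)
    qed
  qed
  show "continuous_on UNIV (\<lambda>w. if w = 0 then b else \<sigma>i (inverse w))" (is "continuous_on UNIV ?k") unfolding continuous_on_def
  proof
    fix w :: complex
    show "(?k \<longlongrightarrow> ?k w) (at w within UNIV)"
    proof (cases "w = 0")
      case False
      have "continuous_on (UNIV - {0}) (\<lambda>w. \<sigma>i (inverse w))"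
        by (intro continuous_on_compose2[OF continuous_\<sigma>i[of UNIV]] continuous_intros) auto
      then have "continuous_on (UNIV - {0}) ?k" by (rule continuous_on_eq) auto
      then have "(?k \<longlongrightarrow> ?k w) (at w within UNIV - {0})"
        using False by (auto simp: continuous_on_def)
      moreover have "at w within UNIV = at w within UNIV - {0}"
        by (rule at_within_nhd[of w "- {0}"]) (use False in auto)
      ultimately show ?thesis by simp
    next
      case True
      have "(?k \<longlongrightarrow> b) (at 0)"
      proof (rule tendsto_b)
        fix M :: real assume M: "M > 0"
        have "eventually (\<lambda>w. w \<noteq> 0 \<and> norm w < 1 / M) (at (0::complex))"
          using M by (auto simp: eventually_at intro!: exI[of _ "1 / M"])
        then show "eventually (\<lambda>w. ?k w \<in> S2 \<and> (?k w = b \<or> norm (\<sigma> (?k w)) > M)) (at 0)"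
          by (rule eventually_mono) (use M \<sigma>i_in in \<open>auto simp: norm_inverse field_simps inverse_eq_divide norm_divide\<close>)
      qed
      then show ?thesis using True by simp
    qed
  qed
  show "(\<lambda>w. if w = 0 then b else \<sigma>i (inverse w)) ` UNIV \<subseteq> S2 - {a}"
  proof clarify
    fix w :: complex
    show "(if w = 0 then b else \<sigma>i (inverse w)) \<in> S2 - {a}"
      using \<sigma>i_in ab \<sigma>i_eq_a[of "inverse w"] by simp
  qed
  show "(if \<kappa> x = 0 then b else \<sigma>i (inverse (\<kappa> x))) = x" if "x \<in> S2 - {a}" for x
    using that \<sigma>_eq_0 \<sigma>i_\<sigma> by (auto simp: \<kappa>_def)
  show "\<kappa> (if w = 0 then b else \<sigma>i (inverse w)) = w" for w
    using \<sigma>i_in by (auto simp: \<kappa>_def)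
qed auto

lemma chart_a: "chart S2 (S2 - {b}) \<sigma> a"
proof -
  have "openin (top_of_set S2) (S2 - {b})" by (simp add: openin_delete)
  then show ?thesis
    using chart_of_homeomorphism_UNIV[OF homeo, of S2 a] zero ab by simp
qed

lemma chart_b: "chart S2 (S2 - {a}) \<kappa> b"
proof -
  have "openin (top_of_set S2) (S2 - {a})" by (simp add: openin_delete)
  then show ?thesis
    using chart_of_homeomorphism_UNIV[OF homeomorphism_\<kappa>, of S2 b] ab
    by (simp add: \<kappa>_def[of b])
qed

end

lemma sphere_coordinate_exists:
  assumes "a \<in> S2" "b \<in> S2" "a \<noteq> b"
  obtains \<sigma> \<sigma>i where "sphere_coordinate a b \<sigma> \<sigma>i"
proof -
  have "(S2 - {b}) homeomorphic (UNIV :: complex set)"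
    by (rule homeomorphic_punctured_sphere_affine) (use assms(2) in \<open>auto simp: aff_dim_UNIV\<close>)
  then obtain \<sigma> \<sigma>i where h: "homeomorphism (S2 - {b}) (UNIV :: complex set) \<sigma> \<sigma>i"
    by (auto simp: homeomorphic_def)
  have "homeomorphism UNIV UNIV (\<lambda>z. z - \<sigma> a) (\<lambda>z. z + \<sigma> a)"
    by (intro homeomorphismI continuous_intros) auto
  from homeomorphism_compose[OF h this]
  have "sphere_coordinate a b ((\<lambda>z. z - \<sigma> a) \<circ> \<sigma>) (\<sigma>i \<circ> (\<lambda>z. z + \<sigma> a))"
    using assms by unfold_locales auto
  then show ?thesis by (rule that)
qed

lemma locally_power_homeomorphism:
  assumes h: "homeomorphism S2 S2 \<theta> \<theta>'" and y: "y \<in> S2"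
  shows "locally_power S2 S2 \<theta> y 1"
proof -
  have ty: "\<theta> y \<in> S2" using h y by (auto simp: homeomorphism_def)
  obtain b where b: "b \<in> S2" "\<theta> y \<noteq> b"
    using S2_compact_connected_infinite(4) by (metis finite.simps finite_insert infinite_imp_nonempty insertCI insert_iff subsetI subset_singletonD)
  then obtain \<sigma> \<sigma>i where "sphere_coordinate (\<theta> y) b \<sigma> \<sigma>i" using sphere_coordinate_exists[OF ty] by metis
  then have c: "chart S2 (S2 - {b}) \<sigma> (\<theta> y)" by (rule sphere_coordinate.chart_a)
  show ?thesis
    by (rule locally_powerI[where \<psi> = \<sigma> and f = \<theta> and m = 1, OF _ chart_pullback[OF h c y] c]) auto
qed

text \<open>
  In a coordinate whose pole avoids all the points, a homeomorphism of the plane that is the identity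
  outside a bounded set moves the points, and it extends by fixing the pole.
\<close>

lemma S2_move_points:
  fixes x y :: "'i \<Rightarrow> real ^ 3"
  assumes K: "finite K" and x: "x ` K \<subseteq> S2" "inj_on x K" and y: "y ` K \<subseteq> S2" "inj_on y K"
  obtains \<theta> \<theta>' where "homeomorphism S2 S2 \<theta> \<theta>'" "\<And>i. i \<in> K \<Longrightarrow> \<theta> (x i) = y i"
proof -
  have "infinite (S2 - (x ` K \<union> y ` K))" using S2_compact_connected_infinite(4) K by simp
  then have "S2 - (x ` K \<union> y ` K) \<noteq> {}" by (rule infinite_imp_nonempty)
  then obtain b where b: "b \<in> S2" "b \<notin> x ` K" "b \<notin> y ` K" by blast
  have "infinite (S2 - {b})" using S2_compact_connected_infinite(4) by simp
  then have "S2 - {b} \<noteq> {}" by (rule infinite_imp_nonempty)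
  then obtain a where a: "a \<in> S2" "a \<noteq> b" by blast
  obtain \<sigma> \<sigma>i where "sphere_coordinate a b \<sigma> \<sigma>i" using sphere_coordinate_exists a b by metis
  then interpret sphere_coordinate a b \<sigma> \<sigma>i .
  have inS: "x i \<in> S2" "x i \<noteq> b" "y i \<in> S2" "y i \<noteq> b" if "i \<in> K" for i using that b x y by auto
  have inj: "pairwise (\<lambda>i j. \<sigma> (x i) \<noteq> \<sigma> (x j) \<and> \<sigma> (y i) \<noteq> \<sigma> (y j)) K"
    unfolding pairwise_def using inS x(2) y(2) \<sigma>i_\<sigma> by (metis inj_onD)
  obtain F G where FG: "homeomorphism UNIV UNIV F G" "\<And>i. i \<in> K \<Longrightarrow> F (\<sigma> (x i)) = \<sigma> (y i)"
    "bounded {z. \<not> (F z = z \<and> G z = z)}"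
    by (rule homeomorphism_moving_points_exists[of "UNIV :: complex set" UNIV K "\<sigma> \<circ> x" "\<sigma> \<circ> y"])
       (use K inj in auto)
  obtain B where B: "\<And>z. norm z > B \<Longrightarrow> F z = z \<and> G z = z"
    using FG(3) unfolding bounded_iff by (metis (mono_tags, lifting) linorder_not_less mem_Collect_eq)
  define ext where "ext H z = (if z = b then b else \<sigma>i (H (\<sigma> z)))" for H z
  have ext_cont: "continuous_on S2 (ext H)"
    if H: "continuous_on UNIV H" "\<And>z. norm z > B \<Longrightarrow> H z = z" for H
    unfolding continuous_on_def
  proof
    fix z assume z: "z \<in> S2"
    show "(ext H \<longlongrightarrow> ext H z) (at z within S2)"
    proof (cases "z = b")
      case False
      have "continuous_on (S2 - {b}) (\<lambda>z. \<sigma>i (H (\<sigma> z)))"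
        by (intro continuous_on_compose2[OF continuous_\<sigma>i[of UNIV]] continuous_on_compose2[OF H(1)] continuous_\<sigma>) auto
      then have "continuous_on (S2 - {b}) (ext H)" by (rule continuous_on_eq) (simp add: ext_def)
      then have "(ext H \<longlongrightarrow> ext H z) (at z within S2 - {b})" using z False by (auto simp: continuous_on_def)
      moreover have "at z within S2 = at z within S2 - {b}"
        by (rule at_within_nhd[of z "- {b}"]) (use False in auto)
      ultimately show ?thesis by simp
    next
      case True
      have "(ext H \<longlongrightarrow> b) (at b within S2)"
      proof (rule tendsto_b)
        fix M :: real assume "M > 0"
        have "eventually (\<lambda>y. y \<in> S2 \<and> (y = b \<or> norm (\<sigma> y) > max M B)) (at b within S2)"
          by (rule eventually_far[OF tendsto_ident_at]) (auto simp: eventually_at_filter)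
        then show "eventually (\<lambda>y. ext H y \<in> S2 \<and> (ext H y = b \<or> norm (\<sigma> (ext H y)) > M)) (at b within S2)"
          by (rule eventually_mono) (use H(2) ab \<sigma>i_in in \<open>auto simp: ext_def\<close>)
      qed
      then show ?thesis using True by (simp add: ext_def)
    qed
  qed
  have FGs: "F (G z) = z" "G (F z) = z" "continuous_on UNIV F" "continuous_on UNIV G" for z
    using FG(1) by (auto simp: homeomorphism_def)
  have "homeomorphism S2 S2 (ext F) (ext G)"
  proof (rule homeomorphismI)
    show "continuous_on S2 (ext F)" "continuous_on S2 (ext G)" by (rule ext_cont; use FGs B in blast)+
    show "ext F ` S2 \<subseteq> S2" "ext G ` S2 \<subseteq> S2" using ab \<sigma>i_in by (auto simp: ext_def)
    show "ext G (ext F z) = z" "ext F (ext G z) = z" if "z \<in> S2" for z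
      using that \<sigma>i_in \<sigma>i_\<sigma> FGs by (auto simp: ext_def)
  qed
  moreover have "ext F (x i) = y i" if "i \<in> K" for i
    using inS[OF that] FG(2)[OF that] \<sigma>i_\<sigma> by (simp add: ext_def)
  ultimately show ?thesis using that by blast
qed

section \<open>Power maps of the sphere\<close>

text \<open>
  Off an unpunctured point \<open>p\<close> the claim is the planar case. A disc around \<open>p\<close> carries a root since \<open>q p\<close>
  is nonzero, and it meets the rest in a punctured disc, which is connected.
\<close>

lemma has_root_sphere_punctures:
  assumes P: "finite P" "P \<subseteq> S2" and q: "continuous_on (S2 - P) q" "\<And>x. x \<in> S2 - P \<Longrightarrow> q x \<noteq> 0"
    and loc: "\<And>c. c \<in> P \<Longrightarrow> \<exists>W. openin (top_of_set S2) W \<and> c \<in> W \<and> has_root m q (W - {c})"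
    and m: "m > 0"
  shows "has_root m q (S2 - P)"
proof -
  have "infinite (S2 - P)" using S2_compact_connected_infinite(4) P by simp
  then have "S2 - P \<noteq> {}" by (rule infinite_imp_nonempty)
  then obtain p where p: "p \<in> S2" "p \<notin> P" by blast
  have "infinite (S2 - {p})" using S2_compact_connected_infinite(4) by simp
  then have "S2 - {p} \<noteq> {}" by (rule infinite_imp_nonempty)
  then obtain a where a: "a \<in> S2" "a \<noteq> p" by blast
  obtain \<sigma> \<sigma>i where "sphere_coordinate a p \<sigma> \<sigma>i" using sphere_coordinate_exists a p by metis
  then interpret sphere_coordinate a p \<sigma> \<sigma>i .
  have \<sigma>i_P: "\<sigma>i z \<in> P \<longleftrightarrow> z \<in> \<sigma> ` P" for z
  proof
    show "\<sigma>i z \<in> P \<Longrightarrow> z \<in> \<sigma> ` P" using image_eqI[of z \<sigma> "\<sigma>i z" P] by simp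
    assume "z \<in> \<sigma> ` P"
    then obtain x where x: "x \<in> P" "z = \<sigma> x" by blast
    then have "x \<in> S2" "x \<noteq> p" using P(2) p(2) by auto
    then show "\<sigma>i z \<in> P" using x \<sigma>i_\<sigma> by simp
  qed
  have plane: "has_root m (\<lambda>z. q (\<sigma>i z)) (UNIV - \<sigma> ` P)"
  proof (rule has_root_convex_punctures[OF _ _ _ _ _ _ _ m])
    show "finite (\<sigma> ` P)" using P by simp
    show "continuous_on (UNIV - \<sigma> ` P) (\<lambda>z. q (\<sigma>i z))"
      by (rule continuous_on_compose2[OF q(1) continuous_\<sigma>i]) (use \<sigma>i_in \<sigma>i_P in auto)
    show "q (\<sigma>i z) \<noteq> 0" if "z \<in> UNIV - \<sigma> ` P" for z
      using that by (intro q(2)) (use \<sigma>i_in \<sigma>i_P in auto)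
    show "\<exists>\<epsilon>>0. has_root m (\<lambda>z. q (\<sigma>i z)) (ball c \<epsilon> - {c})" if c: "c \<in> \<sigma> ` P" for c
    proof -
      obtain y where y: "y \<in> P" "c = \<sigma> y" using c by blast
      then have yp: "y \<in> S2" "y \<noteq> p" using P(2) p(2) by auto
      obtain W where W: "openin (top_of_set S2) W" "y \<in> W" "has_root m q (W - {y})" using loc[OF y(1)] by blast
      obtain T where T: "open T" "W = S2 \<inter> T" using W(1) by (auto simp: openin_open)
      have "open (\<sigma>i -` T)" by (rule open_vimage[OF T(1) continuous_\<sigma>i])
      moreover have "c \<in> \<sigma>i -` T" using y(2) yp W(2) T(2) \<sigma>i_\<sigma>[of y] by auto
      ultimately obtain \<epsilon> where \<epsilon>: "\<epsilon> > 0" "ball c \<epsilon> \<subseteq> \<sigma>i -` T" by (meson openE)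
      obtain r where r: "continuous_on (W - {y}) r" "\<forall>x\<in>W - {y}. r x ^ m = q x"
        using W(3) by (auto simp: has_root_def)
      have sub: "\<sigma>i z \<in> W - {y}" if "z \<in> ball c \<epsilon> - {c}" for z
        using that \<epsilon>(2) T(2) \<sigma>i_in y by auto
      have "continuous_on (ball c \<epsilon> - {c}) (\<lambda>z. r (\<sigma>i z))"
        by (rule continuous_on_compose2[OF r(1) continuous_\<sigma>i]) (use sub in blast)
      then have "has_root m (\<lambda>z. q (\<sigma>i z)) (ball c \<epsilon> - {c})"
        unfolding has_root_def using r(2) sub by (intro exI[of _ "\<lambda>z. r (\<sigma>i z)"]) blast
      then show ?thesis using \<epsilon>(1) by blast
    qed
  qed auto
  obtain r where r: "continuous_on (UNIV - \<sigma> ` P) r" "\<forall>z\<in>UNIV - \<sigma> ` P. r z ^ m = q (\<sigma>i z)"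
    using plane by (auto simp: has_root_def)
  have \<sigma>_P: "\<sigma> x \<notin> \<sigma> ` P" if "x \<in> S2 - P - {p}" for x
    using that \<sigma>i_P[of "\<sigma> x"] \<sigma>i_\<sigma>[of x] by auto
  have "continuous_on (S2 - P - {p}) (\<lambda>x. r (\<sigma> x))"
  proof (rule continuous_on_compose2[OF r(1) continuous_on_subset[OF continuous_\<sigma>]])
    show "S2 - P - {p} \<subseteq> S2 - {p}" by blast
    show "\<sigma> ` (S2 - P - {p}) \<subseteq> UNIV - \<sigma> ` P"
      by (rule image_subsetI) (rule DiffI[OF UNIV_I \<sigma>_P])
  qed
  moreover have "r (\<sigma> x) ^ m = q x" if "x \<in> S2 - P - {p}" for x
    using r(2) \<sigma>_P[OF that] that \<sigma>i_\<sigma>[of x] by auto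
  ultimately have root_S: "has_root m q (S2 - P - {p})" unfolding has_root_def by blast
  \<comment> \<open>a disc around p on which q stays in a disc that misses the origin\<close>
  define B where "B = ball (q p) (norm (q p))"
  have qp: "q p \<noteq> 0" using q(2) p by blast
  have B0: "z \<noteq> 0" if "z \<in> B" for z using that by (auto simp: B_def dist_norm)
  have "openin (top_of_set (S2 - P)) ((S2 - P) \<inter> q -` B)"
    using q(1) by (simp add: B_def continuous_openin_preimage_gen)
  moreover have "openin (top_of_set S2) (S2 - P)"
    using P by (simp add: Diff_eq openin_open_Int open_Compl finite_imp_closed)
  ultimately have "openin (top_of_set S2) ((S2 - P) \<inter> q -` B)" using openin_trans by blast
  then obtain V where V: "open V" "(S2 - P) \<inter> q -` B = S2 \<inter> V" by (auto simp: openin_open)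
  have "p \<in> (S2 - P) \<inter> q -` B" using p qp by (simp add: B_def)
  then have "p \<in> V" using V(2) by blast
  then obtain M where M: "M > 0" "\<And>z. norm z > M \<Longrightarrow> \<sigma>i z \<in> V"
    using far_in_neighbourhood_of_b[OF V(1)] by metis
  define N where "N = S2 - \<sigma>i ` cball 0 M"
  have N_iff: "x \<in> N \<longleftrightarrow> x \<in> S2 \<and> (x = p \<or> norm (\<sigma> x) > M)" for x
    unfolding N_def by (rule far_from_a_iff)
  have NV: "N \<subseteq> (S2 - P) \<inter> q -` B" unfolding V(2)
  proof
    fix x assume "x \<in> N"
    then have x: "x \<in> S2" "x = p \<or> norm (\<sigma> x) > M" using N_iff by auto
    then show "x \<in> S2 \<inter> V"
      using M(2)[of "\<sigma> x"] \<sigma>i_\<sigma>[of x] \<open>p \<in> V\<close> by (cases "x = p") auto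
  qed
  have root_N: "has_root m q N"
  proof -
    have "has_root m (\<lambda>z. z) B"
      by (rule has_root_contractible[OF _ _ B0 m]) (auto simp: B_def intro: convex_imp_contractible)
    then obtain \<rho> where \<rho>: "continuous_on B \<rho>" "\<forall>z\<in>B. \<rho> z ^ m = z" by (auto simp: has_root_def)
    have "continuous_on N (\<lambda>x. \<rho> (q x))"
      by (rule continuous_on_compose2[OF \<rho>(1) continuous_on_subset[OF q(1)]]) (use NV in auto)
    then show ?thesis unfolding has_root_def using \<rho>(2) NV by (intro exI[of _ "\<lambda>x. \<rho> (q x)"]) auto
  qed
  have "N - {p} = \<sigma>i ` (- cball 0 M)"
  proof (intro equalityI subsetI)
    fix x assume "x \<in> N - {p}"
    then have "\<sigma> x \<in> - cball 0 M" "x = \<sigma>i (\<sigma> x)" using N_iff[of x] \<sigma>i_\<sigma>[of x] by auto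
    then show "x \<in> \<sigma>i ` (- cball 0 M)" by blast
  next
    fix x assume "x \<in> \<sigma>i ` (- cball 0 M)"
    then show "x \<in> N - {p}" using \<sigma>i_in N_iff by auto
  qed
  moreover have "connected (- cball (0::complex) M)"
    by (rule connected_complement_bounded_convex) auto
  ultimately have conn: "connected (N - {p})" by (simp add: connected_continuous_image continuous_\<sigma>i)
  have eq: "(S2 - P - {p}) \<union> N = S2 - P" "(S2 - P - {p}) \<inter> N = N - {p}"
    using NV p N_iff[of p] by auto
  have "has_root m q ((S2 - P - {p}) \<union> N)"
  proof (rule has_root_Un[OF _ root_S _ root_N _ _ m])
    show "connected ((S2 - P - {p}) \<inter> N)" using conn eq(2) by simp
    show "\<And>x. x \<in> (S2 - P - {p}) \<inter> N \<Longrightarrow> q x \<noteq> 0" using q(2) by blast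
    show "openin (top_of_set ((S2 - P - {p}) \<union> N)) (S2 - P - {p})"
      unfolding eq(1) by (simp add: openin_delete)
    have "openin (top_of_set S2) N" unfolding N_def by (rule far_from_a_open)
    then show "openin (top_of_set ((S2 - P - {p}) \<union> N)) N"
      unfolding eq(1) by (rule openin_subset_trans) (use NV in auto)
  qed
  then show ?thesis by (simp add: eq(1))
qed

context sphere_coordinate
begin

definition power_map :: "nat \<Rightarrow> real ^ 3 \<Rightarrow> real ^ 3" where
  "power_map m x = (if x = b then b else \<sigma>i (\<sigma> x ^ m))"

lemma power_map_in: "power_map m x \<in> S2"
  using ab \<sigma>i_in by (simp add: power_map_def)

lemma power_map_eq_b: "power_map m x = b \<longleftrightarrow> x = b"
  using \<sigma>i_in by (simp add: power_map_def)

lemma power_map_eq_a: "m > 0 \<Longrightarrow> x \<in> S2 \<Longrightarrow> power_map m x = a \<longleftrightarrow> x = a"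
  using ab \<sigma>i_eq_a \<sigma>_eq_0 zero by (auto simp: power_map_def zero_power)

lemma locally_power_power_map:
  assumes m: "m > 0" and x: "x \<in> S2"
  shows "locally_power S2 S2 (power_map m) x (if x = a \<or> x = b then m else 1)"
proof -
  have sub: "power_map m ` (S2 - {b}) \<subseteq> S2 - {b}" "power_map m ` (S2 - {a}) \<subseteq> S2 - {a}"
    using power_map_in by (intro image_subsetI; simp add: power_map_eq_b power_map_eq_a[OF m])+
  have eq: "\<sigma> (power_map m u) = \<sigma> u ^ m" if "u \<in> S2 - {b}" for u
    using that by (simp add: power_map_def)
  have a: "power_map m a = a" and b: "power_map m b = b"
    using power_map_eq_a[OF m] power_map_eq_b ab by auto
  have ca: "chart S2 (S2 - {b}) \<sigma> (power_map m a)" using chart_a a by simp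
  have cb: "chart S2 (S2 - {a}) \<kappa> (power_map m b)" using chart_b b by simp
  have eqb: "\<kappa> (power_map m u) = \<kappa> u ^ m" if "u \<in> S2 - {a}" for u
    using that \<sigma>i_in m by (auto simp: \<kappa>_def power_map_def power_inverse)
  consider "x = a" | "x = b" | "x \<noteq> a" "x \<noteq> b" by blast
  then show ?thesis
  proof cases
    case 1
    then show ?thesis using locally_powerI[OF m chart_a ca sub(1) eq] by simp
  next
    case 2
    then show ?thesis using locally_powerI[OF m chart_b cb sub(2) eqb] by simp
  next
    case 3
    then show ?thesis
      using locally_power_off_centre[OF m chart_a ca sub(1) eq, of x] x by simp
  qed
qed

lemma branched_cover_power_map: "m > 0 \<Longrightarrow> branched_cover S2 S2 (power_map m)"
  using locally_power_power_map power_map_in S2_compact_connected_infinite by (intro branched_coverI) auto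

lemma local_degree_power_map:
  "m > 0 \<Longrightarrow> x \<in> S2 \<Longrightarrow> local_degree S2 S2 (power_map m) x = (if x = a \<or> x = b then m else 1)"
  by (rule local_degree_eq[OF locally_power_power_map])

lemma card_fibre_power_map:
  assumes m: "m > 0" and w: "w \<in> S2" "w \<noteq> a" "w \<noteq> b"
  shows "card {x \<in> S2. power_map m x = w} = m"
proof -
  have "bij_betw \<sigma>i {z. z ^ m = \<sigma> w} {x \<in> S2. power_map m x = w}"
    unfolding bij_betw_def
  proof
    show "inj_on \<sigma>i {z. z ^ m = \<sigma> w}" by (metis \<sigma>_\<sigma>i inj_onI)
    show "\<sigma>i ` {z. z ^ m = \<sigma> w} = {x \<in> S2. power_map m x = w}"
    proof (intro equalityI subsetI)
      fix x assume "x \<in> {x \<in> S2. power_map m x = w}"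
      then have x: "x \<in> S2" "x \<noteq> b" "\<sigma>i (\<sigma> x ^ m) = w" using w by (auto simp: power_map_def)
      then have "\<sigma> x ^ m = \<sigma> w" "x = \<sigma>i (\<sigma> x)" using \<sigma>i_\<sigma> by auto
      then show "x \<in> \<sigma>i ` {z. z ^ m = \<sigma> w}" by blast
    qed (use \<sigma>i_in \<sigma>i_\<sigma> w in \<open>auto simp: power_map_def\<close>)
  qed
  then have "card {z. z ^ m = \<sigma> w} = card {x \<in> S2. power_map m x = w}" by (rule bij_betw_same_card)
  moreover have "\<sigma> w \<noteq> 0" using \<sigma>_eq_0 w by blast
  ultimately show ?thesis using card_nth_roots[of "\<sigma> w" m] m by simp
qed

text \<open>
  In a chart \<open>\<Phi>\<close> at \<open>c\<close> the coordinate of \<open>f\<close> is \<open>\<Phi> ^ k\<close> at a zero and \<open>\<Phi> ^ (- k)\<close> at a pole, and \<open>m\<close>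
  divides \<open>k\<close>.
\<close>

lemma local_root_at_puncture:
  assumes lp: "locally_power S2 S2 f c k" and c: "f c = a \<or> f c = b" and dvd: "m dvd k"
  shows "\<exists>W. openin (top_of_set S2) W \<and> c \<in> W \<and> has_root m (\<lambda>y. \<sigma> (f y)) (W - {c})"
proof -
  obtain j where j: "k = j * m" using dvd by (metis dvd_def mult.commute)
  have k: "k > 0" using lp by (simp add: locally_power_def)
  show ?thesis
  proof (cases "f c = b")
    case False
    then have "chart S2 (S2 - {b}) \<sigma> (f c)" using chart_a c by simp
    then obtain U \<Phi> where U: "chart S2 U \<Phi> c" "\<And>u. u \<in> U \<Longrightarrow> \<sigma> (f u) = \<Phi> u ^ k"
      using locally_power_any_target_chart[OF lp] by metis
    have "continuous_on (U - {c}) (\<lambda>u. \<Phi> u ^ j)"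
      by (intro continuous_intros continuous_on_subset[OF chartD(6)[OF U(1)]]) auto
    then have "has_root m (\<lambda>y. \<sigma> (f y)) (U - {c})"
      unfolding has_root_def using U(2) j
      by (intro exI[of _ "\<lambda>u. \<Phi> u ^ j"]) (auto simp: power_mult)
    then show ?thesis using chartD(1,3)[OF U(1)] by blast
  next
    case True
    then have "chart S2 (S2 - {a}) \<kappa> (f c)" using chart_b by simp
    then obtain U \<Phi> where U: "chart S2 U \<Phi> c" "\<And>u. u \<in> U \<Longrightarrow> \<kappa> (f u) = \<Phi> u ^ k"
      using locally_power_any_target_chart[OF lp] by metis
    have nz: "\<Phi> u \<noteq> 0" if "u \<in> U - {c}" for u
      using that chartD(3,4)[OF U(1)] inj_onD[OF chartD(7)[OF U(1)], of u c] by auto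
    have eq: "\<sigma> (f u) = (inverse (\<Phi> u) ^ j) ^ m" if u: "u \<in> U - {c}" for u
    proof -
      have "\<kappa> (f u) \<noteq> 0" using U(2) nz[OF u] u by simp
      then have "\<kappa> (f u) = inverse (\<sigma> (f u))" by (auto simp: \<kappa>_def)
      then have "inverse (\<sigma> (f u)) = (\<Phi> u ^ j) ^ m" using U(2)[of u] u j by (simp add: power_mult)
      then show ?thesis by (metis inverse_inverse_eq power_inverse)
    qed
    have "continuous_on (U - {c}) (\<lambda>u. inverse (\<Phi> u) ^ j)"
      by (intro continuous_intros continuous_on_subset[OF chartD(6)[OF U(1)]]) (use nz in auto)
    then have "has_root m (\<lambda>y. \<sigma> (f y)) (U - {c})"
      unfolding has_root_def using eq by (intro exI[of _ "\<lambda>u. inverse (\<Phi> u) ^ j"]) simp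
    then show ?thesis using chartD(1,3)[OF U(1)] by blast
  qed
qed

text \<open>
  A lift is the same as a continuous \<open>m\<close>-th root \<open>r\<close> of the coordinate of \<open>f\<close>, extended by the zero and
  the pole. It is again a branched cover by \<open>locally_power_lift\<close>, where the divisibility is used a second
  time.
\<close>

theorem lift_through_power_map:
  assumes f: "branched_cover S2 S2 f" and m: "m > 0"
    and dvd: "\<And>y. y \<in> S2 \<Longrightarrow> f y = a \<or> f y = b \<Longrightarrow> m dvd local_degree S2 S2 f y"
  obtains g where "branched_cover S2 S2 g" "\<And>y. y \<in> S2 \<Longrightarrow> power_map m (g y) = f y"
proof -
  define P where "P = {y \<in> S2. f y = a} \<union> {y \<in> S2. f y = b}"
  have P: "finite P" "P \<subseteq> S2" using finite_fibre[OF f] by (auto simp: P_def)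
  have fS: "f y \<in> S2" if "y \<in> S2" for y
    using f that by (auto simp: branched_cover_def)
  have contf: "continuous_on S2 f" using f by (auto simp: branched_cover_def)
  have "has_root m (\<lambda>y. \<sigma> (f y)) (S2 - P)"
  proof (rule has_root_sphere_punctures[OF P _ _ _ m])
    show "continuous_on (S2 - P) (\<lambda>y. \<sigma> (f y))"
      by (rule continuous_on_compose2[OF continuous_\<sigma> continuous_on_subset[OF contf]])
         (use fS in \<open>auto simp: P_def\<close>)
    show "\<sigma> (f y) \<noteq> 0" if "y \<in> S2 - P" for y
      using that \<sigma>_eq_0[of "f y"] fS by (auto simp: P_def)
    show "\<exists>W. openin (top_of_set S2) W \<and> c \<in> W \<and> has_root m (\<lambda>y. \<sigma> (f y)) (W - {c})" if "c \<in> P" for c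
    proof (rule local_root_at_puncture)
      show "locally_power S2 S2 f c (local_degree S2 S2 f c)"
        using branched_cover_locally_power[OF f] that P by blast
    qed (use that dvd in \<open>auto simp: P_def\<close>)
  qed
  then obtain r where r: "continuous_on (S2 - P) r" "\<And>y. y \<in> S2 - P \<Longrightarrow> r y ^ m = \<sigma> (f y)"
    by (auto simp: has_root_def)
  define g where "g y = (if y \<in> P then f y else \<sigma>i (r y))" for y
  have gS: "g y \<in> S2" if "y \<in> S2" for y using that fS \<sigma>i_in by (auto simp: g_def)
  have pg: "power_map m (g y) = f y" if y: "y \<in> S2" for y
  proof (cases "y \<in> P")
    case True
    then have "f y = a \<or> f y = b" by (auto simp: P_def)
    then show ?thesis using True power_map_eq_a[OF m] power_map_eq_b ab by (auto simp: g_def)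
  next
    case False
    then have "f y \<noteq> b" using y by (auto simp: P_def)
    then show ?thesis
      using False r(2)[of y] y \<sigma>i_in \<sigma>i_\<sigma>[OF fS[OF y]] by (auto simp: g_def power_map_def)
  qed
  have \<sigma>g: "\<sigma> (g y) ^ m = \<sigma> (f y)" if "y \<in> S2" "g y \<noteq> b" for y
    using pg[OF that(1)] that(2) by (metis \<sigma>_\<sigma>i power_map_def)
  have g_ab: "g y = b \<longleftrightarrow> f y = b" "g y = a \<longleftrightarrow> f y = a" if "y \<in> S2" for y
    using pg[OF that] power_map_eq_a[OF m gS[OF that]] power_map_eq_b by metis+
  have contg: "continuous_on S2 g" unfolding continuous_on_def
  proof
    fix y assume y: "y \<in> S2"
    have lf: "(f \<longlongrightarrow> f y) (at y within S2)" using contf y by (simp add: continuous_on_def)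
    have evS: "eventually (\<lambda>u. u \<in> S2) (at y within S2)" by (auto simp: eventually_at_filter)
    show "(g \<longlongrightarrow> g y) (at y within S2)"
    proof (cases "y \<in> P")
      case False
      have "continuous_on (S2 - P) (\<lambda>u. \<sigma>i (r u))"
        by (rule continuous_on_compose2[OF continuous_\<sigma>i[of UNIV] r(1)]) auto
      then have "continuous_on (S2 - P) g" by (rule continuous_on_eq) (simp add: g_def)
      then have "(g \<longlongrightarrow> g y) (at y within S2 - P)" using y False by (auto simp: continuous_on_def)
      moreover have "at y within S2 = at y within S2 - P"
        by (rule at_within_nhd[of y "- P"]) (use False P in \<open>auto simp: open_Compl finite_imp_closed\<close>)
      ultimately show ?thesis by simp
    next
      case True
      then consider "f y = b" | "f y = a" "f y \<noteq> b" using ab by (auto simp: P_def)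
      then show ?thesis
      proof cases
        case 1
        have "(g \<longlongrightarrow> b) (at y within S2)"
        proof (rule tendsto_b)
          fix M :: real assume M: "M > 0"
          have "eventually (\<lambda>u. f u \<in> S2) (at y within S2)" using evS by eventually_elim (rule fS)
          with lf have "eventually (\<lambda>u. f u \<in> S2 \<and> (f u = b \<or> norm (\<sigma> (f u)) > M ^ m)) (at y within S2)"
            using 1 by (intro eventually_far) auto
          with evS show "eventually (\<lambda>u. g u \<in> S2 \<and> (g u = b \<or> norm (\<sigma> (g u)) > M)) (at y within S2)"
          proof eventually_elim
            case (elim u)
            have "norm (\<sigma> (g u)) > M" if "g u \<noteq> b"
            proof -
              have "M ^ m < norm (\<sigma> (g u)) ^ m"
                using elim that g_ab(1)[of u] \<sigma>g[of u] by (simp flip: norm_power)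
              then show ?thesis by (rule power_less_imp_less_base) simp
            qed
            then show ?case using gS elim by blast
          qed
        qed
        moreover have "g y = b" using 1 g_ab(1)[OF y] by simp
        ultimately show ?thesis by simp
      next
        case 2
        have gy: "g y = a" using 2 g_ab(2)[OF y] by simp
        have evb: "eventually (\<lambda>u. f u \<noteq> b) (at y within S2)"
          using lf 2 by (intro tendsto_imp_eventually_ne) 
        have "((\<lambda>u. \<sigma> (f u)) \<longlongrightarrow> \<sigma> (f y)) (at y within S2)"
        proof (rule continuous_on_tendsto_compose[OF continuous_\<sigma> lf])
          show "f y \<in> S2 - {b}" using ab 2 by simp
          show "eventually (\<lambda>u. f u \<in> S2 - {b}) (at y within S2)"
            using evS evb by eventually_elim (use fS in auto)
        qed
        then have s0: "((\<lambda>u. \<sigma> (f u)) \<longlongrightarrow> 0) (at y within S2)" using 2 zero by simp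
        have "((\<lambda>u. \<sigma> (g u)) \<longlongrightarrow> 0) (at y within S2)"
        proof (rule tendstoI)
          fix e :: real assume e: "e > 0"
          have "eventually (\<lambda>u. dist (\<sigma> (f u)) 0 < e ^ m) (at y within S2)"
            by (rule tendstoD[OF s0]) (use e in simp)
          with evS evb show "eventually (\<lambda>u. dist (\<sigma> (g u)) 0 < e) (at y within S2)"
          proof eventually_elim
            case (elim u)
            have "norm (\<sigma> (g u)) ^ m < e ^ m"
              using elim g_ab(1)[of u] \<sigma>g[of u] by (simp flip: norm_power)
            then show ?case using e by (simp add: power_less_imp_less_base)
          qed
        qed
        then have "((\<lambda>u. \<sigma>i (\<sigma> (g u))) \<longlongrightarrow> \<sigma>i 0) (at y within S2)"
          using continuous_on_tendsto_compose[OF continuous_\<sigma>i[of UNIV]] by simp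
        moreover have "eventually (\<lambda>u. \<sigma>i (\<sigma> (g u)) = g u) (at y within S2)"
          using evS evb by eventually_elim (use \<sigma>i_\<sigma> gS g_ab in auto)
        ultimately show ?thesis using gy \<sigma>i_0 by (simp add: tendsto_cong)
      qed
    qed
  qed
  have "branched_cover S2 S2 g"
  proof (rule branched_coverI)
    fix y assume y: "y \<in> S2"
    let ?l = "if g y = a \<or> g y = b then m else 1"
    have "?l dvd local_degree S2 S2 f y" using dvd[OF y] g_ab[OF y] by auto
    then obtain k where k: "local_degree S2 S2 f y = k * ?l" by (metis dvd_def mult.commute)
    have "locally_power S2 S2 f y (k * ?l)" using branched_cover_locally_power[OF f y] k by simp
    then have "locally_power S2 S2 (\<lambda>u. power_map m (g u)) y (k * ?l)"
      by (rule locally_power_cong) (use pg y in auto)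
    then have "locally_power S2 S2 g y k"
      by (rule locally_power_lift[OF _ locally_power_power_map[OF m gS[OF y]] contg]) (use gS in auto)
    then show "\<exists>m. locally_power S2 S2 g y m" by blast
  qed (use S2_compact_connected_infinite gS in auto)
  then show ?thesis using that pg by blast
qed

end

section \<open>Local degrees of a composite, and multiset lemmas\<close>

lemma branched_cover_compose:
  assumes g: "branched_cover Y X g" and h: "branched_cover X Z h"
    and f: "\<And>y. y \<in> Y \<Longrightarrow> f y = h (g y)"
  shows "branched_cover Y Z f"
    and "y \<in> Y \<Longrightarrow> local_degree Y Z f y = local_degree Y X g y * local_degree X Z h (g y)"
proof -
  have gX: "g y \<in> X" if "y \<in> Y" for y using g that by (auto simp: branched_cover_def)
  have lp: "locally_power Y Z f y (local_degree Y X g y * local_degree X Z h (g y))" if y: "y \<in> Y" for y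
    by (rule locally_power_cong[OF locally_power_compose[OF branched_cover_locally_power[OF g y]
          branched_cover_locally_power[OF h gX[OF y]]]]) (use f y in auto)
  have "f ` Y = h ` g ` Y" using f by force
  then have "f ` Y = Z" using g h by (simp add: branched_cover_def)
  then show "branched_cover Y Z f"
    unfolding branched_cover_def using lp locally_power_continuous_on[of Y Z f] by blast
  show "y \<in> Y \<Longrightarrow> local_degree Y Z f y = local_degree Y X g y * local_degree X Z h (g y)"
    using lp by (rule local_degree_eq)
qed

lemma image_mset_mset_set_UNION:
  assumes "finite I" "\<And>i. i \<in> I \<Longrightarrow> finite (A i)"
    and "\<And>i j. i \<in> I \<Longrightarrow> j \<in> I \<Longrightarrow> i \<noteq> j \<Longrightarrow> A i \<inter> A j = {}"
  shows "image_mset F (mset_set (\<Union>i\<in>I. A i)) = (\<Sum>i\<in>I. image_mset F (mset_set (A i)))"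
  using assms
proof (induction I rule: finite_induct)
  case (insert i I)
  have "A i \<inter> (\<Union>i\<in>I. A i) = {}" using insert.hyps insert.prems(2) by blast
  then have "mset_set (A i \<union> (\<Union>i\<in>I. A i)) = mset_set (A i) + mset_set (\<Union>i\<in>I. A i)"
    using insert by (intro mset_set_Union) auto
  then show ?case using insert by simp
qed simp

text \<open>
  The fibre of \<open>f\<close> over \<open>x\<close> is the disjoint union of the fibres of \<open>g\<close> over the points \<open>w\<close> with
  \<open>h w = x\<close>, and local degrees multiply.
\<close>

lemma local_degrees_over_compose:
  assumes Y: "compact Y" and X: "compact X"
    and g: "branched_cover Y X g" and h: "branched_cover X Z h"
    and f: "\<And>y. y \<in> Y \<Longrightarrow> f y = h (g y)"
    and e: "\<And>w. w \<in> X \<Longrightarrow> h w = x \<Longrightarrow> local_degree X Z h w = e"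
  shows "local_degrees_over Y Z f x =
    image_mset (\<lambda>b. e * b) (\<Sum>w | w \<in> X \<and> h w = x. local_degrees_over Y X g w)"
proof -
  have gX: "g y \<in> X" if "y \<in> Y" for y using g that by (auto simp: branched_cover_def)
  have fib: "{y \<in> Y. f y = x} = (\<Union>w\<in>{w \<in> X. h w = x}. {y \<in> Y. g y = w})"
    using f gX by auto
  have "local_degrees_over Y Z f x
      = (\<Sum>w | w \<in> X \<and> h w = x. image_mset (local_degree Y Z f) (mset_set {y \<in> Y. g y = w}))"
    unfolding local_degrees_over_def fib
    by (rule image_mset_mset_set_UNION) (use finite_fibre[OF h X] finite_fibre[OF g Y] in auto)
  also have "\<dots> = (\<Sum>w | w \<in> X \<and> h w = x. image_mset (\<lambda>b. e * b) (local_degrees_over Y X g w))"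
  proof (rule sum.cong[OF refl])
    fix w assume w: "w \<in> {w \<in> X. h w = x}"
    have "local_degree Y Z f y = e * local_degree Y X g y" if "y \<in> {y \<in> Y. g y = w}" for y
      using branched_cover_compose(2)[OF g h f, of y] that e w by simp
    then show "image_mset (local_degree Y Z f) (mset_set {y \<in> Y. g y = w}) =
        image_mset (\<lambda>b. e * b) (local_degrees_over Y X g w)"
      unfolding local_degrees_over_def using finite_fibre[OF g Y]
      by (simp add: multiset.map_comp comp_def) (rule image_mset_cong, simp)
  qed
  also have "\<dots> = image_mset (\<lambda>b. e * b) (\<Sum>w | w \<in> X \<and> h w = x. local_degrees_over Y X g w)"
  proof -
    have "(\<Sum>w\<in>I. image_mset (\<lambda>b. e * b) (local_degrees_over Y X g w))
        = image_mset (\<lambda>b. e * b) (\<Sum>w\<in>I. local_degrees_over Y X g w)" for I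
      by (induction I rule: infinite_finite_induct) auto
    then show ?thesis .
  qed
  finally show ?thesis .
qed

lemma in_local_degrees_over:
  assumes "branched_cover Y X f" "compact Y"
  shows "b \<in># local_degrees_over Y X f x \<longleftrightarrow> (\<exists>y\<in>Y. f y = x \<and> b = local_degree Y X f y)"
  unfolding local_degrees_over_def using finite_fibre[OF assms, of x] by auto

lemma branch_point_iff_nontrivial:
  assumes "branched_cover Y X f" "compact Y" "x \<in> X"
  shows "x \<in> branch_points Y X f \<longleftrightarrow> nontrivial (local_degrees_over Y X f x)"
  unfolding nontrivial_def branch_points_def
  using in_local_degrees_over[OF assms(1,2)] assms(3) by auto

lemma trivial_partition_unique:
  assumes "partition_of d p" "\<not> nontrivial p"
  shows "p = replicate_mset d 1"
proof -
  have "\<forall>b\<in>#p. b = 1"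
    using assms unfolding partition_of_def nontrivial_def by (metis One_nat_def Suc_lessI)
  then have "p = replicate_mset (sum_mset p) 1" by (induction p) auto
  then show ?thesis using assms(1) by (simp add: partition_of_def)
qed

lemma image_mset_mset_set_eq_imp_bij:
  assumes "finite S" "finite T" "image_mset f (mset_set S) = image_mset g (mset_set T)"
  obtains \<beta> where "bij_betw \<beta> S T" "\<And>s. s \<in> S \<Longrightarrow> g (\<beta> s) = f s"
proof -
  have "\<exists>\<beta>. bij_betw \<beta> S T \<and> (\<forall>s\<in>S. g (\<beta> s) = f s)"
    using assms
  proof (induction S arbitrary: T rule: finite_induct)
    case empty
    then have "T = {}" by (simp add: mset_set_empty_iff)
    then show ?case by (auto simp: bij_betw_def)
  next
    case (insert s S)
    have "f s \<in># image_mset g (mset_set T)" using insert by (metis finite_insert image_mset_add_mset mset_set.insert union_single_eq_member)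
    then obtain t where t: "t \<in> T" "g t = f s" using insert.prems by auto
    have "mset_set T = add_mset t (mset_set (T - {t}))" using t insert.prems(1) by (simp add: mset_set.remove)
    then have "image_mset f (mset_set S) = image_mset g (mset_set (T - {t}))"
      using insert.prems(2) insert.hyps t by simp
    then obtain \<beta> where \<beta>: "bij_betw \<beta> S (T - {t})" "\<forall>s\<in>S. g (\<beta> s) = f s"
      using insert.IH[of "T - {t}"] insert.prems(1) by auto
    define \<beta>' where "\<beta>' = \<beta>(s := t)"
    have "bij_betw \<beta>' S (T - {t})"
      using \<beta>(1) insert.hyps(2) by (subst bij_betw_cong[of S \<beta>' \<beta>]) (auto simp: \<beta>'_def)
    then have "bij_betw \<beta>' (S \<union> {s}) ((T - {t}) \<union> {\<beta>' s})"
      by (rule notIn_Un_bij_betw[rotated 2]) (use insert.hyps in \<open>auto simp: \<beta>'_def\<close>)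
    moreover have "(T - {t}) \<union> {\<beta>' s} = T" using t by (auto simp: \<beta>'_def)
    ultimately have "bij_betw \<beta>' (insert s S) T" by simp
    moreover have "\<forall>s\<in>insert s S. g (\<beta>' s) = f s" using \<beta>(2) t(2) by (auto simp: \<beta>'_def)
    ultimately show ?case by blast
  qed
  then show ?thesis using that by blast
qed

lemma exists_labelling:
  assumes "finite F" "card F = size P"
  shows "\<exists>lab. image_mset lab (mset_set F) = P"
  using assms
proof (induction F arbitrary: P rule: finite_induct)
  case (insert w F)
  then obtain p P' where P: "P = add_mset p P'" by (metis card_insert_disjoint size_Suc_Diff1 multi_nonempty_split size_empty nat.distinct(1))
  then obtain lab where lab: "image_mset lab (mset_set F) = P'" using insert by (auto)
  have "image_mset (lab(w := p)) (mset_set F) = image_mset lab (mset_set F)"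
    using insert.hyps by (intro image_mset_cong) auto
  then have "image_mset (lab(w := p)) (mset_set (insert w F)) = P"
    using insert.hyps lab P by simp
  then show ?case by blast
qed auto

section \<open>The dihedral cover\<close>

text \<open>
  The orbifold universal cover of the sphere with cone points \<open>x1, x2, x3\<close> of orders \<open>2, 2, t\<close>, with its
  universal property. The squaring map \<open>J\<close> with zero \<open>x1\<close> and pole \<open>x2\<close> unwinds the first two cone
  points and doubles the third into \<open>q\<close> and \<open>q'\<close>; the \<open>t\<close>-th power map \<open>R\<close> with zero \<open>q\<close> and pole
  \<open>q'\<close> unwinds these. A map \<open>f\<close> is lifted through \<open>J\<close> and then through \<open>R\<close>. The second lift exists
  since \<open>J\<close> is unramified at \<open>q\<close> and \<open>q'\<close>, so that the local degrees of \<open>f\<close> over \<open>x3\<close> are those of its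
  first lift over \<open>q\<close> and \<open>q'\<close>.
\<close>

lemma dihedral_cover:
  assumes x: "x1 \<in> S2" "x2 \<in> S2" "x3 \<in> S2" "x1 \<noteq> x2" "x1 \<noteq> x3" "x2 \<noteq> x3" and t: "t > 0"
  obtains h where "branched_cover S2 S2 h"
    "card {w \<in> S2. h w = x1} = t" "card {w \<in> S2. h w = x2} = t" "card {w \<in> S2. h w = x3} = 2"
    "\<And>x. x \<in> S2 \<Longrightarrow> x \<notin> {x1, x2, x3} \<Longrightarrow> card {w \<in> S2. h w = x} = 2 * t"
    "\<And>w. w \<in> S2 \<Longrightarrow> local_degree S2 S2 h w = (if h w = x1 \<or> h w = x2 then 2 else if h w = x3 then t else 1)"
    "\<And>f. \<lbrakk>branched_cover S2 S2 f;
       \<And>y. y \<in> S2 \<Longrightarrow> f y = x1 \<or> f y = x2 \<Longrightarrow> 2 dvd local_degree S2 S2 f y;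
       \<And>y. y \<in> S2 \<Longrightarrow> f y = x3 \<Longrightarrow> t dvd local_degree S2 S2 f y\<rbrakk>
      \<Longrightarrow> \<exists>g. branched_cover S2 S2 g \<and> (\<forall>y\<in>S2. f y = h (g y))"
proof -
  obtain \<sigma> \<sigma>i where "sphere_coordinate x1 x2 \<sigma> \<sigma>i" using sphere_coordinate_exists[OF x(1,2,4)] .
  then interpret A: sphere_coordinate x1 x2 \<sigma> \<sigma>i .
  have two: "(2::nat) > 0" by simp
  define J where "J = A.power_map 2"
  have J: "branched_cover S2 S2 J" unfolding J_def by (rule A.branched_cover_power_map[OF two])
  have JS: "J w \<in> S2" for w unfolding J_def by (rule A.power_map_in)
  have J1: "J w = x1 \<longleftrightarrow> w = x1" if "w \<in> S2" for w unfolding J_def by (rule A.power_map_eq_a[OF two that])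
  have J2: "J w = x2 \<longleftrightarrow> w = x2" for w unfolding J_def by (rule A.power_map_eq_b)
  have cardJ: "card {w \<in> S2. J w = v} = 2" if "v \<in> S2" "v \<noteq> x1" "v \<noteq> x2" for v
    unfolding J_def by (rule A.card_fibre_power_map[OF two that])
  have degJ: "local_degree S2 S2 J w = (if w = x1 \<or> w = x2 then 2 else 1)" if "w \<in> S2" for w
    unfolding J_def by (rule A.local_degree_power_map[OF two that])
  obtain q q' where q: "{w \<in> S2. J w = x3} = {q, q'}" "q \<noteq> q'"
    using cardJ[of x3] x by (auto simp: card_2_iff)
  then have qS: "q \<in> S2" "q' \<in> S2" "J q = x3" "J q' = x3" by blast+
  have Jx: "J x1 = x1" "J x2 = x2" using J1[of x1] J2[of x2] x by simp_all
  have q_ne: "q \<noteq> x1" "q \<noteq> x2" "q' \<noteq> x1" "q' \<noteq> x2" using qS Jx x by metis+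
  have J3: "J w = x3 \<longleftrightarrow> w = q \<or> w = q'" if "w \<in> S2" for w using q(1) that by blast
  obtain \<tau> \<tau>i where "sphere_coordinate q q' \<tau> \<tau>i" using sphere_coordinate_exists[OF qS(1,2) q(2)] .
  then interpret B: sphere_coordinate q q' \<tau> \<tau>i .
  define R where "R = B.power_map t"
  have R: "branched_cover S2 S2 R" unfolding R_def by (rule B.branched_cover_power_map[OF t])
  have RS: "R w \<in> S2" for w unfolding R_def by (rule B.power_map_in)
  have Rq: "R w = q \<longleftrightarrow> w = q" if "w \<in> S2" for w unfolding R_def by (rule B.power_map_eq_a[OF t that])
  have Rq': "R w = q' \<longleftrightarrow> w = q'" for w unfolding R_def by (rule B.power_map_eq_b)
  have cardR: "card {w \<in> S2. R w = v} = t" if "v \<in> S2" "v \<noteq> q" "v \<noteq> q'" for v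
    unfolding R_def by (rule B.card_fibre_power_map[OF t that])
  have degR: "local_degree S2 S2 R w = (if w = q \<or> w = q' then t else 1)" if "w \<in> S2" for w
    unfolding R_def by (rule B.local_degree_power_map[OF t that])
  define h where "h w = J (R w)" for w
  show ?thesis
  proof (rule that[of h])
    show "branched_cover S2 S2 h" by (rule branched_cover_compose(1)[OF R J]) (simp add: h_def)
    show "card {w \<in> S2. h w = x1} = t"
      using cardR[of x1] x q_ne J1[OF RS] by (simp add: h_def)
    show "card {w \<in> S2. h w = x2} = t"
      using cardR[of x2] x q_ne J2 by (simp add: h_def)
    have "{w \<in> S2. h w = x3} = {q, q'}"
      using J3[OF RS] Rq Rq' qS by (auto simp: h_def)
    then show "card {w \<in> S2. h w = x3} = 2" using q(2) by simp
    show "card {w \<in> S2. h w = v} = 2 * t" if v: "v \<in> S2" "v \<notin> {x1, x2, x3}" for v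
    proof -
      have fib: "{w \<in> S2. h w = v} = (\<Union>u\<in>{u \<in> S2. J u = v}. {w \<in> S2. R w = u})"
        using RS by (auto simp: h_def)
      have "card {w \<in> S2. h w = v} = (\<Sum>u | u \<in> S2 \<and> J u = v. card {w \<in> S2. R w = u})"
        unfolding fib
        by (rule card_UN_disjoint)
           (use finite_fibre[OF J S2_compact_connected_infinite(1)] finite_fibre[OF R S2_compact_connected_infinite(1)] in auto)
      also have "\<dots> = (\<Sum>u | u \<in> S2 \<and> J u = v. t)"
        using v qS by (intro sum.cong refl cardR) auto
      also have "\<dots> = 2 * t" using cardJ[of v] v by simp
      finally show ?thesis .
    qed
    show "local_degree S2 S2 h w = (if h w = x1 \<or> h w = x2 then 2 else if h w = x3 then t else 1)"
      if w: "w \<in> S2" for w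
    proof -
      have "local_degree S2 S2 h w = local_degree S2 S2 R w * local_degree S2 S2 J (R w)"
        by (rule branched_cover_compose(2)[OF R J _ w]) (simp add: h_def)
      then show ?thesis
        using degR[OF w] degJ[OF RS, of w] J1[OF RS, of w] J2[of "R w"] J3[OF RS, of w]
          Rq[OF w] Rq'[of w] q_ne x by (auto simp: h_def)
    qed
    show "\<exists>g. branched_cover S2 S2 g \<and> (\<forall>y\<in>S2. f y = h (g y))"
      if f: "branched_cover S2 S2 f"
        and f12: "\<And>y. y \<in> S2 \<Longrightarrow> f y = x1 \<or> f y = x2 \<Longrightarrow> 2 dvd local_degree S2 S2 f y"
        and f3: "\<And>y. y \<in> S2 \<Longrightarrow> f y = x3 \<Longrightarrow> t dvd local_degree S2 S2 f y" for f
    proof -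
      obtain g1 where g1: "branched_cover S2 S2 g1" "\<And>y. y \<in> S2 \<Longrightarrow> J (g1 y) = f y"
        using A.lift_through_power_map[OF f two f12] unfolding J_def by blast
      have g1S: "g1 y \<in> S2" if "y \<in> S2" for y using g1(1) that by (auto simp: branched_cover_def)
      have "t dvd local_degree S2 S2 g1 y" if y: "y \<in> S2" and gy: "g1 y = q \<or> g1 y = q'" for y
      proof -
        have "local_degree S2 S2 f y = local_degree S2 S2 g1 y * local_degree S2 S2 J (g1 y)"
          by (rule branched_cover_compose(2)[OF g1(1) J _ y]) (simp add: g1(2))
        moreover have "local_degree S2 S2 J (g1 y) = 1"
          using degJ[OF g1S[OF y]] gy q_ne by auto
        moreover have "f y = x3" using g1(2)[OF y] gy qS by auto
        ultimately show ?thesis using f3[OF y] by simp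
      qed
      then obtain g where g: "branched_cover S2 S2 g" "\<And>y. y \<in> S2 \<Longrightarrow> R (g y) = g1 y"
        using B.lift_through_power_map[OF g1(1) t] unfolding R_def by blast
      then show ?thesis using g1(2) by (intro exI[of _ g]) (simp add: h_def)
    qed
  qed
qed

text \<open>
  The order of the stabilizer, and below the size of the orbit, of a point over the \<open>k\<close>-th marked point
  under the dihedral group of order \<open>2t\<close>. The marked points from the fourth on lie under free orbits.
\<close>

definition isotropy_order :: "nat \<Rightarrow> nat \<Rightarrow> nat" where
  "isotropy_order t k = (if k = 1 \<or> k = 2 then 2 else if k = 3 then t else 1)"

definition orbit_size :: "nat \<Rightarrow> nat \<Rightarrow> nat" where
  "orbit_size t k = (if k = 1 \<or> k = 2 then t else if k = 3 then 2 else 2 * t)"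

lemma marked_dihedral_cover:
  assumes x: "x ` {1..n} \<subseteq> S2" "inj_on x {1..n}" and n: "n \<ge> 3" and t: "t > 0"
  obtains h where "branched_cover S2 S2 h"
    "\<And>k. k \<in> {1..n} \<Longrightarrow> card {w \<in> S2. h w = x k} = orbit_size t k"
    "\<And>k w. k \<in> {1..n} \<Longrightarrow> w \<in> S2 \<Longrightarrow> h w = x k \<Longrightarrow> local_degree S2 S2 h w = isotropy_order t k"
    "\<And>w. w \<in> S2 \<Longrightarrow> h w \<notin> x ` {1..n} \<Longrightarrow> local_degree S2 S2 h w = 1"
    "\<And>f. \<lbrakk>branched_cover S2 S2 f;
       \<And>k y. k \<in> {1..n} \<Longrightarrow> y \<in> S2 \<Longrightarrow> f y = x k \<Longrightarrow> isotropy_order t k dvd local_degree S2 S2 f y\<rbrakk>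
      \<Longrightarrow> \<exists>g. branched_cover S2 S2 g \<and> (\<forall>y\<in>S2. f y = h (g y))"
proof -
  have k: "1 \<in> {1..n}" "2 \<in> {1..n}" "3 \<in> {1..n}" using n by auto
  have eqx: "x i = x j \<longleftrightarrow> i = j" if "i \<in> {1..n}" "j \<in> {1..n}" for i j
    by (rule inj_on_eq_iff[OF x(2) that])
  have S: "x k \<in> S2" if "k \<in> {1..n}" for k using x(1) that by blast
  obtain h where h: "branched_cover S2 S2 h"
    "card {w \<in> S2. h w = x 1} = t" "card {w \<in> S2. h w = x 2} = t" "card {w \<in> S2. h w = x 3} = 2"
    "\<And>v. v \<in> S2 \<Longrightarrow> v \<notin> {x 1, x 2, x 3} \<Longrightarrow> card {w \<in> S2. h w = v} = 2 * t"
    "\<And>w. w \<in> S2 \<Longrightarrow> local_degree S2 S2 h w = (if h w = x 1 \<or> h w = x 2 then 2 else if h w = x 3 then t else 1)"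
    "\<And>f. \<lbrakk>branched_cover S2 S2 f;
       \<And>y. y \<in> S2 \<Longrightarrow> f y = x 1 \<or> f y = x 2 \<Longrightarrow> 2 dvd local_degree S2 S2 f y;
       \<And>y. y \<in> S2 \<Longrightarrow> f y = x 3 \<Longrightarrow> t dvd local_degree S2 S2 f y\<rbrakk>
      \<Longrightarrow> \<exists>g. branched_cover S2 S2 g \<and> (\<forall>y\<in>S2. f y = h (g y))"
    by (rule dihedral_cover[OF S[OF k(1)] S[OF k(2)] S[OF k(3)] _ _ _ t]) (use eqx k in \<open>simp_all\<close>)
  show ?thesis
  proof (rule that[OF h(1)])
    show "card {w \<in> S2. h w = x k} = orbit_size t k" if "k \<in> {1..n}" for k
      using h(2,3,4) h(5)[OF S[OF that]] eqx[OF that] k by (auto simp: orbit_size_def)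
    show "local_degree S2 S2 h w = isotropy_order t k" if "k \<in> {1..n}" "w \<in> S2" "h w = x k" for k w
      using h(6)[OF that(2)] that(3) eqx[OF that(1)] k by (simp add: isotropy_order_def)
    show "local_degree S2 S2 h w = 1" if "w \<in> S2" "h w \<notin> x ` {1..n}" for w
      using h(6)[OF that(1)] that(2) k by auto
    show "\<exists>g. branched_cover S2 S2 g \<and> (\<forall>y\<in>S2. f y = h (g y))"
      if f: "branched_cover S2 S2 f"
        "\<And>k y. k \<in> {1..n} \<Longrightarrow> y \<in> S2 \<Longrightarrow> f y = x k \<Longrightarrow> isotropy_order t k dvd local_degree S2 S2 f y" for f
    proof (rule h(7)[OF f(1)])
      show "2 dvd local_degree S2 S2 f y" if "y \<in> S2" "f y = x 1 \<or> f y = x 2" for y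
        using f(2)[OF k(1) that(1)] f(2)[OF k(2) that(1)] that(2) by (auto simp: isotropy_order_def)
      show "t dvd local_degree S2 S2 f y" if "y \<in> S2" "f y = x 3" for y
        using f(2)[OF k(3) that] by (simp add: isotropy_order_def)
    qed
  qed
qed

section \<open>Transfer of branching data along the dihedral cover\<close>

lemma has_degree_S2_iff:
  assumes "branched_cover S2 S2 f" "x \<in> S2"
  shows "has_degree S2 S2 f d \<longleftrightarrow> sum_mset (local_degrees_over S2 S2 f x) = d"
  by (rule has_degree_iff_sum_local_degrees[OF assms(1) S2_compact_connected_infinite(1,2,4) assms(2)])

lemma sum_mset_scaled: "sum_mset (image_mset (\<lambda>b. e * b) M) = e * sum_mset (M :: nat multiset)"
  by (induction M) (auto simp: algebra_simps)

lemma filter_mset_all: "(\<And>x. x \<in># M \<Longrightarrow> Q x) \<Longrightarrow> filter_mset Q M = M"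
  by (induction M) auto

text \<open>
  A realization \<open>f\<close> of the \<open>A k\<close> factors as \<open>h \<circ> g\<close>, and \<open>P k\<close> collects the partitions of \<open>g\<close> over the
  points of the fibre of \<open>h\<close> over the \<open>k\<close>-th branch point. Every branch point of \<open>g\<close> lies in one of these
  fibres, since \<open>h\<close> maps it to a branch point of \<open>f\<close>.
\<close>

lemma realized_data_descends:
  fixes A a :: "nat \<Rightarrow> nat multiset"
  assumes t: "t > 0" and n: "n \<ge> 3"
    and nontriv: "\<And>k. k \<in> {1..n} \<Longrightarrow> nontrivial (A k)"
    and A: "\<And>k. k \<in> {1..n} \<Longrightarrow> A k = image_mset (\<lambda>b. isotropy_order t k * b) (a k)"
    and real: "realized_on_S2 D {# A k. k \<in># mset_set {1..n} #}"
  obtains P where "\<And>k. k \<in> {1..n} \<Longrightarrow> decomposition (a k) (orbit_size t k) (D div (2 * t)) (P k)"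
    "realized_on_S2 (D div (2 * t)) (\<Sum>k=1..n. P k)"
proof -
  have "filter_mset nontrivial {# A k. k \<in># mset_set {1..n} #} = {# A k. k \<in># mset_set {1..n} #}"
    using nontriv by (intro filter_mset_all) auto
  then obtain f where f: "branched_cover S2 S2 f" "has_degree S2 S2 f D"
    and bd: "image_mset A (mset_set {1..n}) =
      image_mset (local_degrees_over S2 S2 f) (mset_set (branch_points S2 S2 f))"
    using real unfolding realized_on_S2_def branching_data_def by metis
  obtain x where x: "bij_betw x {1..n} (branch_points S2 S2 f)"
    and Ax: "\<And>k. k \<in> {1..n} \<Longrightarrow> local_degrees_over S2 S2 f (x k) = A k"
    using image_mset_mset_set_eq_imp_bij[OF _ finite_branch_points[OF f(1) S2_compact_connected_infinite(1)] bd] by auto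
  have inj: "inj_on x {1..n}" and im: "x ` {1..n} = branch_points S2 S2 f"
    using x by (auto simp: bij_betw_def)
  then have xS: "x ` {1..n} \<subseteq> S2" by (auto simp: branch_points_def)
  obtain h where h: "branched_cover S2 S2 h"
    "\<And>k. k \<in> {1..n} \<Longrightarrow> card {w \<in> S2. h w = x k} = orbit_size t k"
    "\<And>k w. k \<in> {1..n} \<Longrightarrow> w \<in> S2 \<Longrightarrow> h w = x k \<Longrightarrow> local_degree S2 S2 h w = isotropy_order t k"
    "\<And>w. w \<in> S2 \<Longrightarrow> h w \<notin> x ` {1..n} \<Longrightarrow> local_degree S2 S2 h w = 1"
    "\<And>f. \<lbrakk>branched_cover S2 S2 f;
       \<And>k y. k \<in> {1..n} \<Longrightarrow> y \<in> S2 \<Longrightarrow> f y = x k \<Longrightarrow> isotropy_order t k dvd local_degree S2 S2 f y\<rbrakk>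
      \<Longrightarrow> \<exists>g. branched_cover S2 S2 g \<and> (\<forall>y\<in>S2. f y = h (g y))"
    by (rule marked_dihedral_cover[OF xS inj n t]) blast
  have "isotropy_order t k dvd local_degree S2 S2 f y" if k: "k \<in> {1..n}" and y: "y \<in> S2" "f y = x k" for k y
  proof -
    have "local_degree S2 S2 f y \<in># local_degrees_over S2 S2 f (x k)"
      unfolding in_local_degrees_over[OF f(1) S2_compact_connected_infinite(1)] using y by blast
    then have "local_degree S2 S2 f y \<in># A k" by (simp only: Ax[OF k])
    then show ?thesis by (auto simp: A[OF k])
  qed
  then obtain g where g: "branched_cover S2 S2 g" "\<And>y. y \<in> S2 \<Longrightarrow> f y = h (g y)"
    using h(5)[OF f(1)] by blast
  let ?L = "local_degrees_over S2 S2 g"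
  define fib where "fib k = {w \<in> S2. h w = x k}" for k
  have finfib: "finite (fib k)" for k unfolding fib_def by (rule finite_fibre[OF h(1) S2_compact_connected_infinite(1)])
  have fib_disj: "fib i \<inter> fib j = {}" if "i \<in> {1..n}" "j \<in> {1..n}" "i \<noteq> j" for i j
    using inj_on_eq_iff[OF inj that(1,2)] that(3) by (auto simp: fib_def)
  define P where "P k = image_mset ?L (mset_set (fib k))" for k
  have a_eq: "a k = sum_mset (P k)" if k: "k \<in> {1..n}" for k
  proof -
    let ?e = "isotropy_order t k"
    have "A k = image_mset (\<lambda>b. ?e * b) (\<Sum>w\<in>fib k. ?L w)"
      using local_degrees_over_compose[OF S2_compact_connected_infinite(1,1) g(1) h(1) g(2) h(3)[OF k]] Ax[OF k]
      by (simp add: fib_def)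
    also have "(\<Sum>w\<in>fib k. ?L w) = sum_mset (P k)" by (simp add: P_def sum_unfold_sum_mset)
    finally have "image_mset (\<lambda>b. ?e * b) (a k) = image_mset (\<lambda>b. ?e * b) (sum_mset (P k))"
      using A[OF k] by simp
    moreover have "inj (\<lambda>b. ?e * b)" using t by (auto simp: inj_on_def isotropy_order_def)
    ultimately show ?thesis using multiset.inj_map by (metis injD)
  qed
  have k3: "3 \<in> {1..n}" using n by simp
  have "S2 \<noteq> {}" by (rule S2_compact_connected_infinite)
  then obtain w0 where w0: "w0 \<in> S2" by blast
  define N where "N = sum_mset (?L w0)"
  have degN: "has_degree S2 S2 g N" using has_degree_S2_iff[OF g(1) w0] by (simp add: N_def)
  have sumN: "sum_mset (?L w) = N" if "w \<in> S2" for w using has_degree_S2_iff[OF g(1) that] degN by simp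
  have "x 3 \<in> S2" using xS k3 by blast
  from has_degree_S2_iff[OF f(1) this] have "D = sum_mset (A 3)" using f(2) Ax[OF k3] by simp
  also have "\<dots> = t * sum_mset (a 3)" using A[OF k3] by (simp add: sum_mset_scaled isotropy_order_def)
  also have "sum_mset (a 3) = (\<Sum>w\<in>fib 3. sum_mset (?L w))"
  proof -
    have "sum_mset (sum_mset (image_mset ?L (mset_set B))) = (\<Sum>w\<in>B. sum_mset (?L w))" for B
      by (induction B rule: infinite_finite_induct) auto
    then show ?thesis unfolding a_eq[OF k3] P_def .
  qed
  also have "\<dots> = (\<Sum>w\<in>fib 3. N)" by (intro sum.cong refl sumN) (simp add: fib_def)
  also have "\<dots> = 2 * N" using h(2)[OF k3] by (simp add: fib_def orbit_size_def)
  finally have N: "D div (2 * t) = N" using t by simp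
  have dec: "decomposition (a k) (orbit_size t k) N (P k)" if k: "k \<in> {1..n}" for k
    unfolding decomposition_def
  proof (intro conjI ballI)
    show "size (P k) = orbit_size t k" using h(2)[OF k] by (simp add: P_def fib_def)
    show "sum_mset (P k) = a k" by (rule a_eq[OF k, symmetric])
    fix p assume "p \<in># P k"
    then obtain w where w: "w \<in> S2" "p = ?L w" using finfib[of k] by (auto simp: P_def fib_def)
    then show "partition_of N p"
      unfolding partition_of_def
      using sumN in_local_degrees_over[OF g(1) S2_compact_connected_infinite(1), of _ w] local_degree_pos[OF g(1)] by auto
  qed
  define F where "F = (\<Union>k\<in>{1..n}. fib k)"
  have sumP: "(\<Sum>k=1..n. P k) = image_mset ?L (mset_set F)"
    unfolding P_def F_def
    by (rule image_mset_mset_set_UNION[OF _ finfib fib_disj, symmetric]) simp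
  have "branch_points S2 S2 g \<subseteq> F"
  proof
    fix w assume "w \<in> branch_points S2 S2 g"
    then obtain y where y: "w \<in> S2" "y \<in> S2" "g y = w" "local_degree S2 S2 g y > 1"
      by (auto simp: branch_points_def)
    have "local_degree S2 S2 f y = local_degree S2 S2 g y * local_degree S2 S2 h (g y)"
      by (rule branched_cover_compose(2)[OF g(1) h(1) g(2) y(2)])
    moreover have "local_degree S2 S2 h (g y) > 0" by (rule local_degree_pos[OF h(1)]) (use y in simp)
    then have "local_degree S2 S2 g y * 1 \<le> local_degree S2 S2 g y * local_degree S2 S2 h (g y)"
      by (intro mult_le_mono2) simp
    ultimately have "local_degree S2 S2 f y > 1" using y(4) by linarith
    moreover have "f y \<in> S2" using f(1) y(2) by (auto simp: branched_cover_def)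
    ultimately have "f y \<in> x ` {1..n}" unfolding im branch_points_def using y(2) by blast
    then show "w \<in> F" using g(2)[OF y(2)] y by (auto simp: F_def fib_def)
  qed
  moreover have "F \<subseteq> S2" by (auto simp: F_def fib_def)
  ultimately have "branch_points S2 S2 g = {w \<in> F. nontrivial (?L w)}"
    using branch_point_iff_nontrivial[OF g(1) S2_compact_connected_infinite(1)] by (auto simp: branch_points_def[of S2 S2 g])
  moreover have "finite F" using finfib by (simp add: F_def)
  ultimately have "branching_data S2 S2 g = filter_mset nontrivial (\<Sum>k=1..n. P k)"
    unfolding branching_data_def sumP by (simp add: filter_mset_image_mset filter_mset_mset_set)
  then have "realized_on_S2 N (\<Sum>k=1..n. P k)"
    unfolding realized_on_S2_def using g(1) degN by blast
  then show ?thesis using that[of P] dec N by simp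
qed

text \<open>
  The marked points can be chosen anywhere. The partitions in \<open>P k\<close> are distributed over the fibre of
  \<open>h\<close> over the \<open>k\<close>-th marked point; the nontrivial ones are matched with the branch points of \<open>g\<close>, and a
  homeomorphism moves the latter to the points so labelled. The points with trivial labels are then no
  branch points of the moved map \<open>g'\<close>, and there is only one trivial partition of \<open>N\<close>.
\<close>

lemma realized_data_ascends:
  fixes A a :: "nat \<Rightarrow> nat multiset"
  assumes t: "t > 0" and n: "n \<ge> 3"
    and nontriv: "\<And>k. k \<in> {1..n} \<Longrightarrow> nontrivial (A k)"
    and sumA: "\<And>k. k \<in> {1..n} \<Longrightarrow> sum_mset (A k) = D"
    and A: "\<And>k. k \<in> {1..n} \<Longrightarrow> A k = image_mset (\<lambda>b. isotropy_order t k * b) (a k)"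
    and dec: "\<And>k. k \<in> {1..n} \<Longrightarrow> decomposition (a k) (orbit_size t k) N (P k)"
    and real: "realized_on_S2 N (\<Sum>k=1..n. P k)"
  shows "realized_on_S2 D {# A k. k \<in># mset_set {1..n} #}"
proof -
  obtain g where g: "branched_cover S2 S2 g" "has_degree S2 S2 g N"
    and bd: "branching_data S2 S2 g = filter_mset nontrivial (\<Sum>k=1..n. P k)"
    using real unfolding realized_on_S2_def by blast
  let ?L = "local_degrees_over S2 S2 g"
  obtain X where X: "finite X" "card X = n" "X \<subseteq> S2" using infinite_arbitrarily_large[OF S2_compact_connected_infinite(4)] by metis
  obtain x where x: "bij_betw x {1..n} X" using ex_bij_betw_nat_finite_1[OF X(1)] X(2) by auto
  then have inj: "inj_on x {1..n}" and xS: "x ` {1..n} \<subseteq> S2" using X(3) by (auto simp: bij_betw_def)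
  obtain h where h: "branched_cover S2 S2 h"
    "\<And>k. k \<in> {1..n} \<Longrightarrow> card {w \<in> S2. h w = x k} = orbit_size t k"
    "\<And>k w. k \<in> {1..n} \<Longrightarrow> w \<in> S2 \<Longrightarrow> h w = x k \<Longrightarrow> local_degree S2 S2 h w = isotropy_order t k"
    "\<And>w. w \<in> S2 \<Longrightarrow> h w \<notin> x ` {1..n} \<Longrightarrow> local_degree S2 S2 h w = 1"
    by (rule marked_dihedral_cover[OF xS inj n t]) blast
  define fib where "fib k = {w \<in> S2. h w = x k}" for k
  have finfib: "finite (fib k)" for k unfolding fib_def by (rule finite_fibre[OF h(1) S2_compact_connected_infinite(1)])
  have fib_disj: "fib i \<inter> fib j = {}" if "i \<in> {1..n}" "j \<in> {1..n}" "i \<noteq> j" for i j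
    using inj_on_eq_iff[OF inj that(1,2)] that(3) by (auto simp: fib_def)
  have "\<exists>l. image_mset l (mset_set (fib k)) = P k" if "k \<in> {1..n}" for k
    using exists_labelling[OF finfib, of k "P k"] h(2)[OF that] dec[OF that]
    by (simp add: fib_def decomposition_def)
  then obtain l where l: "\<And>k. k \<in> {1..n} \<Longrightarrow> image_mset (l k) (mset_set (fib k)) = P k" by metis
  define F where "F = (\<Union>k\<in>{1..n}. fib k)"
  have finF: "finite F" using finfib by (simp add: F_def)
  have FS: "F \<subseteq> S2" by (auto simp: F_def fib_def)
  define lab where "lab w = l (inv_into {1..n} x (h w)) w" for w
  have lab: "image_mset lab (mset_set (fib k)) = P k" if k: "k \<in> {1..n}" for k
  proof -
    have "image_mset lab (mset_set (fib k)) = image_mset (l k) (mset_set (fib k))"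
      using finfib[of k] inj k by (intro image_mset_cong) (auto simp: lab_def fib_def inv_into_f_f)
    then show ?thesis using l[OF k] by simp
  qed
  have lab_part: "partition_of N (lab w)" if w: "w \<in> F" for w
  proof -
    obtain k where k: "k \<in> {1..n}" "w \<in> fib k" using w by (auto simp: F_def)
    have "lab w \<in># image_mset lab (mset_set (fib k))" using k(2) finfib[of k] by simp
    then have "lab w \<in># P k" by (simp only: lab[OF k(1)])
    then show ?thesis using dec[OF k(1)] by (simp add: decomposition_def)
  qed
  have "(\<Sum>k=1..n. P k) = (\<Sum>k=1..n. image_mset lab (mset_set (fib k)))"
    by (intro sum.cong refl) (simp add: lab)
  also have "\<dots> = image_mset lab (mset_set F)"
    unfolding F_def
    by (rule image_mset_mset_set_UNION[OF _ finfib fib_disj, symmetric]) simp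
  finally have sumP: "(\<Sum>k=1..n. P k) = image_mset lab (mset_set F)" .
  define F' where "F' = {w \<in> F. nontrivial (lab w)}"
  have "image_mset lab (mset_set F') = image_mset ?L (mset_set (branch_points S2 S2 g))"
    using bd finF unfolding sumP branching_data_def F'_def
    by (simp add: filter_mset_image_mset filter_mset_mset_set)
  moreover have "finite F'" using finF by (simp add: F'_def)
  ultimately obtain \<beta> where \<beta>: "bij_betw \<beta> F' (branch_points S2 S2 g)" "\<And>w. w \<in> F' \<Longrightarrow> ?L (\<beta> w) = lab w"
    using image_mset_mset_set_eq_imp_bij[OF _ finite_branch_points[OF g(1) S2_compact_connected_infinite(1)]] by metis
  have F'S: "F' \<subseteq> S2" using FS by (auto simp: F'_def)
  have \<beta>S: "\<beta> ` F' \<subseteq> S2" "inj_on \<beta> F'" and \<beta>im: "\<beta> ` F' = branch_points S2 S2 g"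
    using \<beta>(1) by (auto simp: bij_betw_def branch_points_def)
  obtain \<theta> \<theta>' where \<theta>: "homeomorphism S2 S2 \<theta> \<theta>'" "\<And>w. w \<in> F' \<Longrightarrow> \<theta> w = \<beta> w"
    by (rule S2_move_points[of F' "\<lambda>w. w" \<beta>]) (use \<open>finite F'\<close> F'S \<beta>S in auto)
  have \<theta>S: "\<theta> w \<in> S2" "\<theta>' w \<in> S2" "\<theta>' (\<theta> w) = w" "\<theta> (\<theta>' w) = w" if "w \<in> S2" for w
    using \<theta>(1) that by (auto simp: homeomorphism_def)
  have \<theta>_branch: "w \<in> F'" if w: "w \<in> S2" "\<theta> w \<in> branch_points S2 S2 g" for w
  proof -
    obtain v where v: "v \<in> F'" "\<theta> w = \<beta> v" using w(2) unfolding \<beta>im[symmetric] by blast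
    have eq: "\<theta> w = \<theta> v" using v(2) \<theta>(2)[OF v(1)] by (rule trans[OF _ sym])
    have vS: "v \<in> S2" using v(1) F'S by blast
    have "w = v" using \<theta>S(3)[OF w(1)] unfolding eq \<theta>S(3)[OF vS] by (rule sym)
    then show ?thesis using v(1) by simp
  qed
  have L\<theta>: "?L (\<theta> w) = lab w" if w: "w \<in> F" for w
  proof (cases "w \<in> F'")
    case True
    then show ?thesis using \<theta>(2) \<beta>(2) by simp
  next
    case False
    have wS: "w \<in> S2" using w FS by blast
    have "\<not> nontrivial (?L (\<theta> w))"
      using \<theta>_branch[OF wS] False branch_point_iff_nontrivial[OF g(1) S2_compact_connected_infinite(1) \<theta>S(1)[OF wS]] by blast
    moreover have "partition_of N (?L (\<theta> w))"
      unfolding partition_of_def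
      using has_degree_S2_iff[OF g(1) \<theta>S(1)[OF wS]] g(2) local_degree_pos[OF g(1)]
        in_local_degrees_over[OF g(1) S2_compact_connected_infinite(1)] by auto
    moreover have "\<not> nontrivial (lab w)" using False w by (simp add: F'_def)
    ultimately show ?thesis using trivial_partition_unique lab_part[OF w] by metis
  qed
  define g' where "g' y = \<theta>' (g y)" for y
  have h\<theta>: "homeomorphism S2 S2 \<theta>' \<theta>" using \<theta>(1) by (rule homeomorphism_symD)
  have lp\<theta>: "locally_power S2 S2 \<theta>' w 1" if "w \<in> S2" for w by (rule locally_power_homeomorphism[OF h\<theta> that])
  have bc\<theta>: "branched_cover S2 S2 \<theta>'"
    using lp\<theta> \<theta>S S2_compact_connected_infinite by (intro branched_coverI) auto
  have g': "branched_cover S2 S2 g'" by (rule branched_cover_compose(1)[OF g(1) bc\<theta>]) (simp add: g'_def)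
  have gS: "g y \<in> S2" "g' y \<in> S2" if "y \<in> S2" for y
    using g(1) g' that by (auto simp: branched_cover_def)
  have g'_deg: "local_degree S2 S2 g' y = local_degree S2 S2 g y" if y: "y \<in> S2" for y
    using branched_cover_compose(2)[OF g(1) bc\<theta> _ y, of g'] local_degree_eq[OF lp\<theta>[OF gS(1)[OF y]]]
    by (simp add: g'_def)
  have g'_L: "local_degrees_over S2 S2 g' w = ?L (\<theta> w)" if w: "w \<in> S2" for w
  proof -
    have "g' y = w \<longleftrightarrow> g y = \<theta> w" if "y \<in> S2" for y
      using \<theta>S(3)[OF w] \<theta>S(4)[OF gS(1)[OF that]] unfolding g'_def by metis
    then have "{y \<in> S2. g' y = w} = {y \<in> S2. g y = \<theta> w}" by blast
    then have "local_degrees_over S2 S2 g' w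
        = image_mset (local_degree S2 S2 g') (mset_set {y \<in> S2. g y = \<theta> w})"
      by (simp only: local_degrees_over_def)
    also have "\<dots> = ?L (\<theta> w)"
      unfolding local_degrees_over_def
    proof (rule image_mset_cong)
      fix y assume "y \<in># mset_set {y \<in> S2. g y = \<theta> w}"
      then have "y \<in> S2" using finite_fibre[OF g(1) S2_compact_connected_infinite(1), of "\<theta> w"] by simp
      then show "local_degree S2 S2 g' y = local_degree S2 S2 g y" by (rule g'_deg)
    qed
    finally show ?thesis .
  qed
  define f where "f y = h (g' y)" for y
  have f: "branched_cover S2 S2 f" by (rule branched_cover_compose(1)[OF g' h(1)]) (simp add: f_def)
  have fx: "local_degrees_over S2 S2 f (x k) = A k" if k: "k \<in> {1..n}" for k
  proof -
    have "local_degrees_over S2 S2 f (x k) =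
        image_mset (\<lambda>b. isotropy_order t k * b) (\<Sum>w\<in>fib k. local_degrees_over S2 S2 g' w)"
      unfolding fib_def
      by (rule local_degrees_over_compose[OF S2_compact_connected_infinite(1,1) g' h(1)]) (use h(3)[OF k] in \<open>auto simp: f_def\<close>)
    also have "(\<Sum>w\<in>fib k. local_degrees_over S2 S2 g' w) = (\<Sum>w\<in>fib k. lab w)"
    proof (rule sum.cong[OF refl])
      fix w assume "w \<in> fib k"
      then have "w \<in> F" "w \<in> S2" using k by (auto simp: F_def fib_def)
      then show "local_degrees_over S2 S2 g' w = lab w" using g'_L L\<theta> by simp
    qed
    also have "\<dots> = sum_mset (P k)" using lab[OF k] by (simp add: sum_unfold_sum_mset)
    also have "\<dots> = a k" using dec[OF k] by (simp add: decomposition_def)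
    finally show ?thesis using A[OF k] by simp
  qed
  have bp: "branch_points S2 S2 f = x ` {1..n}"
  proof (intro equalityI subsetI)
    fix v assume "v \<in> x ` {1..n}"
    then show "v \<in> branch_points S2 S2 f"
      using fx nontriv xS branch_point_iff_nontrivial[OF f S2_compact_connected_infinite(1)] by auto
  next
    fix v assume "v \<in> branch_points S2 S2 f"
    then obtain y where y: "y \<in> S2" "f y = v" "local_degree S2 S2 f y > 1" by (auto simp: branch_points_def)
    show "v \<in> x ` {1..n}"
    proof (rule ccontr)
      assume v: "v \<notin> x ` {1..n}"
      have "local_degree S2 S2 h (g' y) = 1"
        by (rule h(4)[OF gS(2)[OF y(1)]]) (use v y in \<open>auto simp: f_def\<close>)
      then have "local_degree S2 S2 g y > 1"
        using branched_cover_compose(2)[OF g' h(1) _ y(1), of f] y g'_deg by (simp add: f_def)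
      then have "g y \<in> branch_points S2 S2 g" using gS y by (auto simp: branch_points_def)
      then have "g' y \<in> F'" using \<theta>_branch[OF gS(2)[OF y(1)]] \<theta>S(4)[OF gS(1)[OF y(1)]] by (simp add: g'_def)
      then show False using v y(2) by (auto simp: F'_def F_def fib_def f_def)
    qed
  qed
  have k1: "1 \<in> {1..n}" using n by simp
  then have "x 1 \<in> S2" using xS by blast
  from has_degree_S2_iff[OF f this] have "has_degree S2 S2 f D" unfolding fx[OF k1] sumA[OF k1] by simp
  moreover have "branching_data S2 S2 f = filter_mset nontrivial {# A k. k \<in># mset_set {1..n} #}"
  proof -
    have "branching_data S2 S2 f = image_mset (local_degrees_over S2 S2 f) (image_mset x (mset_set {1..n}))"
      unfolding branching_data_def bp using inj by (simp add: image_mset_mset_set)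
    also have "\<dots> = {# A k. k \<in># mset_set {1..n} #}"
      using fx by (simp add: multiset.map_comp comp_def) (intro image_mset_cong, simp)
    also have "\<dots> = filter_mset nontrivial {# A k. k \<in># mset_set {1..n} #}"
      using nontriv by (intro filter_mset_all[symmetric]) auto
    finally show ?thesis .
  qed
  ultimately show ?thesis unfolding realized_on_S2_def using f by blast
qed

theorem theorem1p2:
  fixes d' t n :: nat
    and A a :: "nat \<Rightarrow> nat multiset"
  assumes "d' \<ge> 2" and "t \<ge> 2" and "n \<ge> 3" and "t dvd d'"
    and "\<forall>k\<in>{1..n}. partition_of (2 * d') (A k) \<and> nontrivial (A k)"
    and "\<forall>k\<in>{1..n}. \<forall>b \<in># a k. b \<ge> 1"
    and "A 1 = image_mset (\<lambda>b. 2 * b) (a 1)"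
    and "A 2 = image_mset (\<lambda>b. 2 * b) (a 2)"
    and "A 3 = image_mset (\<lambda>b. t * b) (a 3)"
    and "\<forall>k\<in>{4..n}. A k = a k"
    and "(\<Sum>k=1..n. size (a k)) = 2 * (n - 2) * d' + 2"
  shows "realized_on_S2 (2 * d') {# A k. k \<in># mset_set {1..n} #}
    \<longleftrightarrow> (\<exists>P :: nat \<Rightarrow> nat multiset multiset.
          decomposition (a 3) 2 (d' div t) (P 3) \<and>
          decomposition (a 1) t (d' div t) (P 1) \<and>
          decomposition (a 2) t (d' div t) (P 2) \<and>
          (\<forall>k\<in>{4..n}. decomposition (A k) (2 * t) (d' div t) (P k)) \<and>
          realized_on_S2 (d' div t) (\<Sum>k=1..n. P k))"
proof -
  have t: "t > 0" using assms(2) by simp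
  have idx: "{1..n} = {1, 2, 3} \<union> {4..n}" using assms(3) by auto
  have A: "A k = image_mset (\<lambda>b. isotropy_order t k * b) (a k)" if k: "k \<in> {1..n}" for k
  proof (cases "k \<ge> 4")
    case True
    then have "isotropy_order t k = 1" by (simp add: isotropy_order_def)
    then show ?thesis using assms(10) k True by (simp only: mult_1 multiset.map_ident) simp
  next
    case False
    then have "k = 1 \<or> k = 2 \<or> k = 3" using k by auto
    then show ?thesis using assms(7-9) by (auto simp: isotropy_order_def)
  qed
  have nontriv: "nontrivial (A k)" and sumA: "sum_mset (A k) = 2 * d'" if "k \<in> {1..n}" for k
    using assms(5) that by (auto simp: partition_of_def)
  have deg: "2 * d' div (2 * t) = d' div t" by simp
  have dec_iff: "(decomposition (a 3) 2 (d' div t) (P 3) \<and>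
          decomposition (a 1) t (d' div t) (P 1) \<and>
          decomposition (a 2) t (d' div t) (P 2) \<and>
          (\<forall>k\<in>{4..n}. decomposition (A k) (2 * t) (d' div t) (P k)))
      \<longleftrightarrow> (\<forall>k\<in>{1..n}. decomposition (a k) (orbit_size t k) (d' div t) (P k))" for P
    using assms(10) unfolding idx by (auto simp: orbit_size_def)
  show ?thesis
  proof
    assume "realized_on_S2 (2 * d') {# A k. k \<in># mset_set {1..n} #}"
    from realized_data_descends[OF t assms(3) nontriv A this] obtain P where
      "\<And>k. k \<in> {1..n} \<Longrightarrow> decomposition (a k) (orbit_size t k) (d' div t) (P k)"
      "realized_on_S2 (d' div t) (\<Sum>k=1..n. P k)" unfolding deg by blast
    then show "\<exists>P. decomposition (a 3) 2 (d' div t) (P 3) \<and>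
          decomposition (a 1) t (d' div t) (P 1) \<and>
          decomposition (a 2) t (d' div t) (P 2) \<and>
          (\<forall>k\<in>{4..n}. decomposition (A k) (2 * t) (d' div t) (P k)) \<and>
          realized_on_S2 (d' div t) (\<Sum>k=1..n. P k)"
      using dec_iff by blast
  next
    assume "\<exists>P. decomposition (a 3) 2 (d' div t) (P 3) \<and>
          decomposition (a 1) t (d' div t) (P 1) \<and>
          decomposition (a 2) t (d' div t) (P 2) \<and>
          (\<forall>k\<in>{4..n}. decomposition (A k) (2 * t) (d' div t) (P k)) \<and>
          realized_on_S2 (d' div t) (\<Sum>k=1..n. P k)"
    then obtain P where
      dec: "\<And>k. k \<in> {1..n} \<Longrightarrow> decomposition (a k) (orbit_size t k) (d' div t) (P k)"
      and real: "realized_on_S2 (d' div t) (\<Sum>k=1..n. P k)" using dec_iff by blast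
    show "realized_on_S2 (2 * d') {# A k. k \<in># mset_set {1..n} #}"
      by (rule realized_data_ascends[OF t assms(3) nontriv sumA A dec real])
  qed
qed

end
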